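(* Let $\sigma\in\mathbb R$, let $V:\mathbb R\to\mathbb R$ be smooth, and let $\hat u(z,k)$ be a family of nonconstant functions, $2\pi$-periodic in $z$ and depending smoothly on $(z,k)$ for $k$ in an open interval of nonzero reals, such that $k^4\hat u_{zzzz}+\sigma k^2\hat u_{zz}+V'(\hat u)=0$ for each $k$. Let $A(k)=\frac1{2\pi}\int_0^{2\pi}(\sigma k\hat u_z^2-2k^3\hat u_{zz}^2)\,dz$, and let $k_0$ be a value of $k$ with $$A_k(k_0)=A_{kk}(k_0)=0 .$$ Assume that the kernel of $\mathbf L_0=k_0^4\partial_z^4+\sigma k_0^2\partial_z^2+V''(\hat u(\cdot,k_0))$ on $2\pi$-periodic functions is spanned by $\hat u_z(\cdot,k_0)$. Let $q(X)$ be a smooth function and let $\phi$ satisfy $\phi_X=q$. Consider the modulation ansatz $$u(x)=\hat u\big(\theta,k_0+\varepsilon q(X)\big)+\varepsilon^2w_2(\theta,X)+\varepsilon^3w_3(\theta,X)+\varepsilon^4w_4(\theta,X),\qquad \theta=k_0x+\phi(X),\quad X=\varepsilon x ,$$ with $w_2,w_3,w_4$ smooth and $2\pi$-periodic in $\theta$, substituted in $u_{xxxx}+\sigma u_{xx}+V'(u)$ and formally expanded in powers of $\varepsilon$. Then $w_2,w_3,w_4$ can be chosen so that the coefficients of $\varepsilon^0,\varepsilon^1,\varepsilon^2,\varepsilon^3,\varepsilon^4$ all vanish (as functions of $(\theta,X)$) if and only if $q$ satisfies $$\mathscr K\,q_{XXX}+\tfrac12A_{kkk}(k_0)\,q^2q_X=0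 ,$$ where $\mathscr K$ is the constant defined in the context.
   Context: In the expansion, $\frac{d}{dx}$ acts on functions of $(\theta,X)$ as $(k_0+\varepsilon q(X))\partial_\theta+\varepsilon\partial_X$, with $\theta$ and $X$ treated as independent variables. Inner product of real $2\pi$-periodic functions: $\langle\langle a,b\rangle\rangle=\frac1{2\pi}\int_0^{2\pi}a(z)b(z)\,dz$. The constant $\mathscr K$: with everything evaluated at $k=k_0$, set $\xi_1=\hat u_z$, $\xi_2=\hat u_k$, and let $\xi_3,\xi_4$ be $2\pi$-periodic functions with $$\mathbf L_0\xi_3=-\big(4k^3\partial_z^3+2\sigma k\,\partial_z\big)\xi_2-\big(6k^2\partial_z^2+\sigma\big)\xi_1,$$ $$\mathbf L_0\xi_4=-\big(4k^3\partial_z^3+2\sigma k\,\partial_z\big)\xi_3-\big(6k^2\partial_z^2+\sigma\big)\xi_2-4k\,\partial_z\xi_1$$ (these exist when $A_k(k_0)=0$). Then $$\mathscr K=\big\langle\big\langle\hat u_z,\;4k^3(\xi_4)_{zzz}+2\sigma k(\xi_4)_z+6k^2(\xi_3)_{zz}+\sigma\xi_3+4k\hat u_{zk}+\hat u_z\big\rangle\big\rangle .$$ *)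

theory Defs
  imports "HOL-Analysis.Analysis"
begin

primrec Ck_on :: "nat \<Rightarrow> 'a::real_normed_vector set \<Rightarrow> ('a \<Rightarrow> 'b::real_normed_vector) \<Rightarrow> bool" where
  "Ck_on 0 S f \<longleftrightarrow> continuous_on S f"
| "Ck_on (Suc n) S f \<longleftrightarrow>
     (\<forall>x\<in>S. f differentiable (at x)) \<and> (\<forall>v. Ck_on n S (\<lambda>x. frechet_derivative f (at x) v))"

text \<open>Intended for open \<open>S\<close>, since the derivatives are full derivatives \<open>at x\<close>.\<close>

definition smooth_on :: "'a::real_normed_vector set \<Rightarrow> ('a \<Rightarrow> 'b::real_normed_vector) \<Rightarrow> bool" where
  "smooth_on S f \<longleftrightarrow> (\<forall>n. Ck_on n S f)"

definition pd1 :: "(real \<Rightarrow> real \<Rightarrow> real) \<Rightarrow> real \<Rightarrow> real \<Rightarrow> real" where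
  "pd1 f x y = deriv (\<lambda>s. f s y) x"

definition pd2 :: "(real \<Rightarrow> real \<Rightarrow> real) \<Rightarrow> real \<Rightarrow> real \<Rightarrow> real" where
  "pd2 f x y = deriv (\<lambda>s. f x s) y"

definition ip :: "(real \<Rightarrow> real) \<Rightarrow> (real \<Rightarrow> real) \<Rightarrow> real" where
  "ip a b = 1 / (2 * pi) * integral {0..2*pi} (\<lambda>z. a z * b z)"

definition smooth_periodic :: "(real \<Rightarrow> real) \<Rightarrow> bool" where
  "smooth_periodic f \<longleftrightarrow> smooth_on UNIV f \<and> periodic_fun_simple f (2 * pi)"

text \<open>
  Throughout, \<open>u z k\<close> is the family of periodic waves, \<open>V\<close> the potential.
\<close>

definition action :: "real \<Rightarrow> (real \<Rightarrow> real \<Rightarrow> real) \<Rightarrow> real \<Rightarrow> real" where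
  "action \<sigma> u k = 1 / (2 * pi) *
     integral {0..2*pi} (\<lambda>z. \<sigma> * k * (pd1 u z k)^2 - 2 * k^3 * ((pd1 ^^ 2) u z k)^2)"

definition L0 :: "real \<Rightarrow> (real \<Rightarrow> real) \<Rightarrow> (real \<Rightarrow> real \<Rightarrow> real) \<Rightarrow> real \<Rightarrow> (real \<Rightarrow> real) \<Rightarrow> real \<Rightarrow> real" where
  "L0 \<sigma> V u k f z =
     k^4 * (deriv ^^ 4) f z + \<sigma> * k^2 * (deriv ^^ 2) f z + (deriv ^^ 2) V (u z k) * f z"

definition xi1 :: "(real \<Rightarrow> real \<Rightarrow> real) \<Rightarrow> real \<Rightarrow> real \<Rightarrow> real" where
  "xi1 u k z = pd1 u z k"

definition xi2 :: "(real \<Rightarrow> real \<Rightarrow> real) \<Rightarrow> real \<Rightarrow> real \<Rightarrow> real" where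
  "xi2 u k z = pd2 u z k"

definition is_xi34 ::
  "real \<Rightarrow> (real \<Rightarrow> real) \<Rightarrow> (real \<Rightarrow> real \<Rightarrow> real) \<Rightarrow> real \<Rightarrow> (real \<Rightarrow> real) \<Rightarrow> (real \<Rightarrow> real) \<Rightarrow> bool" where
  "is_xi34 \<sigma> V u k \<xi>3 \<xi>4 \<longleftrightarrow>
     smooth_periodic \<xi>3 \<and> smooth_periodic \<xi>4 \<and>
     (\<forall>z. L0 \<sigma> V u k \<xi>3 z =
        - (4 * k^3 * (deriv ^^ 3) (xi2 u k) z + 2 * \<sigma> * k * deriv (xi2 u k) z)
        - (6 * k^2 * (deriv ^^ 2) (xi1 u k) z + \<sigma> * xi1 u k z)) \<and>
     (\<forall>z. L0 \<sigma> V u k \<xi>4 z =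
        - (4 * k^3 * (deriv ^^ 3) \<xi>3 z + 2 * \<sigma> * k * deriv \<xi>3 z)
        - (6 * k^2 * (deriv ^^ 2) (xi2 u k) z + \<sigma> * xi2 u k z)
        - 4 * k * deriv (xi1 u k) z)"

definition K_const ::
  "real \<Rightarrow> (real \<Rightarrow> real \<Rightarrow> real) \<Rightarrow> real \<Rightarrow> (real \<Rightarrow> real) \<Rightarrow> (real \<Rightarrow> real) \<Rightarrow> real" where
  "K_const \<sigma> u k \<xi>3 \<xi>4 =
     ip (\<lambda>z. pd1 u z k)
        (\<lambda>z. 4 * k^3 * (deriv ^^ 3) \<xi>4 z + 2 * \<sigma> * k * deriv \<xi>4 z
           + 6 * k^2 * (deriv ^^ 2) \<xi>3 z + \<sigma> * \<xi>3 z
           + 4 * k * pd2 (pd1 u) z k + pd1 u z k)"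

definition ddx :: "real \<Rightarrow> (real \<Rightarrow> real) \<Rightarrow> real \<Rightarrow> (real \<Rightarrow> real \<Rightarrow> real) \<Rightarrow> real \<Rightarrow> real \<Rightarrow> real" where
  "ddx k0 q \<epsilon> F \<theta> X = (k0 + \<epsilon> * q X) * pd1 F \<theta> X + \<epsilon> * pd2 F \<theta> X"

text \<open>\<^const>\<open>ddx\<close> is \<open>d/dx\<close> along \<open>\<theta> = k0 x + \<phi>(X)\<close>, \<open>X = \<epsilon> x\<close> with \<open>\<phi>\<close> a primitive of \<open>q\<close>:\<close>

lemma ddx_chain_rule:
  assumes F: "(\<lambda>(\<theta>, X). F \<theta> X) differentiable (at (k0 * x + \<phi> (\<epsilon> * x), \<epsilon> * x))"
    and \<phi>: "(\<phi> has_real_derivative q (\<epsilon> * x)) (at (\<epsilon> * x))"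
  shows "((\<lambda>x. F (k0 * x + \<phi> (\<epsilon> * x)) (\<epsilon> * x)) has_real_derivative
           ddx k0 q \<epsilon> F (k0 * x + \<phi> (\<epsilon> * x)) (\<epsilon> * x)) (at x)"
proof -
  define a b where "a = k0 * x + \<phi> (\<epsilon> * x)" and "b = \<epsilon> * x"
  obtain F' where F': "((\<lambda>(\<theta>, X). F \<theta> X) has_derivative F') (at (a, b))"
    using F unfolding a_def b_def differentiable_def by blast
  interpret F': bounded_linear F' using F' by (rule has_derivative_bounded_linear)
  have lin: "F' (r, s) = r * F' (1, 0) + s * F' (0, 1)" for r s
    using F'.add[of "(r, 0)" "(0, s)"] F'.scaleR[of r "(1, 0)"] F'.scaleR[of s "(0, 1)"] by simp
  have e1: "(\<lambda>h. F' (h, 0)) = (*) (F' (1, 0))" and e2: "(\<lambda>h. F' (0, h)) = (*) (F' (0, 1))"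
    by (rule ext, subst lin, simp)+
  have "((\<lambda>s. case (s, b) of (\<theta>, X) \<Rightarrow> F \<theta> X) has_derivative (\<lambda>h. F' (h, 0))) (at a)"
    by (rule has_derivative_compose[where f = "\<lambda>s. (s, b)", OF _ F'])
      (auto intro!: derivative_eq_intros)
  then have "((\<lambda>s. F s b) has_real_derivative F' (1, 0)) (at a)"
    by (simp add: has_field_derivative_def e1)
  then have p1: "pd1 F a b = F' (1, 0)"
    unfolding pd1_def by (rule DERIV_imp_deriv)
  have "((\<lambda>s. case (a, s) of (\<theta>, X) \<Rightarrow> F \<theta> X) has_derivative (\<lambda>h. F' (0, h))) (at b)"
    by (rule has_derivative_compose[where f = "\<lambda>s. (a, s)", OF _ F'])
      (auto intro!: derivative_eq_intros)
  then have "((\<lambda>s. F a s) has_real_derivative F' (0, 1)) (at b)"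
    by (simp add: has_field_derivative_def e2)
  then have p2: "pd2 F a b = F' (0, 1)"
    unfolding pd2_def by (rule DERIV_imp_deriv)
  have "((\<lambda>x. \<phi> (\<epsilon> * x)) has_real_derivative q (\<epsilon> * x) * \<epsilon>) (at x)"
    by (rule DERIV_chain2[where f = \<phi> and g = "\<lambda>x. \<epsilon> * x", OF \<phi>]) (auto intro!: derivative_eq_intros)
  then have "((\<lambda>x. k0 * x + \<phi> (\<epsilon> * x)) has_real_derivative (k0 + q b * \<epsilon>)) (at x)"
    unfolding b_def by (auto intro!: derivative_eq_intros)
  then have "((\<lambda>x. (k0 * x + \<phi> (\<epsilon> * x), \<epsilon> * x)) has_derivative
      (\<lambda>h. ((k0 + q b * \<epsilon>) * h, \<epsilon> * h))) (at x)"
    unfolding has_field_derivative_def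
    by (rule has_derivative_Pair) (auto intro!: derivative_eq_intros)
  from has_derivative_compose[OF this, where g = "\<lambda>(\<theta>, X). F \<theta> X"] F'
  have "((\<lambda>x. F (k0 * x + \<phi> (\<epsilon> * x)) (\<epsilon> * x)) has_derivative
      (\<lambda>h. F' ((k0 + q b * \<epsilon>) * h, \<epsilon> * h))) (at x)"
    by (simp add: a_def b_def)
  moreover have "F' ((k0 + q b * \<epsilon>) * h, \<epsilon> * h) = ddx k0 q \<epsilon> F a b * h" for h
    unfolding ddx_def p1 p2 by (subst lin) (simp add: algebra_simps)
  ultimately show ?thesis
    by (simp add: has_field_derivative_def a_def b_def)
qed

definition ansatz ::
  "(real \<Rightarrow> real \<Rightarrow> real) \<Rightarrow> real \<Rightarrow> (real \<Rightarrow> real) \<Rightarrow> (real \<Rightarrow> real \<Rightarrow> real) \<Rightarrow> (real \<Rightarrow> real \<Rightarrow> real) \<Rightarrow>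
     (real \<Rightarrow> real \<Rightarrow> real) \<Rightarrow> real \<Rightarrow> real \<Rightarrow> real \<Rightarrow> real" where
  "ansatz u k0 q w2 w3 w4 \<epsilon> \<theta> X =
     u \<theta> (k0 + \<epsilon> * q X) + \<epsilon>^2 * w2 \<theta> X + \<epsilon>^3 * w3 \<theta> X + \<epsilon>^4 * w4 \<theta> X"

definition residual ::
  "real \<Rightarrow> (real \<Rightarrow> real) \<Rightarrow> (real \<Rightarrow> real \<Rightarrow> real) \<Rightarrow> real \<Rightarrow> (real \<Rightarrow> real) \<Rightarrow> (real \<Rightarrow> real \<Rightarrow> real) \<Rightarrow>
     (real \<Rightarrow> real \<Rightarrow> real) \<Rightarrow> (real \<Rightarrow> real \<Rightarrow> real) \<Rightarrow> real \<Rightarrow> real \<Rightarrow> real \<Rightarrow> real" where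
  "residual \<sigma> V u k0 q w2 w3 w4 \<epsilon> \<theta> X =
     (let U = ansatz u k0 q w2 w3 w4 \<epsilon>
      in (ddx k0 q \<epsilon> ^^ 4) U \<theta> X + \<sigma> * (ddx k0 q \<epsilon> ^^ 2) U \<theta> X + deriv V (U \<theta> X))"

text \<open>
  The formal expansion in \<open>\<epsilon>\<close> is the Taylor expansion at \<open>\<epsilon> = 0\<close> for fixed \<open>(\<theta>, X)\<close>.
  Values of \<open>u \<theta> k\<close> at \<open>k\<close> outside the parameter interval do not matter: near \<open>\<epsilon> = 0\<close> and
  a given \<open>X\<close>, the argument \<open>k0 + \<epsilon> * q X\<close> stays in that interval.
\<close>

definition residual_coeff ::
  "real \<Rightarrow> (real \<Rightarrow> real) \<Rightarrow> (real \<Rightarrow> real \<Rightarrow> real) \<Rightarrow> real \<Rightarrow> (real \<Rightarrow> real) \<Rightarrow> (real \<Rightarrow> real \<Rightarrow> real) \<Rightarrow>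
     (real \<Rightarrow> real \<Rightarrow> real) \<Rightarrow> (real \<Rightarrow> real \<Rightarrow> real) \<Rightarrow> nat \<Rightarrow> real \<Rightarrow> real \<Rightarrow> real" where
  "residual_coeff \<sigma> V u k0 q w2 w3 w4 j \<theta> X =
     (deriv ^^ j) (\<lambda>\<epsilon>. residual \<sigma> V u k0 q w2 w3 w4 \<epsilon> \<theta> X) 0 / fact j"

definition smooth_periodic_fst :: "(real \<Rightarrow> real \<Rightarrow> real) \<Rightarrow> bool" where
  "smooth_periodic_fst w \<longleftrightarrow>
     smooth_on UNIV (\<lambda>(\<theta>, X). w \<theta> X) \<and> (\<forall>X. periodic_fun_simple (\<lambda>\<theta>. w \<theta> X) (2 * pi))"

end

theory Submission
  imports Defs
begin

text \<open>
  Write \<open>\<kappa> = k0 + \<epsilon> q(X)\<close>, so that \<open>d/dx\<close> acts as \<open>\<kappa> \<partial>\<^sub>\<theta> + \<epsilon> \<partial>\<^sub>X\<close> with \<open>\<partial>\<^sub>X \<kappa> = \<epsilon> q'\<close>.  The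
  profile \<open>u(\<theta>, \<kappa>)\<close> solves the wave equation for every \<open>\<kappa>\<close>, so it contributes to the residual only through
  \<open>X\<close>-derivatives of \<open>\<kappa>\<close>, and the residual starts at order \<open>\<epsilon>\<^sup>2\<close> (\<open>residual_eq\<close>).  Expanding \<open>\<kappa>\<close> as well
  (\<open>residual_coeffs\<close>), the coefficients of order \<open>j = 2, 3, 4\<close> have the form \<open>L w\<^sub>j + f\<^sub>j\<close>, where \<open>L\<close> is the
  linearisation at the wave and \<open>f\<^sub>j\<close> depends on the corrections of lower order.

  \<open>L\<close> is symmetric and its periodic kernel is spanned by \<open>u\<^sub>z\<close>.  Hence \<open>L w\<^sub>j = - f\<^sub>j\<close> has a periodic solution exactly
  when \<open>\<langle>\<langle>u\<^sub>z, f\<^sub>j\<rangle>\<rangle> = 0\<close>.  Sufficiency (\<open>periodic_fredholm\<close>) comes from the monodromy map of the fourth-order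
  equation on Cauchy data: a simple kernel makes the defect of periodicity range over a whole hyperplane, and Green's
  identity identifies that hyperplane.

  At order two the condition is \<open>q' A\<^sub>k(k0) = 0\<close>.  At order three it is \<open>q q' A\<^sub>k\<^sub>k(k0) = 0\<close>, the contribution of \<open>q''\<close>
  being zero by symmetry.  So these orders can be solved, which also provides \<open>\<xi>\<^sub>3\<close> and \<open>\<xi>\<^sub>4\<close>, and
  \<open>w\<^sub>2 = q' \<xi>\<^sub>3 + \<alpha> u\<^sub>z\<close>, \<open>w\<^sub>3 = q'' \<xi>\<^sub>4 + \<alpha>' u\<^sub>k + q q' \<eta> + q \<alpha> u\<^sub>z\<^sub>k + \<beta> u\<^sub>z\<close> with functions \<open>\<alpha>, \<beta>\<close> of \<open>X\<close> left free.

  At order four the condition is a sum of products of functions of \<open>X\<close> with the numbers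
  \<open>\<langle>\<langle>u\<^sub>z, h\<^sub>i\<rangle>\<rangle>\<close>.  The one of \<open>q'''\<close> is the constant in the statement, by definition.  The one of \<open>q\<^sup>2 q'\<close> is
  \<open>A\<^sub>k\<^sub>k\<^sub>k(k0) / 2\<close>, because \<open>A\<^sub>k = \<langle>\<langle>u\<^sub>z, G\<rangle>\<rangle>\<close> with \<open>G\<close> the forcing at order two (\<open>action_derivs\<close>, \<open>ip_x_h4\<close>).  All the others
  vanish: those of \<open>q'\<^sup>2\<close> and \<open>q q''\<close> (\<open>ip_x_h2\<close>, \<open>ip_x_h3\<close>), and all that contain \<open>\<alpha>\<close> or \<open>\<beta>\<close>, which are mere phase shifts.
  The mechanism is always the same: operators with an odd number of derivatives are antisymmetric, those with an even
  number are symmetric, and the wave equation differentiated in \<open>z\<close> and \<open>k\<close> (\<open>wave_identities\<close>) lets \<open>L\<close> be moved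
  from one factor to the other until the terms cancel in pairs.

  Two devices keep the analysis elementary.  Taylor expansion in \<open>\<epsilon>\<close> is handled by jets whose coefficients are formal power
  series, so that sums, products and compositions of functions become those of series.  And \<open>w\<^sub>4\<close> is a finite
  sum of products of a function of \<open>X\<close> and a function of \<open>\<theta>\<close>, so that no parameter dependence of the inverse of \<open>L\<close> has to be
  studied.
\<close>

section \<open>Calculus of smooth functions\<close>

lemma frechet_derivative_cong_open:
  assumes "open S" "x \<in> S" "\<And>y. y \<in> S \<Longrightarrow> f y = g y"
  shows "frechet_derivative f (at x) = frechet_derivative g (at x)"
proof -
  have "(f has_derivative D) (at x) \<longleftrightarrow> (g has_derivative D) (at x)" for D
    using has_derivative_transform_within_open[OF _ assms(1,2)] assms(3) by metis
  then show ?thesis unfolding frechet_derivative_def by simp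
qed

lemma differentiable_cong_open:
  assumes "open S" "x \<in> S" "\<And>y. y \<in> S \<Longrightarrow> f y = g y" "f differentiable (at x)"
  shows "g differentiable (at x)"
  using assms unfolding differentiable_def
  by (meson has_derivative_transform_within_open)

lemma Ck_on_cong:
  assumes S: "open S"
  shows "(\<And>x. x \<in> S \<Longrightarrow> f x = g x) \<Longrightarrow> Ck_on n S f \<Longrightarrow> Ck_on n S g"
proof (induction n arbitrary: f g)
  case 0
  then show ?case by (simp cong: continuous_on_cong)
next
  case (Suc n)
  have "frechet_derivative f (at x) v = frechet_derivative g (at x) v" if "x \<in> S" for x v
    using frechet_derivative_cong_open[OF S that Suc.prems(1)] by simp
  then have "Ck_on n S (\<lambda>x. frechet_derivative g (at x) v)" for v
    by (rule Suc.IH[of "\<lambda>x. frechet_derivative f (at x) v"]) (use Suc.prems in auto)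
  moreover have "g differentiable (at x)" if "x \<in> S" for x
    using differentiable_cong_open[OF S that] Suc.prems that by auto
  ultimately show ?case by simp
qed

lemma Ck_on_SucD: "Ck_on (Suc n) S f \<Longrightarrow> Ck_on n S f"
proof (induction n arbitrary: f)
  case 0
  then show ?case
    by (auto intro!: continuous_at_imp_continuous_on differentiable_imp_continuous_within)
next
  case (Suc n)
  then show ?case by (simp only: Ck_on.simps) blast
qed

lemma Ck_on_const: "Ck_on n S (\<lambda>x. c)"
  by (induction n arbitrary: c) auto

lemma Ck_on_add:
  assumes S: "open S"
  shows "Ck_on n S f \<Longrightarrow> Ck_on n S g \<Longrightarrow> Ck_on n S (\<lambda>x. f x + g x)"
proof (induction n arbitrary: f g)
  case 0
  then show ?case by (auto intro: continuous_on_add)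
next
  case (Suc n)
  have "Ck_on n S (\<lambda>x. frechet_derivative (\<lambda>x. f x + g x) (at x) v)" for v
  proof (rule Ck_on_cong[OF S])
    show "Ck_on n S (\<lambda>x. frechet_derivative f (at x) v + frechet_derivative g (at x) v)"
      using Suc by (intro Suc.IH) auto
    show "frechet_derivative f (at x) v + frechet_derivative g (at x) v
      = frechet_derivative (\<lambda>x. f x + g x) (at x) v" if "x \<in> S" for x
      using Suc.prems that
      by (subst frechet_derivative_at[symmetric])
        (auto intro!: has_derivative_add simp: frechet_derivative_works[symmetric])
  qed
  then show ?case using Suc.prems by auto
qed

lemma Ck_on_mult:
  fixes f g :: "'a::real_normed_vector \<Rightarrow> real"
  assumes S: "open S"
  shows "Ck_on n S f \<Longrightarrow> Ck_on n S g \<Longrightarrow> Ck_on n S (\<lambda>x. f x * g x)"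
proof (induction n arbitrary: f g)
  case 0
  then show ?case by (auto intro: continuous_on_mult)
next
  case (Suc n)
  have "Ck_on n S (\<lambda>x. frechet_derivative (\<lambda>x. f x * g x) (at x) v)" for v
  proof (rule Ck_on_cong[OF S])
    show "Ck_on n S (\<lambda>x. f x * frechet_derivative g (at x) v + frechet_derivative f (at x) v * g x)"
      using Suc.prems Suc.prems[THEN Ck_on_SucD] by (intro Ck_on_add[OF S] Suc.IH) auto
    show "f x * frechet_derivative g (at x) v + frechet_derivative f (at x) v * g x
      = frechet_derivative (\<lambda>x. f x * g x) (at x) v" if "x \<in> S" for x
      using Suc.prems that
      by (subst frechet_derivative_at[symmetric])
        (auto intro!: has_derivative_mult simp: frechet_derivative_works[symmetric])
  qed
  then show ?case using Suc.prems by (auto intro!: differentiable_mult)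
qed

text \<open>Affine substitutions cover both the restriction of a function of \<open>(z, k)\<close> to a line and the
  pullback of a function of one variable along a projection.\<close>

lemma Ck_on_compose_affine:
  assumes A: "\<And>x. (A has_derivative L) (at x)" and S: "open S" "A ` S \<subseteq> T"
  shows "Ck_on n T f \<Longrightarrow> Ck_on n S (\<lambda>x. f (A x))"
proof (induction n arbitrary: f)
  case 0
  have "continuous_on S A"
    using A by (meson continuous_at_imp_continuous_on has_derivative_continuous)
  then show ?case using 0 S by (auto intro: continuous_on_compose2)
next
  case (Suc n)
  have D: "((\<lambda>x. f (A x)) has_derivative (\<lambda>v. frechet_derivative f (at (A x)) (L v))) (at x)"
    if "x \<in> S" for x
    using Suc.prems that S
    by (intro has_derivative_compose[OF A]) (auto simp: frechet_derivative_works[symmetric])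
  have "Ck_on n S (\<lambda>x. frechet_derivative (\<lambda>x. f (A x)) (at x) v)" for v
  proof (rule Ck_on_cong[OF S(1)])
    show "Ck_on n S (\<lambda>x. frechet_derivative f (at (A x)) (L v))"
      using Suc.prems by (intro Suc.IH[of "\<lambda>y. frechet_derivative f (at y) (L v)"]) auto
    show "frechet_derivative f (at (A x)) (L v)
      = frechet_derivative (\<lambda>x. f (A x)) (at x) v" if "x \<in> S" for x
      by (subst frechet_derivative_at[OF D[OF that], symmetric]) simp
  qed
  then show ?case using D by (auto simp: differentiable_def)
qed

lemma smooth_on_cong: "open S \<Longrightarrow> (\<And>x. x \<in> S \<Longrightarrow> f x = g x) \<Longrightarrow> smooth_on S f \<Longrightarrow> smooth_on S g"
  unfolding smooth_on_def using Ck_on_cong by blast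

lemma smooth_on_const: "smooth_on S (\<lambda>x. c)"
  unfolding smooth_on_def by (simp add: Ck_on_const)

lemma smooth_on_add:
  "open S \<Longrightarrow> smooth_on S f \<Longrightarrow> smooth_on S g \<Longrightarrow> smooth_on S (\<lambda>x. f x + g x)"
  unfolding smooth_on_def by (simp add: Ck_on_add)

lemma smooth_on_mult:
  fixes f g :: "'a::real_normed_vector \<Rightarrow> real"
  shows "open S \<Longrightarrow> smooth_on S f \<Longrightarrow> smooth_on S g \<Longrightarrow> smooth_on S (\<lambda>x. f x * g x)"
  unfolding smooth_on_def by (simp add: Ck_on_mult)

lemma smooth_on_compose_affine:
  "(\<And>x. (A has_derivative L) (at x)) \<Longrightarrow> open S \<Longrightarrow> A ` S \<subseteq> T \<Longrightarrow> smooth_on T f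
    \<Longrightarrow> smooth_on S (\<lambda>x. f (A x))"
  unfolding smooth_on_def using Ck_on_compose_affine[of A L S T _ f] by simp

lemma smooth_on_differentiable: "smooth_on S f \<Longrightarrow> x \<in> S \<Longrightarrow> f differentiable (at x)"
  unfolding smooth_on_def by (metis Ck_on.simps(2))

lemma smooth_on_frechet_derivative:
  "smooth_on S f \<Longrightarrow> smooth_on S (\<lambda>x. frechet_derivative f (at x) v)"
  unfolding smooth_on_def by (metis Ck_on.simps(2))

lemma smooth_on_continuous_on: "smooth_on S f \<Longrightarrow> continuous_on S f"
  unfolding smooth_on_def by (metis Ck_on.simps(1))

subsection \<open>One real variable\<close>

lemma frechet_derivative_eq_deriv:
  fixes f :: "real \<Rightarrow> real"
  assumes "f differentiable (at x)"
  shows "frechet_derivative f (at x) v = deriv f x * v"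
proof -
  have "(f has_real_derivative deriv f x) (at x)"
    using assms DERIV_deriv_iff_real_differentiable by blast
  then have "(f has_derivative (*) (deriv f x)) (at x)" by (simp add: has_field_derivative_def)
  then show ?thesis using frechet_derivative_at by metis
qed

lemma Ck_on_UNIV_Suc:
  fixes f :: "real \<Rightarrow> real"
  shows "Ck_on (Suc n) UNIV f \<longleftrightarrow> (\<forall>x. f differentiable (at x)) \<and> Ck_on n UNIV (deriv f)"
proof
  assume f: "Ck_on (Suc n) UNIV f"
  then have "Ck_on n UNIV (\<lambda>x. frechet_derivative f (at x) 1)" by simp
  with f show "(\<forall>x. f differentiable (at x)) \<and> Ck_on n UNIV (deriv f)"
    by (simp add: frechet_derivative_eq_deriv)
next
  assume f: "(\<forall>x. f differentiable (at x)) \<and> Ck_on n UNIV (deriv f)"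
  then have "Ck_on n UNIV (\<lambda>x. frechet_derivative f (at x) v)" for v
    by (simp add: frechet_derivative_eq_deriv Ck_on_mult Ck_on_const)
  with f show "Ck_on (Suc n) UNIV f" by simp
qed

lemma smooth_deriv:
  fixes f :: "real \<Rightarrow> real"
  shows "smooth_on UNIV f \<Longrightarrow> smooth_on UNIV (deriv f)"
  unfolding smooth_on_def using Ck_on_UNIV_Suc by blast

lemma smooth_funpow_deriv:
  fixes f :: "real \<Rightarrow> real"
  shows "smooth_on UNIV f \<Longrightarrow> smooth_on UNIV ((deriv ^^ n) f)"
  by (induction n) (auto intro: smooth_deriv)

lemma smooth_has_deriv:
  fixes f :: "real \<Rightarrow> real"
  shows "smooth_on UNIV f \<Longrightarrow> (f has_real_derivative deriv f x) (at x)"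
  using smooth_on_differentiable DERIV_deriv_iff_real_differentiable by blast

lemma Ck_on_compose:
  fixes f g :: "real \<Rightarrow> real"
  shows "Ck_on n UNIV g \<Longrightarrow> Ck_on n UNIV f \<Longrightarrow> Ck_on n UNIV (\<lambda>x. g (f x))"
proof (induction n arbitrary: g f)
  case 0
  then have "continuous_on UNIV g" "continuous_on UNIV f" by simp_all
  then show ?case using continuous_on_compose2[of UNIV g UNIV f] by simp
next
  case (Suc n)
  have D: "((\<lambda>x. g (f x)) has_real_derivative deriv g (f x) * deriv f x) (at x)" for x
    using Suc.prems
    by (intro DERIV_chain2) (auto simp: DERIV_deriv_iff_real_differentiable)
  then have "deriv (\<lambda>x. g (f x)) = (\<lambda>x. deriv g (f x) * deriv f x)"
    by (auto intro: DERIV_imp_deriv)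
  moreover have "Ck_on n UNIV (\<lambda>x. deriv g (f x))" "Ck_on n UNIV (deriv f)"
    using Suc.IH[of "deriv g" f] Suc.prems Ck_on_SucD[OF Suc.prems(2)]
    unfolding Ck_on_UNIV_Suc by blast+
  then have "Ck_on n UNIV (\<lambda>x. deriv g (f x) * deriv f x)"
    by (intro Ck_on_mult open_UNIV)
  ultimately show ?case using D unfolding Ck_on_UNIV_Suc
    by (auto simp: real_differentiable_def)
qed

lemma smooth_compose:
  fixes f g :: "real \<Rightarrow> real"
  shows "smooth_on UNIV g \<Longrightarrow> smooth_on UNIV f \<Longrightarrow> smooth_on UNIV (\<lambda>x. g (f x))"
  by (simp add: smooth_on_def Ck_on_compose)

subsection \<open>Two real variables\<close>

abbreviation (input) smooth2 :: "real set \<Rightarrow> (real \<Rightarrow> real \<Rightarrow> real) \<Rightarrow> bool" where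
  "smooth2 J f \<equiv> smooth_on (UNIV \<times> J) (\<lambda>(z, k). f z k)"

lemma smooth2_has_partials:
  assumes f: "smooth2 J f" and k: "k \<in> J"
  shows "((\<lambda>s. f s k) has_real_derivative frechet_derivative (\<lambda>(z, k). f z k) (at (z, k)) (1, 0)) (at z)"
    and "((\<lambda>s. f z s) has_real_derivative frechet_derivative (\<lambda>(z, k). f z k) (at (z, k)) (0, 1)) (at k)"
proof -
  define D where "D = frechet_derivative (\<lambda>(z, k). f z k) (at (z, k))"
  have D: "((\<lambda>(z, k). f z k) has_derivative D) (at (z, k))"
    using smooth_on_differentiable[OF f, of "(z, k)"] k
    by (auto simp: frechet_derivative_works D_def)
  interpret D: bounded_linear D using D by (rule has_derivative_bounded_linear)
  have lin: "D (r, 0) = D (1, 0) * r" "D (0, r) = D (0, 1) * r" for r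
    using D.scaleR[of r "(1, 0)"] D.scaleR[of r "(0, 1)"] by simp_all
  have e: "(\<lambda>h. D (h, 0)) = (*) (D (1, 0))" "(\<lambda>h. D (0, h)) = (*) (D (0, 1))"
    by (rule ext, rule lin)+
  have "((\<lambda>s. case (s, k) of (z, k) \<Rightarrow> f z k) has_derivative (\<lambda>h. D (h, 0))) (at z)"
    by (rule has_derivative_compose[where f = "\<lambda>s. (s, k)", OF _ D])
      (auto intro!: derivative_eq_intros)
  then show "((\<lambda>s. f s k) has_real_derivative frechet_derivative (\<lambda>(z, k). f z k) (at (z, k)) (1, 0)) (at z)"
    by (simp add: has_field_derivative_def e flip: D_def)
  have "((\<lambda>s. case (z, s) of (z, k) \<Rightarrow> f z k) has_derivative (\<lambda>h. D (0, h))) (at k)"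
    by (rule has_derivative_compose[where f = "\<lambda>s. (z, s)", OF _ D])
      (auto intro!: derivative_eq_intros)
  then show "((\<lambda>s. f z s) has_real_derivative frechet_derivative (\<lambda>(z, k). f z k) (at (z, k)) (0, 1)) (at k)"
    by (simp add: has_field_derivative_def e flip: D_def)
qed

lemma smooth2_DERIV1:
  "smooth2 J f \<Longrightarrow> k \<in> J \<Longrightarrow> ((\<lambda>s. f s k) has_real_derivative pd1 f z k) (at z)"
  unfolding pd1_def by (metis smooth2_has_partials(1) DERIV_imp_deriv)

lemma smooth2_DERIV2:
  "smooth2 J f \<Longrightarrow> k \<in> J \<Longrightarrow> ((\<lambda>s. f z s) has_real_derivative pd2 f z k) (at k)"
  unfolding pd2_def by (metis smooth2_has_partials(2) DERIV_imp_deriv)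

lemma smooth2_pd1:
  assumes "open J" "smooth2 J f" shows "smooth2 J (pd1 f)"
  by (rule smooth_on_cong[OF _ _ smooth_on_frechet_derivative[OF assms(2), of "(1, 0)"]])
    (use assms in \<open>auto simp: open_Times pd1_def intro!: DERIV_imp_deriv[symmetric] smooth2_has_partials\<close>)

lemma smooth2_pd2:
  assumes "open J" "smooth2 J f" shows "smooth2 J (pd2 f)"
  by (rule smooth_on_cong[OF _ _ smooth_on_frechet_derivative[OF assms(2), of "(0, 1)"]])
    (use assms in \<open>auto simp: open_Times pd2_def intro!: DERIV_imp_deriv[symmetric] smooth2_has_partials\<close>)

lemma smooth2_cont:
  "smooth2 J f \<Longrightarrow> A \<subseteq> J \<Longrightarrow> continuous_on (B \<times> A) (\<lambda>(z, k). f z k)"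
  by (rule continuous_on_subset[OF smooth_on_continuous_on]) auto

lemma smooth2_section1:
  assumes "smooth2 J f" "k \<in> J" shows "smooth_on UNIV (\<lambda>z. f z k)"
proof -
  have "smooth_on UNIV (\<lambda>z. case (z, k) of (z, k) \<Rightarrow> f z k)"
    by (rule smooth_on_compose_affine[where A = "\<lambda>z. (z, k)" and L = "\<lambda>h. (h, 0)", OF _ _ _ assms(1)])
      (use assms in \<open>auto intro!: has_derivative_Pair has_derivative_ident has_derivative_const\<close>)
  then show ?thesis by simp
qed

lemma smooth2_section2:
  assumes "smooth2 UNIV f" shows "smooth_on UNIV (\<lambda>k. f z k)"
proof -
  have "smooth_on UNIV (\<lambda>k. case (z, k) of (z, k) \<Rightarrow> f z k)"
    by (rule smooth_on_compose_affine[where A = "\<lambda>k. (z, k)" and L = "\<lambda>h. (0, h)", OF _ _ _ assms(1)])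
      (use assms in \<open>auto intro!: has_derivative_Pair has_derivative_ident has_derivative_const\<close>)
  then show ?thesis by simp
qed

lemma smooth2_prod:
  assumes "smooth_on UNIV f" "smooth_on UNIV g"
  shows "smooth2 UNIV (\<lambda>z k. f z * g k)"
proof -
  have "smooth_on UNIV (\<lambda>p::real \<times> real. f (fst p))" "smooth_on UNIV (\<lambda>p::real \<times> real. g (snd p))"
    by (rule smooth_on_compose_affine[where A = fst and L = fst and T = UNIV]
          smooth_on_compose_affine[where A = snd and L = snd and T = UNIV],
        auto intro: assms bounded_linear_imp_has_derivative bounded_linear_fst bounded_linear_snd)+
  from smooth_on_mult[OF _ this] show ?thesis by (simp add: case_prod_beta')
qed

lemma smooth2_add:
  "open J \<Longrightarrow> smooth2 J f \<Longrightarrow> smooth2 J g \<Longrightarrow> smooth2 J (\<lambda>z k. f z k + g z k)"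
  using smooth_on_add[of "UNIV \<times> J" "\<lambda>(z, k). f z k" "\<lambda>(z, k). g z k"]
  by (simp add: open_Times case_prod_beta')

text \<open>Both mixed derivatives are continuous, so differentiation in \<open>k\<close> may be pulled under the
  integral that recovers \<open>f\<close> from its \<open>z\<close>-derivative.\<close>

lemma smooth2_pd_commute:
  assumes J: "open J" and f: "smooth2 J f" and k: "k \<in> J"
  shows "pd1 (pd2 f) z k = pd2 (pd1 f) z k"
proof -
  obtain e where e: "e > 0" "ball k e \<subseteq> J" using J k open_contains_ball by blast
  \<comment> \<open>The base point lies to the left of \<open>z\<close>, so that \<open>z\<close> is interior to the interval of integration.\<close>
  define a b where "a = z - 1" and "b = z + 1"
  have f1: "smooth2 J (pd1 f)" and f12: "smooth2 J (pd2 (pd1 f))"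
    using J f by (auto intro: smooth2_pd1 smooth2_pd2)
  have swap: "continuous_on (ball k e \<times> cbox a y) (\<lambda>(k, z). g z k)" if "smooth2 J g" for g y
  proof -
    have "continuous_on (ball k e \<times> cbox a y) (\<lambda>p. case (snd p, fst p) of (z, k) \<Rightarrow> g z k)"
      by (rule continuous_on_compose2[OF smooth2_cont[OF that, of "ball k e" UNIV]])
        (use e in \<open>auto intro!: continuous_intros\<close>)
    then show ?thesis by (simp add: case_prod_beta')
  qed
  have cont1: "continuous_on A (\<lambda>s. g s k')" if "smooth2 J g" "k' \<in> J" for g k' A
    using smooth2_section1[OF that] smooth_on_continuous_on continuous_on_subset by blast
  have int: "f y k' = f a k' + integral (cbox a y) (\<lambda>s. pd1 f s k')" if "a \<le> y" "k' \<in> J" for y k'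
  proof -
    have "((\<lambda>s. pd1 f s k') has_integral f y k' - f a k') {a..y}"
      using that smooth2_DERIV1[OF f]
      by (intro fundamental_theorem_of_calculus)
        (auto simp: has_real_derivative_iff_has_vector_derivative[symmetric]
          intro: has_field_derivative_at_within)
    then show ?thesis by (simp add: integral_unique)
  qed
  have eq: "pd2 f y k = pd2 f a k + integral {a..y} (\<lambda>s. pd2 (pd1 f) s k)" if y: "a \<le> y" for y
  proof -
    have "((\<lambda>k'. integral (cbox a y) (\<lambda>s. pd1 f s k')) has_real_derivative
        integral (cbox a y) (\<lambda>s. pd2 (pd1 f) s k)) (at k within ball k e)"
    proof (rule leibniz_rule_field_derivative)
      show "((\<lambda>k'. pd1 f s k') has_real_derivative pd2 (pd1 f) s k') (at k' within ball k e)"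
        if "k' \<in> ball k e" for k' s
        using smooth2_DERIV2[OF f1] e that by (blast intro: has_field_derivative_at_within)
      show "(\<lambda>s. pd1 f s k') integrable_on cbox a y" if "k' \<in> ball k e" for k'
        using cont1[OF f1] e that by (intro integrable_continuous) auto
    qed (use swap[OF f12] e in auto)
    then have "((\<lambda>k'. integral (cbox a y) (\<lambda>s. pd1 f s k')) has_real_derivative
        integral (cbox a y) (\<lambda>s. pd2 (pd1 f) s k)) (at k)"
      using e at_within_open[of k "ball k e"] by auto
    then have "((\<lambda>k'. f a k' + integral (cbox a y) (\<lambda>s. pd1 f s k')) has_real_derivative
        pd2 f a k + integral (cbox a y) (\<lambda>s. pd2 (pd1 f) s k)) (at k)"
      using smooth2_DERIV2[OF f k] by (intro derivative_intros)
    then have "((\<lambda>k'. f y k') has_real_derivative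
        pd2 f a k + integral (cbox a y) (\<lambda>s. pd2 (pd1 f) s k)) (at k)"
      by (rule has_field_derivative_transform_within_open[OF _ J k]) (use int[OF y] in auto)
    then show ?thesis using DERIV_unique[OF _ smooth2_DERIV2[OF f k, of y]] by auto
  qed
  have "((\<lambda>y. integral {a..y} (\<lambda>s. pd2 (pd1 f) s k)) has_real_derivative pd2 (pd1 f) z k)
      (at z within {a..b})"
    by (rule integral_has_real_derivative[OF cont1[OF f12 k]]) (auto simp: a_def b_def)
  then have "((\<lambda>y. integral {a..y} (\<lambda>s. pd2 (pd1 f) s k)) has_real_derivative pd2 (pd1 f) z k) (at z)"
    by (simp add: a_def b_def at_within_Icc_at)
  then have "((\<lambda>y. pd2 f a k + integral {a..y} (\<lambda>s. pd2 (pd1 f) s k)) has_real_derivative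
      pd2 (pd1 f) z k) (at z)"
    by (auto intro!: derivative_eq_intros)
  then have "((\<lambda>y. pd2 f y k) has_real_derivative pd2 (pd1 f) z k) (at z)"
  proof (rule has_field_derivative_transform_within_open[where S = "{a<..}"])
    show "pd2 f a k + integral {a..y} (\<lambda>s. pd2 (pd1 f) s k) = pd2 f y k" if "y \<in> {a<..}" for y
      using eq[of y] that by simp
  qed (auto simp: a_def)
  then show ?thesis unfolding pd1_def[of "pd2 f"] by (rule DERIV_imp_deriv)
qed

section \<open>Global solutions of Lipschitz ordinary differential equations\<close>

text \<open>Integration gains a factor \<open>1 / l\<close> against the weight \<open>exp (l \<bar>t\<bar>)\<close>; this is where the contraction
  constant of the Picard operator comes from.\<close>

lemma exp_weight_bound_pos:
  fixes G :: "real \<Rightarrow> 'a::real_normed_vector"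
  assumes G: "\<And>t. (G has_vector_derivative g t) (at t)" "G 0 = 0"
    and b: "\<And>t. norm (g t) \<le> M * exp (l * \<bar>t\<bar>)" and l: "l > 0" and t: "t \<ge> 0"
  shows "norm (G t) \<le> M / l * exp (l * t)"
proof -
  have M: "M \<ge> 0" using order_trans[OF norm_ge_zero b[of 0]] by simp
  show ?thesis
  proof (cases "t = 0")
    case True
    then show ?thesis using G M l by simp
  next
    case False
    have "norm (G t - G 0) \<le> M / l * exp (l * t) - M / l * exp (l * 0)"
    proof (rule differentiable_bound_general[where f' = g and \<phi>' = "\<lambda>s. M * exp (l * s)"])
      show "continuous_on {0..t} G"
        using G(1) by (meson continuous_at_imp_continuous_on has_vector_derivative_continuous)
      show "((\<lambda>s. M / l * exp (l * s)) has_vector_derivative M * exp (l * x)) (at x)" for x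
        unfolding has_real_derivative_iff_has_vector_derivative[symmetric]
        using l by (auto intro!: derivative_eq_intros)
      show "norm (g x) \<le> M * exp (l * x)" if "0 < x" for x using b[of x] that by simp
    qed (use t l False G in \<open>auto intro!: continuous_intros\<close>)
    also have "\<dots> \<le> M / l * exp (l * t)" using M l by simp
    finally show ?thesis using G by simp
  qed
qed

lemma has_vector_derivative_reflect:
  assumes "(G has_vector_derivative g (- t)) (at (- t))"
  shows "((\<lambda>s. G (- s)) has_vector_derivative - g (- t)) (at t)"
proof -
  have "((\<lambda>s::real. - s) has_vector_derivative - 1) (at t)"
    by (auto intro!: derivative_eq_intros simp: has_real_derivative_iff_has_vector_derivative[symmetric])
  from vector_diff_chain_at[OF this, of G] assms show ?thesis by (simp add: o_def)
qed

lemma exp_weight_bound: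
  fixes G :: "real \<Rightarrow> 'a::real_normed_vector"
  assumes G: "\<And>t. (G has_vector_derivative g t) (at t)" "G 0 = 0"
    and b: "\<And>t. norm (g t) \<le> M * exp (l * \<bar>t\<bar>)" and l: "l > 0"
  shows "norm (G t) \<le> M / l * exp (l * \<bar>t\<bar>)"
proof (cases "t \<ge> 0")
  case True
  then show ?thesis using exp_weight_bound_pos[OF G b l] by simp
next
  case False
  have "norm (G (- (- t))) \<le> M / l * exp (l * (- t))"
  proof (rule exp_weight_bound_pos[where G = "\<lambda>s. G (- s)" and g = "\<lambda>s. - g (- s)"])
    show "((\<lambda>s. G (- s)) has_vector_derivative - g (- s)) (at s)" for s
      by (rule has_vector_derivative_reflect[where g = g, OF G(1)])
    show "norm (- g (- s)) \<le> M * exp (l * \<bar>s\<bar>)" for s using b[of "- s"] by simp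
  qed (use False G l in auto)
  then show ?thesis using False by simp
qed

lemma antiderivative_exists:
  fixes f :: "real \<Rightarrow> 'a::euclidean_space"
  assumes "continuous_on UNIV f"
  shows "\<exists>G. G 0 = 0 \<and> (\<forall>t. (G has_vector_derivative f t) (at t))"
proof -
  obtain F where F: "\<And>t. (F has_vector_derivative f t) (at t)"
    using einterval_antiderivative[of "-\<infinity>" "\<infinity>" f] assms
    by (auto simp: continuous_on_eq_continuous_at)
  have "((\<lambda>s. F s - F 0) has_vector_derivative f t - 0) (at t)" for t
    by (intro derivative_intros F)
  then show ?thesis by (intro exI[of _ "\<lambda>s. F s - F 0"]) auto
qed

text \<open>The Picard operator is a contraction for the norm
  \<open>sup\<^sub>t exp (- l \<bar>t\<bar>) \<parallel>y t\<parallel>\<close> once \<open>l\<close> exceeds the Lipschitz constant, so one fixed point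
  argument gives a solution on the whole line.\<close>

lemma global_ode_exists:
  fixes F :: "real \<Rightarrow> 'a::euclidean_space \<Rightarrow> 'a"
  assumes cont: "continuous_on UNIV (\<lambda>(t, x). F t x)"
    and lip: "\<And>t x y. norm (F t x - F t y) \<le> K * norm (x - y)" and K: "K > 0"
    and bd: "\<And>t. norm (F t 0) \<le> C"
  shows "\<exists>y. y 0 = y0 \<and> (\<forall>t. (y has_vector_derivative F t (y t)) (at t))"
proof -
  define l where "l = 2 * K"
  have l: "l > 0" using K by (simp add: l_def)
  define w where "w = (\<lambda>t::real. exp (l * \<bar>t\<bar>))"
  have w: "w t > 0" "w t \<ge> 1" for t using l by (auto simp: w_def)
  have contw: "continuous_on UNIV w" unfolding w_def by (intro continuous_intros)
  define rhs where "rhs = (\<lambda>(x::real \<Rightarrow>\<^sub>C 'a) s. F s (w s *\<^sub>R x s))"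
  have cont_rhs: "continuous_on UNIV (rhs x)" for x
  proof -
    have "continuous_on UNIV (\<lambda>s. case (s, w s *\<^sub>R x s) of (t, x) \<Rightarrow> F t x)"
      by (rule continuous_on_compose2[OF cont]) (auto intro!: continuous_intros contw)
    then show ?thesis by (simp add: rhs_def)
  qed
  have "\<forall>x. \<exists>G. G 0 = 0 \<and> (\<forall>t. (G has_vector_derivative rhs x t) (at t))"
    using antiderivative_exists[OF cont_rhs] by blast
  then obtain G where G0: "\<And>x. G x 0 = 0"
    and G: "\<And>x t. (G x has_vector_derivative rhs x t) (at t)" by metis
  have rhs_bound: "norm (rhs x s) \<le> (K * norm x + C) * exp (l * \<bar>s\<bar>)" for x s
  proof -
    have C: "C \<ge> 0" using bd[of 0] norm_ge_zero[of "F 0 0"] by linarith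
    have "norm (rhs x s) \<le> norm (rhs x s - F s 0) + norm (F s 0)"
      using norm_triangle_ineq[of "rhs x s - F s 0" "F s 0"] by simp
    also have "\<dots> \<le> K * norm (w s *\<^sub>R x s - 0) + C"
      using lip[of s "w s *\<^sub>R x s" 0] bd[of s] unfolding rhs_def by simp
    also have "\<dots> \<le> K * (w s * norm x) + C * w s"
      using w[of s] K C norm_bounded[of x s]
      by (intro add_mono mult_left_mono) (auto simp: mult_le_cancel_left1)
    finally show ?thesis by (simp add: w_def algebra_simps)
  qed
  have diff_bound: "norm (G x t - G x' t) \<le> (K * dist x x') / l * exp (l * \<bar>t\<bar>)" for x x' t
  proof (rule exp_weight_bound[where g = "\<lambda>t. rhs x t - rhs x' t"])
    show "((\<lambda>t. G x t - G x' t) has_vector_derivative rhs x t - rhs x' t) (at t)" for t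
      by (intro derivative_intros G)
    show "norm (rhs x t - rhs x' t) \<le> K * dist x x' * exp (l * \<bar>t\<bar>)" for t
    proof -
      have "norm (rhs x t - rhs x' t) \<le> K * norm (w t *\<^sub>R x t - w t *\<^sub>R x' t)"
        unfolding rhs_def by (rule lip)
      also have "\<dots> = K * (w t * dist (x t) (x' t))"
        using w[of t] by (simp add: dist_norm scaleR_diff_right[symmetric])
      also have "\<dots> \<le> K * (w t * dist x x')"
        using w[of t] K dist_bounded[of x t x'] by (intro mult_left_mono) auto
      finally show ?thesis by (simp add: w_def algebra_simps)
    qed
  qed (use G0 l in auto)
  define \<Phi> where "\<Phi> = (\<lambda>x t. (1 / w t) *\<^sub>R (y0 + G x t))"
  have \<Phi>: "\<Phi> x \<in> bcontfun" for x
  proof (rule bcontfun_normI)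
    have "continuous_on UNIV (G x)"
      using G by (meson continuous_at_imp_continuous_on has_vector_derivative_continuous)
    then show "continuous_on UNIV (\<Phi> x)" unfolding \<Phi>_def
      using w(1) by (intro continuous_intros contw) (auto simp: less_imp_neq[symmetric])
    show "norm (\<Phi> x t) \<le> norm y0 + (K * norm x + C) / l" for t
    proof -
      have "norm (\<Phi> x t) \<le> (1 / w t) * (norm y0 + norm (G x t))"
        using w[of t] norm_triangle_ineq[of y0 "G x t"] by (simp add: \<Phi>_def divide_right_mono)
      also have "\<dots> \<le> (1 / w t) * (norm y0 * w t + (K * norm x + C) / l * w t)"
        using w[of t] exp_weight_bound[OF G G0 rhs_bound l, of x t]
        by (intro mult_left_mono add_mono) (auto simp: w_def mult_le_cancel_left1)
      also have "\<dots> = norm y0 + (K * norm x + C) / l"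
        using w(1)[of t] by (simp add: field_simps)
      finally show ?thesis .
    qed
  qed
  have "\<exists>!x. Bcontfun (\<Phi> x) = x"
  proof (rule banach_fix_type[where c = "1 / 2"])
    show "\<forall>x x'. dist (Bcontfun (\<Phi> x)) (Bcontfun (\<Phi> x')) \<le> 1 / 2 * dist x x'"
    proof (intro allI dist_bound)
      fix x x' t
      have "dist (\<Phi> x t) (\<Phi> x' t) = (1 / w t) * norm (G x t - G x' t)"
        using w[of t] by (simp add: \<Phi>_def dist_norm scaleR_diff_right[symmetric])
      also have "\<dots> \<le> (1 / w t) * ((K * dist x x') / l * w t)"
        using w[of t] diff_bound[of x t x'] by (intro mult_left_mono) (auto simp: w_def)
      also have "\<dots> = 1 / 2 * dist x x'" using w(1)[of t] K by (simp add: l_def)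
      finally show "dist (Bcontfun (\<Phi> x) t) (Bcontfun (\<Phi> x') t) \<le> 1 / 2 * dist x x'"
        by (simp add: Bcontfun_inverse \<Phi>)
    qed
  qed auto
  then obtain x where "Bcontfun (\<Phi> x) = x" by blast
  then have x: "x t = \<Phi> x t" for t using \<Phi> Bcontfun_inverse by metis
  have y: "w t *\<^sub>R x t = y0 + G x t" for t
    using w(1)[of t] by (subst x) (simp add: \<Phi>_def)
  have "((\<lambda>t. y0 + G x t) has_vector_derivative 0 + F t (y0 + G x t)) (at t)" for t
    using G[of x t] unfolding rhs_def y by (intro derivative_intros)
  then show ?thesis using G0 by (intro exI[of _ "\<lambda>t. y0 + G x t"]) auto
qed

text \<open>The quantity \<open>\<parallel>y t\<parallel>\<^sup>2 exp (- 2 K t)\<close> is nonincreasing and starts at zero.\<close>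

lemma gronwall_zero_pos:
  fixes y :: "real \<Rightarrow> 'a::real_inner"
  assumes y: "\<And>t. (y has_vector_derivative y' t) (at t)" "y 0 = 0"
    and b: "\<And>t. norm (y' t) \<le> K * norm (y t)" and t: "t \<ge> 0"
  shows "y t = 0"
proof -
  define E where "E = (\<lambda>t. (y t \<bullet> y t) * exp (- (2 * K * t)))"
  have D: "(E has_real_derivative
      (2 * (y s \<bullet> y' s) - 2 * K * (y s \<bullet> y s)) * exp (- (2 * K * s))) (at s)" for s
  proof -
    have "((\<lambda>s. y s \<bullet> y s) has_real_derivative y s \<bullet> y' s + y' s \<bullet> y s) (at s)"
      using bounded_bilinear.has_vector_derivative[OF bounded_bilinear_inner y(1)[of s] y(1)[of s]]
      by (simp add: has_real_derivative_iff_has_vector_derivative)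
    then show ?thesis unfolding E_def
      by (auto intro!: derivative_eq_intros simp: inner_commute algebra_simps)
  qed
  have "E t \<le> E 0"
  proof (rule DERIV_nonpos_imp_nonincreasing[OF t])
    fix s
    have "y s \<bullet> y' s \<le> norm (y s) * norm (y' s)" by (rule norm_cauchy_schwarz)
    also have "\<dots> \<le> norm (y s) * (K * norm (y s))" using b by (intro mult_left_mono) auto
    also have "\<dots> = K * (y s \<bullet> y s)" by (simp add: dot_square_norm power2_eq_square)
    finally show "\<exists>z. (E has_real_derivative z) (at s) \<and> z \<le> 0"
      using D[of s] by (intro exI conjI) (auto intro!: mult_nonpos_nonneg)
  qed
  then have "y t \<bullet> y t \<le> 0" using y by (simp add: E_def mult_le_0_iff)
  then show ?thesis using inner_ge_zero[of "y t"] inner_eq_zero_iff[of "y t"] by linarith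
qed

lemma gronwall_zero:
  fixes y :: "real \<Rightarrow> 'a::real_inner"
  assumes y: "\<And>t. (y has_vector_derivative y' t) (at t)" "y 0 = 0"
    and b: "\<And>t. norm (y' t) \<le> K * norm (y t)"
  shows "y t = 0"
proof (cases "t \<ge> 0")
  case True
  then show ?thesis by (rule gronwall_zero_pos[OF y b])
next
  case False
  have "y (- (- t)) = 0"
  proof (rule gronwall_zero_pos[where y = "\<lambda>s. y (- s)" and y' = "\<lambda>s. - y' (- s)" and K = K])
    show "((\<lambda>s. y (- s)) has_vector_derivative - y' (- s)) (at s)" for s
      by (rule has_vector_derivative_reflect[where g = y', OF y(1)])
  qed (use False y b in auto)
  then show ?thesis by simp
qed

section \<open>The Fredholm alternative for periodic fourth-order operators\<close>

lemma periodic_reduce: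
  assumes "periodic_fun_simple f (2 * pi)"
  shows "\<exists>y \<in> {0..2 * pi}. f y = f (x :: real)"
proof -
  interpret f: periodic_fun_simple f "2 * pi" by fact
  define n where "n = \<lfloor>x / (2 * pi)\<rfloor>"
  have "of_int n * (2 * pi) \<le> x" "x \<le> (of_int n + 1) * (2 * pi)"
    using floor_divide_lower[of "2 * pi" x] floor_divide_upper[of "2 * pi" x] by (auto simp: n_def)
  then have "x - of_int n * (2 * pi) \<in> {0..2 * pi}" by (auto simp: algebra_simps)
  then show ?thesis using f.minus_of_int by blast
qed

lemma periodic_bounded:
  fixes f :: "real \<Rightarrow> real"
  assumes "continuous_on UNIV f" "periodic_fun_simple f (2 * pi)"
  shows "\<exists>B. \<forall>x. \<bar>f x\<bar> \<le> B"
proof -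
  have "compact (f ` {0..2 * pi})"
    using assms(1) by (intro compact_continuous_image) (auto intro: continuous_on_subset)
  then obtain B where "\<And>x. x \<in> {0..2 * pi} \<Longrightarrow> \<bar>f x\<bar> \<le> B"
    by (metis bounded_iff compact_imp_bounded imageI real_norm_def)
  then show ?thesis using periodic_reduce[OF assms(2)] by metis
qed

text \<open>The equation \<open>f'''' + s f'' + v f = g\<close> as a first-order system.\<close>

definition ode4 :: "real \<Rightarrow> (real \<Rightarrow> real) \<Rightarrow> (real \<Rightarrow> real) \<Rightarrow> real
    \<Rightarrow> real \<times> real \<times> real \<times> real \<Rightarrow> real \<times> real \<times> real \<times> real" where
  "ode4 s v g t y = (case y of (a, b, c, d) \<Rightarrow> (b, c, d, g t - s * c - v t * a))"

definition sol4 :: "real \<Rightarrow> (real \<Rightarrow> real) \<Rightarrow> (real \<Rightarrow> real)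
    \<Rightarrow> (real \<Rightarrow> real \<times> real \<times> real \<times> real) \<Rightarrow> bool" where
  "sol4 s v g y \<longleftrightarrow> (\<forall>t. (y has_vector_derivative ode4 s v g t (y t)) (at t))"

lemma norm_ode4_le:
  assumes "\<And>t. \<bar>v t\<bar> \<le> B"
  shows "norm (ode4 s v (\<lambda>_. 0) t y) \<le> (3 + \<bar>s\<bar> + B) * norm y"
proof -
  obtain a b c d where y: "y = (a, b, c, d)" by (cases y) auto
  have n4: "norm (a, b, c, d) \<le> \<bar>a\<bar> + (\<bar>b\<bar> + (\<bar>c\<bar> + \<bar>d\<bar>))" for a b c d :: real
    by (rule order_trans[OF norm_Pair_le] add_mono order_refl | simp)+
  have c: "\<bar>a\<bar> \<le> norm y" "norm (b, c, d) \<le> norm y"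
    unfolding y using norm_fst_le[of a "(b, c, d)"] norm_snd_le[of "(b, c, d)" a] by auto
  have c': "\<bar>b\<bar> \<le> norm y" "norm (c, d) \<le> norm y"
    using norm_fst_le[of b "(c, d)"] norm_snd_le[of "(c, d)" b] c by auto
  have c'': "\<bar>c\<bar> \<le> norm y" "\<bar>d\<bar> \<le> norm y"
    using norm_fst_le[of c d] norm_snd_le[of d c] c' by auto
  have "\<bar>0 - s * c - v t * a\<bar> \<le> \<bar>s\<bar> * \<bar>c\<bar> + \<bar>v t\<bar> * \<bar>a\<bar>"
    by (simp add: abs_mult[symmetric])
  also have "\<dots> \<le> \<bar>s\<bar> * norm y + B * norm y"
    using assms[of t] c c'' by (intro add_mono mult_mono) auto
  finally have "norm (ode4 s v (\<lambda>_. 0) t y) \<le> norm y + (norm y + (norm y + (\<bar>s\<bar> * norm y + B * norm y)))"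
    unfolding ode4_def y prod.case using c' c''
    by (intro order_trans[OF n4] add_mono) (auto simp flip: y)
  then show ?thesis by (simp add: algebra_simps)
qed

lemma ode4_diff: "ode4 s v g t x - ode4 s v h t y = ode4 s v (\<lambda>t. g t - h t) t (x - y)"
  by (cases x; cases y) (simp add: ode4_def algebra_simps)

lemma ode4_add: "ode4 s v g t x + ode4 s v h t y = ode4 s v (\<lambda>t. g t + h t) t (x + y)"
  by (cases x; cases y) (simp add: ode4_def algebra_simps)

lemma ode4_scale: "c *\<^sub>R ode4 s v g t x = ode4 s v (\<lambda>t. c * g t) t (c *\<^sub>R x)"
  by (cases x) (simp add: ode4_def algebra_simps)

lemma sol4_exists:
  assumes v: "continuous_on UNIV v" "\<And>t. \<bar>v t\<bar> \<le> B"
    and g: "continuous_on UNIV g" "\<And>t. \<bar>g t\<bar> \<le> C"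
  shows "\<exists>y. y 0 = y0 \<and> sol4 s v g y"
  unfolding sol4_def
proof (rule global_ode_exists[where K = "3 + \<bar>s\<bar> + B" and C = C])
  have "(\<lambda>(t, x). ode4 s v g t x) = (\<lambda>p. (fst (snd (snd p)), fst (snd (snd (snd p))), snd (snd (snd (snd p))),
      g (fst p) - s * fst (snd (snd (snd p))) - v (fst p) * fst (snd p)))"
    by (auto simp: ode4_def fun_eq_iff)
  moreover have "continuous_on UNIV \<dots>"
    by (intro continuous_intros continuous_on_compose2[OF v(1)] continuous_on_compose2[OF g(1)]) auto
  ultimately show "continuous_on UNIV (\<lambda>(t, x). ode4 s v g t x)" by simp
  show "norm (ode4 s v g t x - ode4 s v g t y) \<le> (3 + \<bar>s\<bar> + B) * norm (x - y)" for t x y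
    unfolding ode4_diff using norm_ode4_le[OF v(2)] by simp
  show "3 + \<bar>s\<bar> + B > 0" using v(2)[of 0] by (auto intro: add_pos_nonneg)
  show "norm (ode4 s v g t 0) \<le> C" for t
    using g(2)[of t] by (simp add: ode4_def zero_prod_def norm_Pair)
qed

lemma sol4_unique:
  assumes v: "\<And>t. \<bar>v t\<bar> \<le> B" and y: "sol4 s v g y" "sol4 s v g x" "y 0 = x 0"
  shows "y = x"
proof
  fix t
  have "y t - x t = 0"
  proof (rule gronwall_zero[where y = "\<lambda>t. y t - x t"])
    show "((\<lambda>t. y t - x t) has_vector_derivative ode4 s v g t (y t) - ode4 s v g t (x t)) (at t)" for t
      using y by (intro derivative_intros) (auto simp: sol4_def)
    show "norm (ode4 s v g t (y t) - ode4 s v g t (x t)) \<le> (3 + \<bar>s\<bar> + B) * norm (y t - x t)" for t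
      unfolding ode4_diff using norm_ode4_le[OF v] by simp
  qed (use y in auto)
  then show "y t = x t" by simp
qed

lemma sol4_add: "sol4 s v g x \<Longrightarrow> sol4 s v h y \<Longrightarrow> sol4 s v (\<lambda>t. g t + h t) (\<lambda>t. x t + y t)"
  unfolding sol4_def ode4_add[symmetric] by (auto intro: derivative_intros)

lemma sol4_scale: "sol4 s v g x \<Longrightarrow> sol4 s v (\<lambda>t. c * g t) (\<lambda>t. c *\<^sub>R x t)"
  unfolding sol4_def ode4_scale[symmetric]
  by (auto intro: bounded_linear.has_vector_derivative[OF bounded_linear_scaleR_right])

lemma sol4_components:
  assumes "sol4 s v g y"
  defines "f \<equiv> \<lambda>t. fst (y t)" and "f1 \<equiv> \<lambda>t. fst (snd (y t))"
    and "f2 \<equiv> \<lambda>t. fst (snd (snd (y t)))" and "f3 \<equiv> \<lambda>t. snd (snd (snd (y t)))"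
  shows "(f has_real_derivative f1 t) (at t)" (is ?g1) "(f1 has_real_derivative f2 t) (at t)" (is ?g2)
    "(f2 has_real_derivative f3 t) (at t)" (is ?g3)
    "(f3 has_real_derivative g t - s * f2 t - v t * f t) (at t)" (is ?g4)
proof -
  have y: "(y has_vector_derivative ode4 s v g t (y t)) (at t)"
    using assms(1) by (simp add: sol4_def)
  note F = bounded_linear.has_vector_derivative[OF bounded_linear_fst]
  note S = bounded_linear.has_vector_derivative[OF bounded_linear_snd]
  show ?g1 ?g2
    ?g3
    ?g4
    using F[OF y] F[OF S[OF y]] F[OF S[OF S[OF y]]] S[OF S[OF S[OF y]]]
    unfolding f_def f1_def f2_def f3_def has_real_derivative_iff_has_vector_derivative
    by (simp_all add: ode4_def case_prod_beta')
qed

lemma sol4I: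
  assumes "\<And>t. (f has_real_derivative f1 t) (at t)" "\<And>t. (f1 has_real_derivative f2 t) (at t)"
    "\<And>t. (f2 has_real_derivative f3 t) (at t)"
    "\<And>t. (f3 has_real_derivative g t - s * f2 t - v t * f t) (at t)"
  shows "sol4 s v g (\<lambda>t. (f t, f1 t, f2 t, f3 t))"
  unfolding sol4_def ode4_def
  using assms by (auto intro!: has_vector_derivative_Pair
      simp: has_real_derivative_iff_has_vector_derivative)

lemma sol4_smooth:
  assumes y: "sol4 s v g y" and v: "smooth_on UNIV v" and g: "smooth_on UNIV g"
  shows "smooth_on UNIV (\<lambda>t. fst (y t))"
proof -
  let ?f = "\<lambda>t. fst (y t)" and ?f1 = "\<lambda>t. fst (snd (y t))"
    and ?f2 = "\<lambda>t. fst (snd (snd (y t)))" and ?f3 = "\<lambda>t. snd (snd (snd (y t)))"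
  note c = sol4_components[OF y]
  have d: "deriv ?f = ?f1" "deriv ?f1 = ?f2" "deriv ?f2 = ?f3"
    "deriv ?f3 = (\<lambda>t. g t + (- s * ?f2 t + - 1 * (v t * ?f t)))"
    using c[THEN DERIV_imp_deriv] by (simp_all add: fun_eq_iff)
  have diff: "\<forall>x. ?f differentiable (at x)" "\<forall>x. ?f1 differentiable (at x)"
    "\<forall>x. ?f2 differentiable (at x)" "\<forall>x. ?f3 differentiable (at x)"
    unfolding real_differentiable_def using c by blast+
  have "Ck_on n UNIV ?f \<and> Ck_on n UNIV ?f1 \<and> Ck_on n UNIV ?f2 \<and> Ck_on n UNIV ?f3" for n
  proof (induction n)
    case 0
    then show ?case using diff
      by (auto intro!: continuous_at_imp_continuous_on differentiable_imp_continuous_within)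
  next
    case (Suc n)
    have "Ck_on n UNIV (\<lambda>t. g t + (- s * ?f2 t + - 1 * (v t * ?f t)))"
      using Suc.IH v g unfolding smooth_on_def
      by (intro Ck_on_add Ck_on_mult Ck_on_const open_UNIV) auto
    then show ?case unfolding Ck_on_UNIV_Suc d using Suc.IH diff by blast
  qed
  then show ?thesis by (simp add: smooth_on_def)
qed

lemma smooth_sol4:
  assumes f: "smooth_on UNIV f" and eq: "\<And>t. (deriv ^^ 4) f t + s * (deriv ^^ 2) f t + v t * f t = g t"
  shows "sol4 s v g (\<lambda>t. (f t, deriv f t, (deriv ^^ 2) f t, (deriv ^^ 3) f t))"
proof (rule sol4I)
  have d: "((deriv ^^ n) f has_real_derivative (deriv ^^ Suc n) f t) (at t)" for n t
    using smooth_has_deriv[OF smooth_funpow_deriv[OF f]] by simp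
  show "((deriv ^^ 3) f has_real_derivative g t - s * (deriv ^^ 2) f t - v t * f t) (at t)" for t
    using d[of 3 t] by (simp add: eq[symmetric] numeral_eq_Suc)
qed (use smooth_has_deriv[OF smooth_funpow_deriv[OF f]] in
    \<open>auto simp: numeral_eq_Suc intro: smooth_has_deriv f smooth_deriv\<close>)

text \<open>\<open>N\<close> is injective on the hyperplane normal to \<open>p\<close>, so its range has codimension at most one.\<close>

lemma linear_range_eq_hyperplane:
  fixes N :: "'a::euclidean_space \<Rightarrow> 'a"
  assumes N: "linear N" and p: "p \<noteq> 0" and b: "b \<noteq> 0"
    and ker: "\<And>x. N x = 0 \<Longrightarrow> \<exists>c. x = c *\<^sub>R p" and range: "\<And>x. b \<bullet> N x = 0" and y: "b \<bullet> y = 0"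
  shows "\<exists>x. N x = y"
proof -
  interpret linear N by fact
  let ?P = "{x. p \<bullet> x = 0}"
  have P: "subspace ?P" by (rule subspace_hyperplane)
  have "x = 0" if "x \<in> ?P" "N x = 0" for x
    using ker[OF that(2)] that(1) p by auto
  then have "inj_on N ?P"
    using P by (metis (no_types, lifting) inj_onI diff subspace_diff eq_iff_diff_eq_0)
  then have "inj_on N (span ?P)" by (simp only: span_eq_iff[THEN iffD2, OF P])
  then have "dim (N ` ?P) = dim ?P" by (rule dim_image_eq[OF N])
  then have d: "dim {x. b \<bullet> x = 0} \<le> dim (N ` ?P)" using p b by (simp add: dim_hyperplane)
  have "N ` ?P = {x. b \<bullet> x = 0}"
    by (rule subspace_dim_equal[OF linear_subspace_image[OF N P] subspace_hyperplane _ d])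
      (use range in auto)
  then have "y \<in> N ` ?P" using y by simp
  then show ?thesis by auto
qed

text \<open>A solution is periodic iff its Cauchy data are fixed by the monodromy map \<open>M\<close>.  Green's
  identity confines the range of \<open>M - 1\<close> to the hyperplane normal to \<open>b\<close>, and the simple kernel
  makes it fill this hyperplane; orthogonality of \<open>g\<close> to the kernel puts the defect of a particular
  solution there.\<close>

lemma periodic_fredholm:
  fixes v g \<psi> :: "real \<Rightarrow> real"
  assumes v: "smooth_periodic v" and g: "smooth_periodic g" and \<psi>: "smooth_periodic \<psi>"
    and \<psi>_eq: "\<And>z. (deriv ^^ 4) \<psi> z + s * (deriv ^^ 2) \<psi> z + v z * \<psi> z = 0"
    and \<psi>_nz: "\<exists>z. \<psi> z \<noteq> 0"
    and ker: "\<And>f. smooth_periodic f \<Longrightarrow>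
        (\<And>z. (deriv ^^ 4) f z + s * (deriv ^^ 2) f z + v z * f z = 0) \<Longrightarrow> \<exists>c. f = (\<lambda>z. c * \<psi> z)"
    and orth: "integral {0..2 * pi} (\<lambda>z. \<psi> z * g z) = 0"
  shows "\<exists>f. smooth_periodic f \<and>
    (\<forall>z. (deriv ^^ 4) f z + s * (deriv ^^ 2) f z + v z * f z = g z)"
proof -
  have vs: "smooth_on UNIV v" and gs: "smooth_on UNIV g" and \<psi>s: "smooth_on UNIV \<psi>"
    and vp: "v (z + 2 * pi) = v z" and gp: "g (z + 2 * pi) = g z" and \<psi>p: "\<psi> (z + 2 * pi) = \<psi> z" for z
    using v g \<psi> by (auto simp: smooth_periodic_def periodic_fun_simple_def)
  have cv: "continuous_on UNIV v" and cg: "continuous_on UNIV g"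
    using vs gs smooth_on_continuous_on by auto
  obtain B C where B: "\<And>t. \<bar>v t\<bar> \<le> B" and C: "\<And>t. \<bar>g t\<bar> \<le> C"
    using periodic_bounded cv cg v g unfolding smooth_periodic_def by metis
  note ex = sol4_exists[where v = v and B = B, OF cv B]
  note uniq = sol4_unique[where v = v and B = B, OF B]
  obtain y where y: "y 0 = 0" "sol4 s v g y" using ex[OF cg C, of 0 s] by blast
  have "\<forall>x. \<exists>y. y 0 = x \<and> sol4 s v (\<lambda>_. 0) y"
    using ex[of "\<lambda>_. 0" 0] by auto
  then obtain Y where Y: "\<And>x. Y x 0 = x" "\<And>x. sol4 s v (\<lambda>_. 0) (Y x)" by metis
  define N where "N = (\<lambda>x. Y x (2 * pi) - x)"
  have Y_add: "Y (x + x') = (\<lambda>t. Y x t + Y x' t)" for x x'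
    using sol4_add[OF Y(2) Y(2), of x x'] Y by (intro uniq) auto
  have Y_scale: "Y (c *\<^sub>R x) = (\<lambda>t. c *\<^sub>R Y x t)" for c x
    using sol4_scale[OF Y(2), of c x] Y by (intro uniq) auto
  have N: "linear N"
    by (rule linearI) (simp_all add: N_def Y_add Y_scale algebra_simps)
  define \<Psi> where "\<Psi> = (\<lambda>t. (\<psi> t, deriv \<psi> t, (deriv ^^ 2) \<psi> t, (deriv ^^ 3) \<psi> t))"
  have \<Psi>: "sol4 s v (\<lambda>_. 0) \<Psi>"
    unfolding \<Psi>_def by (rule smooth_sol4[OF \<psi>s \<psi>_eq])
  have \<Psi>0: "\<Psi> 0 \<noteq> 0"
  proof
    assume "\<Psi> 0 = 0"
    moreover have "ode4 s v (\<lambda>_. 0) t 0 = 0" for t by (simp add: ode4_def zero_prod_def)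
    then have "sol4 s v (\<lambda>_. 0) (\<lambda>_. 0)" by (simp add: sol4_def)
    ultimately have "\<Psi> = (\<lambda>_. 0)" using \<Psi> by (intro uniq) auto
    then show False using \<psi>_nz by (auto simp: \<Psi>_def fun_eq_iff zero_prod_def)
  qed
  have shift: "(\<lambda>t. x (t + 2 * pi)) = x" if x: "sol4 s v h x" "x (2 * pi) = x 0"
    and h: "\<And>t. h (t + 2 * pi) = h t" for x h
  proof (rule uniq)
    show "sol4 s v h (\<lambda>t. x (t + 2 * pi))"
      unfolding sol4_def
    proof
      fix t
      have "((\<lambda>t. t + 2 * pi) has_vector_derivative 1) (at t)"
        unfolding has_real_derivative_iff_has_vector_derivative[symmetric]
        by (auto intro!: derivative_eq_intros)
      moreover have "(x has_vector_derivative ode4 s v h (t + 2 * pi) (x (t + 2 * pi))) (at (t + 2 * pi))"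
        using x(1) by (simp add: sol4_def)
      ultimately have "(x \<circ> (\<lambda>t. t + 2 * pi) has_vector_derivative
          1 *\<^sub>R ode4 s v h (t + 2 * pi) (x (t + 2 * pi))) (at t)"
        by (rule vector_diff_chain_at)
      then show "((\<lambda>t. x (t + 2 * pi)) has_vector_derivative ode4 s v h t (x (t + 2 * pi))) (at t)"
        by (simp add: o_def ode4_def vp h)
    qed
  qed (use x in auto)
  have periodic_sol: "smooth_periodic (\<lambda>t. fst (x t)) \<and>
      (\<forall>z. (deriv ^^ 4) (\<lambda>t. fst (x t)) z + s * (deriv ^^ 2) (\<lambda>t. fst (x t)) z + v z * fst (x z) = h z)"
    if x: "sol4 s v h x" "x (2 * pi) = x 0" and h: "smooth_on UNIV h" "\<And>t. h (t + 2 * pi) = h t" for x h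
  proof -
    note d = sol4_components[OF x(1), THEN DERIV_imp_deriv]
    have "deriv (\<lambda>t. fst (x t)) = (\<lambda>t. fst (snd (x t)))"
      "deriv (\<lambda>t. fst (snd (x t))) = (\<lambda>t. fst (snd (snd (x t))))"
      "deriv (\<lambda>t. fst (snd (snd (x t)))) = (\<lambda>t. snd (snd (snd (x t))))"
      by (auto simp: d)
    then have "(deriv ^^ 4) (\<lambda>t. fst (x t)) z + s * (deriv ^^ 2) (\<lambda>t. fst (x t)) z + v z * fst (x z) = h z" for z
      using d(4)[of z] by (simp add: numeral_eq_Suc)
    moreover have "fst (x (t + 2 * pi)) = fst (x t)" for t
      using shift[OF x h(2)] by (metis (no_types))
    ultimately show ?thesis
      using sol4_smooth[OF x(1) vs h(1)] by (auto simp: smooth_periodic_def periodic_fun_simple_def)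
  qed
  have kerN: "\<exists>c. x = c *\<^sub>R \<Psi> 0" if "N x = 0" for x
  proof -
    have *: "Y x (2 * pi) = Y x 0" using that by (simp add: N_def Y)
    obtain c where c: "(\<lambda>t. fst (Y x t)) = (\<lambda>z. c * \<psi> z)"
      using ker[of "\<lambda>t. fst (Y x t)"] periodic_sol[OF Y(2) *] by (auto simp: smooth_on_const)
    note co = sol4_components[OF Y(2)[of x], THEN DERIV_imp_deriv]
      sol4_components[OF sol4_scale[OF \<Psi>, of c], THEN DERIV_imp_deriv]
    have 0: "(\<lambda>t. fst (Y x t)) = (\<lambda>t. fst (c *\<^sub>R \<Psi> t))" using c by (simp add: \<Psi>_def)
    have 1: "(\<lambda>t. fst (snd (Y x t))) = (\<lambda>t. fst (snd (c *\<^sub>R \<Psi> t)))"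
      unfolding co(1)[symmetric] co(5)[symmetric] 0 ..
    have 2: "(\<lambda>t. fst (snd (snd (Y x t)))) = (\<lambda>t. fst (snd (snd (c *\<^sub>R \<Psi> t))))"
      unfolding co(2)[symmetric] co(6)[symmetric] 1 ..
    have 3: "(\<lambda>t. snd (snd (snd (Y x t)))) = (\<lambda>t. snd (snd (snd (c *\<^sub>R \<Psi> t))))"
      unfolding co(3)[symmetric] co(7)[symmetric] 2 ..
    have "Y x 0 = c *\<^sub>R \<Psi> 0"
      using 0 1 2 3 by (auto simp: prod_eq_iff fun_eq_iff)
    then show ?thesis using Y by auto
  qed
  \<comment> \<open>The boundary form of Green's identity at \<open>0\<close>, paired with the Cauchy data of \<open>\<psi>\<close>.\<close>
  define b where "b = (- (deriv ^^ 3) \<psi> 0 - s * deriv \<psi> 0, (deriv ^^ 2) \<psi> 0 + s * \<psi> 0, - deriv \<psi> 0, \<psi> 0)"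
  have b: "b \<noteq> 0" using \<Psi>0 by (auto simp: b_def \<Psi>_def zero_prod_def)
  have \<psi>per: "(deriv ^^ n) \<psi> (2 * pi) = (deriv ^^ n) \<psi> 0" for n
  proof -
    have "(deriv ^^ n) \<psi> (t + 2 * pi) = (deriv ^^ n) \<psi> t" for t
    proof (induction n arbitrary: t)
      case (Suc n)
      have "((deriv ^^ n) \<psi> has_real_derivative (deriv ^^ Suc n) \<psi> (t + 2 * pi)) (at (t + 2 * pi))"
        using smooth_has_deriv[OF smooth_funpow_deriv[OF \<psi>s]] by simp
      then have "((\<lambda>t. (deriv ^^ n) \<psi> (t + 2 * pi)) has_real_derivative (deriv ^^ Suc n) \<psi> (t + 2 * pi)) (at t)"
        by (simp add: DERIV_shift)
      then show ?case unfolding Suc.IH by (simp add: DERIV_imp_deriv)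
    qed (simp add: \<psi>p)
    from this[of 0] show ?thesis by simp
  qed
  have green: "((\<lambda>z. \<psi> z * h z) has_integral b \<bullet> (x (2 * pi) - x 0)) {0..2 * pi}"
    if x: "sol4 s v h x" for x h
  proof -
    define f f1 f2 f3 where f: "f = (\<lambda>t. fst (x t))" "f1 = (\<lambda>t. fst (snd (x t)))"
      "f2 = (\<lambda>t. fst (snd (snd (x t))))" "f3 = (\<lambda>t. snd (snd (snd (x t))))"
    have fd: "(f has_real_derivative f1 t) (at t)" "(f1 has_real_derivative f2 t) (at t)"
      "(f2 has_real_derivative f3 t) (at t)"
      "(f3 has_real_derivative h t - s * f2 t - v t * f t) (at t)" for t
      using sol4_components[OF x] by (simp_all add: f)
    have \<psi>d: "((deriv ^^ n) \<psi> has_real_derivative (deriv ^^ Suc n) \<psi> t) (at t)" for n t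
      using smooth_has_deriv[OF smooth_funpow_deriv[OF \<psi>s]] by simp
    define W where "W = (\<lambda>t. \<psi> t * f3 t - deriv \<psi> t * f2 t + (deriv ^^ 2) \<psi> t * f1 t - (deriv ^^ 3) \<psi> t * f t
      + s * (\<psi> t * f1 t - deriv \<psi> t * f t))"
    have "(W has_real_derivative \<psi> t * h t) (at t)" for t
    proof -
      have 4: "(deriv ^^ 4) \<psi> t = - s * (deriv ^^ 2) \<psi> t - v t * \<psi> t" using \<psi>_eq[of t] by simp
      define p1 p2 p3 p4 where p: "p1 = deriv \<psi>" "p2 = (deriv ^^ 2) \<psi>" "p3 = (deriv ^^ 3) \<psi>"
        "p4 = (deriv ^^ 4) \<psi>"
      have [derivative_intros]: "(\<psi> has_real_derivative p1 t) (at t)" "(p1 has_real_derivative p2 t) (at t)"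
        "(p2 has_real_derivative p3 t) (at t)" "(p3 has_real_derivative p4 t) (at t)"
        using \<psi>d[of 0 t] \<psi>d[of 1 t] \<psi>d[of 2 t] \<psi>d[of 3 t] by (simp_all add: p numeral_eq_Suc)
      note [derivative_intros] = fd[of t]
      have "(W has_real_derivative
          \<psi> t * (h t - s * f2 t - v t * f t) + p1 t * f3 t - (p1 t * f3 t + p2 t * f2 t)
          + (p2 t * f2 t + p3 t * f1 t) - (p3 t * f1 t + p4 t * f t)
          + s * ((\<psi> t * f2 t + p1 t * f1 t) - (p1 t * f1 t + p2 t * f t))) (at t)"
        unfolding W_def p[symmetric]
        by (auto intro!: derivative_eq_intros simp: algebra_simps)
      moreover have "p4 t = - s * p2 t - v t * \<psi> t" using 4 by (simp add: p)
      ultimately show ?thesis by (simp add: algebra_simps)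
    qed
    then have "((\<lambda>z. \<psi> z * h z) has_integral W (2 * pi) - W 0) {0..2 * pi}"
      by (intro fundamental_theorem_of_calculus)
        (auto simp: has_real_derivative_iff_has_vector_derivative[symmetric] intro: has_field_derivative_at_within)
    moreover have "W (2 * pi) - W 0 = b \<bullet> (x (2 * pi) - x 0)"
      using \<psi>per[of 0] \<psi>per[of 1] \<psi>per[of 2] \<psi>per[of 3]
      by (cases "x 0"; cases "x (2 * pi)") (simp add: W_def b_def f algebra_simps)
    ultimately show ?thesis by simp
  qed
  have rangeN: "b \<bullet> N x = 0" for x
    using has_integral_unique[OF green[OF Y(2)[of x]]] Y by (simp add: N_def)
  have "b \<bullet> (- y (2 * pi)) = 0"
    using integral_unique[OF green[OF y(2)]] orth y by simp
  then obtain x where x: "N x = - y (2 * pi)"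
    using linear_range_eq_hyperplane[OF N \<Psi>0 b kerN rangeN] by blast
  have "sol4 s v g (\<lambda>t. y t + Y x t)" using sol4_add[OF y(2) Y(2)[of x]] by simp
  moreover have "y (2 * pi) + Y x (2 * pi) = y 0 + Y x 0"
    using x y Y by (simp add: N_def algebra_simps)
  ultimately show ?thesis
    using periodic_sol[of g "\<lambda>t. y t + Y x t"] gs gp by blast
qed

section \<open>Taylor jets at zero\<close>

text \<open>Formal power series carry the coefficients, so that the ring operations, the derivation and
  the composition of jets are those of \<open>real fps\<close>.\<close>

primrec jet :: "nat \<Rightarrow> (real \<Rightarrow> real) \<Rightarrow> real fps \<Rightarrow> bool" where
  "jet 0 f c \<longleftrightarrow> f 0 = fps_nth c 0"
| "jet (Suc n) f c \<longleftrightarrow> f 0 = fps_nth c 0 \<and>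
     (\<exists>f'. (\<forall>\<^sub>F x in nhds 0. (f has_real_derivative f' x) (at x)) \<and> jet n f' (fps_deriv c))"

lemma jet_SucD: "jet (Suc n) f c \<Longrightarrow> jet n f c"
proof (induction n arbitrary: f c)
  case (Suc n)
  from Suc.prems obtain f' where f': "f 0 = fps_nth c 0"
    "\<forall>\<^sub>F x in nhds 0. (f has_real_derivative f' x) (at x)" "jet (Suc n) f' (fps_deriv c)"
    by (auto simp del: jet.simps(2) simp: jet.simps(2)[of "Suc n"])
  from Suc.IH[OF f'(3)] f' show ?case by auto
qed simp

lemma jet_cong:
  assumes "\<forall>\<^sub>F x in nhds 0. f x = g x" "jet n f c"
  shows "jet n g c"
proof (cases n)
  case 0
  then show ?thesis using assms eventually_nhds_x_imp_x[OF assms(1)] by simp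
next
  case (Suc m)
  with assms obtain f' where f': "f 0 = fps_nth c 0"
    "\<forall>\<^sub>F x in nhds 0. (f has_real_derivative f' x) (at x)" "jet m f' (fps_deriv c)" by auto
  have "\<forall>\<^sub>F x in nhds 0. \<forall>\<^sub>F y in nhds x. f y = g y"
    using assms(1) by (simp add: eventually_eventually)
  with f'(2) have "\<forall>\<^sub>F x in nhds 0. (g has_real_derivative f' x) (at x)"
    by eventually_elim (metis DERIV_cong_ev)
  then show ?thesis using f' Suc eventually_nhds_x_imp_x[OF assms(1)] by auto
qed

text \<open>This ties jets to the definition of the coefficients of a formal expansion.\<close>

lemma jet_coeff:
  "jet n f c \<Longrightarrow> j \<le> n \<Longrightarrow> (deriv ^^ j) f 0 / fact j = fps_nth c j"
proof (induction n arbitrary: f c j)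
  case 0
  then show ?case by simp
next
  case (Suc n)
  show ?case
  proof (cases j)
    case 0
    then show ?thesis using Suc.prems by simp
  next
    case (Suc i)
    from Suc.prems obtain f' where f': "\<forall>\<^sub>F x in nhds 0. (f has_real_derivative f' x) (at x)"
      "jet n f' (fps_deriv c)" by auto
    have "\<forall>\<^sub>F x in nhds 0. deriv f x = f' x"
      using f'(1) by eventually_elim (rule DERIV_imp_deriv)
    then have "(deriv ^^ j) f 0 = (deriv ^^ i) f' 0"
      unfolding Suc funpow_Suc_right o_def by (rule higher_deriv_cong_ev) simp
    also have "\<dots> = fact i * fps_nth (fps_deriv c) i"
      using Suc.IH[OF f'(2), of i] Suc.prems Suc by (simp add: field_simps)
    finally have "(deriv ^^ j) f 0 = fact j * fps_nth c j" by (simp add: Suc algebra_simps)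
    then show ?thesis by simp
  qed
qed

lemma jet_const: "jet n (\<lambda>x. a) (fps_const a)"
proof (induction n arbitrary: a)
  case (Suc n)
  have "jet n (\<lambda>x. 0) 0" using Suc[of 0] by simp
  then show ?case by (auto intro!: exI[of _ "\<lambda>x. 0"])
qed simp

lemma jet_id: "jet n (\<lambda>x. x) fps_X"
  using jet_const[of _ 1] by (cases n) (auto intro!: exI[of _ "\<lambda>x. 1"])

lemma jet_add: "jet n f c \<Longrightarrow> jet n g d \<Longrightarrow> jet n (\<lambda>x. f x + g x) (c + d)"
proof (induction n arbitrary: f g c d)
  case (Suc n)
  then obtain f' g' where f': "\<forall>\<^sub>F x in nhds 0. (f has_real_derivative f' x) (at x)" "jet n f' (fps_deriv c)"
    and g': "\<forall>\<^sub>F x in nhds 0. (g has_real_derivative g' x) (at x)" "jet n g' (fps_deriv d)" by auto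
  have "\<forall>\<^sub>F x in nhds 0. ((\<lambda>x. f x + g x) has_real_derivative f' x + g' x) (at x)"
    using f'(1) g'(1) by eventually_elim (rule derivative_intros)
  then show ?case using Suc.prems Suc.IH[OF f'(2) g'(2)] by auto
qed simp

lemma jet_mult: "jet n f c \<Longrightarrow> jet n g d \<Longrightarrow> jet n (\<lambda>x. f x * g x) (c * d)"
proof (induction n arbitrary: f g c d)
  case (Suc n)
  then obtain f' g' where f': "\<forall>\<^sub>F x in nhds 0. (f has_real_derivative f' x) (at x)" "jet n f' (fps_deriv c)"
    and g': "\<forall>\<^sub>F x in nhds 0. (g has_real_derivative g' x) (at x)" "jet n g' (fps_deriv d)" by auto
  have "\<forall>\<^sub>F x in nhds 0. ((\<lambda>x. f x * g x) has_real_derivative f x * g' x + f' x * g x) (at x)"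
    using f'(1) g'(1) by eventually_elim (auto intro!: derivative_eq_intros)
  moreover have "jet n (\<lambda>x. f x * g' x + f' x * g x) (c * fps_deriv d + fps_deriv c * d)"
    using Suc.prems[THEN jet_SucD] f' g' by (intro jet_add Suc.IH)
  ultimately show ?case using Suc.prems by (auto simp: algebra_simps)
qed simp

lemma jet_power: "jet n f c \<Longrightarrow> jet n (\<lambda>x. f x ^ m) (c ^ m)"
proof (induction m)
  case 0
  then show ?case using jet_const[of n 1] by simp
next
  case (Suc m)
  then show ?case using jet_mult[of n f c "\<lambda>x. f x ^ m" "c ^ m"] by simp
qed

definition taylor :: "(real \<Rightarrow> real) \<Rightarrow> real \<Rightarrow> real fps" where
  "taylor V a = Abs_fps (\<lambda>i. (deriv ^^ i) V a / fact i)"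

lemma taylor_nth: "fps_nth (taylor V a) i = (deriv ^^ i) V a / fact i"
  by (simp add: taylor_def)

lemma Suc_times_div_fact: "real (Suc i) * (x / fact (Suc i)) = x / fact i"
  unfolding fact_Suc by (metis nonzero_mult_divide_mult_cancel_left of_nat_neq_0 times_divide_eq_right)

lemma fps_deriv_taylor: "fps_deriv (taylor V a) = taylor (deriv V) a"
proof (rule fps_ext)
  fix i
  have "(deriv ^^ Suc i) V = (deriv ^^ i) (deriv V)" by (simp only: funpow_Suc_right o_def)
  then show "fps_nth (fps_deriv (taylor V a)) i = fps_nth (taylor (deriv V) a) i"
    unfolding fps_deriv_nth taylor_nth Suc_eq_plus1[symmetric] Suc_times_div_fact by simp
qed

lemma jet_compose:
  "smooth_on UNIV V \<Longrightarrow> jet n f c \<Longrightarrow>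
    jet n (\<lambda>x. V (f x)) (taylor V (fps_nth c 0) oo (c - fps_const (fps_nth c 0)))"
proof (induction n arbitrary: V f c)
  case 0
  then show ?case by (simp add: taylor_def)
next
  case (Suc n)
  then obtain f' where f': "\<forall>\<^sub>F x in nhds 0. (f has_real_derivative f' x) (at x)"
    "jet n f' (fps_deriv c)" by auto
  have "\<forall>\<^sub>F x in nhds 0. ((\<lambda>x. V (f x)) has_real_derivative deriv V (f x) * f' x) (at x)"
    using f'(1) by eventually_elim (rule DERIV_chain2[OF smooth_has_deriv[OF Suc.prems(1)]])
  moreover have "jet n (\<lambda>x. deriv V (f x) * f' x)
      ((taylor (deriv V) (fps_nth c 0) oo (c - fps_const (fps_nth c 0))) * fps_deriv c)"
    by (rule jet_mult[OF Suc.IH[OF smooth_deriv[OF Suc.prems(1)] jet_SucD[OF Suc.prems(2)]] f'(2)])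
  ultimately show ?case using Suc.prems
    by (auto simp: fps_compose_deriv fps_deriv_taylor taylor_nth)
qed

lemma eventually_affine_in_open:
  fixes k0 a :: real
  assumes "open I" "k0 \<in> I"
  shows "\<forall>\<^sub>F \<epsilon> in nhds 0. k0 + \<epsilon> * a \<in> I"
proof -
  have "isCont (\<lambda>\<epsilon>. k0 + \<epsilon> * a) 0" by (intro continuous_intros)
  then have "((\<lambda>\<epsilon>. k0 + \<epsilon> * a) \<longlongrightarrow> k0) (nhds 0)"
    by (simp add: continuous_at tendsto_nhds_iff)
  then show ?thesis using assms by (rule topological_tendstoD)
qed

lemma jet_section:
  assumes I: "open I" "k0 \<in> I"
  shows "(\<And>m k. k \<in> I \<Longrightarrow> (G m has_real_derivative G (Suc m) k) (at k)) \<Longrightarrow>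
    jet n (\<lambda>\<epsilon>. G 0 (k0 + \<epsilon> * a)) (Abs_fps (\<lambda>i. a ^ i * G i k0 / fact i))"
proof (induction n arbitrary: G)
  case 0
  then show ?case by simp
next
  case (Suc n)
  have "\<forall>\<^sub>F \<epsilon> in nhds 0. ((\<lambda>\<epsilon>. G 0 (k0 + \<epsilon> * a)) has_real_derivative G (Suc 0) (k0 + \<epsilon> * a) * a) (at \<epsilon>)"
    using eventually_affine_in_open[OF I, of a] by eventually_elim
      (rule DERIV_chain2[where f = "G 0"], auto intro!: Suc.prems derivative_eq_intros)
  moreover have "jet n (\<lambda>\<epsilon>. G (Suc 0) (k0 + \<epsilon> * a)) (Abs_fps (\<lambda>i. a ^ i * G (Suc i) k0 / fact i))"
    using Suc.IH[of "\<lambda>m. G (Suc m)"] Suc.prems by simp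
  then have "jet n (\<lambda>\<epsilon>. G (Suc 0) (k0 + \<epsilon> * a) * a)
      (Abs_fps (\<lambda>i. a ^ i * G (Suc i) k0 / fact i) * fps_const a)"
    by (intro jet_mult jet_const)
  moreover have "Abs_fps (\<lambda>i. a ^ i * G (Suc i) k0 / fact i) * fps_const a
      = fps_deriv (Abs_fps (\<lambda>i. a ^ i * G i k0 / fact i))"
  proof (rule fps_ext)
    fix i
    have "real (Suc i) * (a ^ Suc i * G (Suc i) k0 / fact (Suc i)) = a ^ Suc i * G (Suc i) k0 / fact i"
      by (rule Suc_times_div_fact)
    then show "fps_nth (Abs_fps (\<lambda>i. a ^ i * G (Suc i) k0 / fact i) * fps_const a) i
        = fps_nth (fps_deriv (Abs_fps (\<lambda>i. a ^ i * G i k0 / fact i))) i"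
      by (simp del: of_nat_Suc fact_Suc flip: Suc_eq_plus1)
  qed
  ultimately show ?case by auto
qed

section \<open>The expansion of the residual\<close>

abbreviation pdd :: "nat \<Rightarrow> nat \<Rightarrow> (real \<Rightarrow> real \<Rightarrow> real) \<Rightarrow> real \<Rightarrow> real \<Rightarrow> real" where
  "pdd i j f \<equiv> (pd1 ^^ i) ((pd2 ^^ j) f)"

lemma smooth2_pdd:
  assumes "open J" "smooth2 J f" shows "smooth2 J (pdd i j f)"
proof -
  have "smooth2 J ((pd2 ^^ j) f)" by (induction j) (use assms in \<open>auto intro: smooth2_pd2\<close>)
  then show ?thesis by (induction i) (use assms in \<open>auto intro: smooth2_pd1\<close>)
qed

lemma pd2_pdd:
  assumes J: "open J" "smooth2 J f" "k \<in> J"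
  shows "pd2 (pdd i j f) z k = pdd i (Suc j) f z k"
proof (induction i arbitrary: z)
  case (Suc i)
  have "pd2 (pdd (Suc i) j f) z k = pd1 (pd2 (pdd i j f)) z k"
    using smooth2_pd_commute[OF J(1) smooth2_pdd[OF J(1,2)] J(3)] by simp
  also have "\<dots> = pd1 (pdd i (Suc j) f) z k"
    unfolding pd1_def[of "pd2 _"] pd1_def[of "pdd i (Suc j) f"] Suc.IH ..
  finally show ?case by simp
qed simp

lemma pdd_DERIV1:
  "open J \<Longrightarrow> smooth2 J f \<Longrightarrow> k \<in> J \<Longrightarrow>
    ((\<lambda>s. pdd i j f s k) has_real_derivative pdd (Suc i) j f z k) (at z)"
  using smooth2_DERIV1[OF smooth2_pdd] by simp

lemma pdd_DERIV2:
  "open J \<Longrightarrow> smooth2 J f \<Longrightarrow> k \<in> J \<Longrightarrow>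
    ((\<lambda>s. pdd i j f z s) has_real_derivative pdd i (Suc j) f z k) (at k)"
  using smooth2_DERIV2[OF smooth2_pdd, of J f k i j z] pd2_pdd by metis

lemma pdd_eq_deriv: "pdd i j f z k = (deriv ^^ i) (\<lambda>z. (pd2 ^^ j) f z k) z"
  by (induction i arbitrary: z) (auto simp: pd1_def)

lemma ddx_eqI:
  assumes "((\<lambda>s. F s X) has_real_derivative a) (at \<theta>)" "((\<lambda>s. F \<theta> s) has_real_derivative b) (at X)"
  shows "ddx k0 q \<epsilon> F \<theta> X = (k0 + \<epsilon> * q X) * a + \<epsilon> * b"
  using assms by (simp add: ddx_def pd1_def pd2_def DERIV_imp_deriv)

lemma ddx_cong:
  assumes J: "open J" "X \<in> J" and FG: "\<And>\<theta> X. X \<in> J \<Longrightarrow> F \<theta> X = G \<theta> X"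
  shows "ddx k0 q \<epsilon> F \<theta> X = ddx k0 q \<epsilon> G \<theta> X"
proof -
  have "\<forall>\<^sub>F s in nhds X. F \<theta> s = G \<theta> s"
    using eventually_nhds_in_open[OF J] by eventually_elim (rule FG)
  then have "pd2 F \<theta> X = pd2 G \<theta> X" unfolding pd2_def by (rule deriv_cong_ev) simp
  then show ?thesis by (simp add: ddx_def pd1_def FG[OF J(2)])
qed

text \<open>The terms of order \<open>\<epsilon>\<^sup>n\<close>, \<open>n \<le> 4\<close>, in the fourth power of \<open>\<kappa> \<partial>\<^sub>\<theta> + \<epsilon> \<partial>\<^sub>X\<close>, where
  \<open>\<partial>\<^sub>X \<kappa> = \<epsilon> q'\<close>; the arguments \<open>p\<close> and \<open>Q\<close> hold the partial derivatives and those of \<open>q\<close>.\<close>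

definition ddx4_term :: "real \<Rightarrow> (nat \<Rightarrow> real) \<Rightarrow> (nat \<Rightarrow> nat \<Rightarrow> real) \<Rightarrow> nat \<Rightarrow> real" where
  "ddx4_term \<kappa> Q p n =
    (if n = 0 then \<kappa>^4 * p 4 0
     else if n = 1 then 4 * \<kappa>^3 * p 3 1
     else if n = 2 then 6 * \<kappa>^2 * Q 1 * p 3 0 + 6 * \<kappa>^2 * p 2 2
     else if n = 3 then 4 * \<kappa> * Q 2 * p 2 0 + 12 * \<kappa> * Q 1 * p 2 1 + 4 * \<kappa> * p 1 3
     else 3 * (Q 1)^2 * p 2 0 + Q 3 * p 1 0 + 4 * Q 2 * p 1 1 + 6 * Q 1 * p 1 2 + p 0 4)"

definition ddx2_term :: "real \<Rightarrow> (nat \<Rightarrow> real) \<Rightarrow> (nat \<Rightarrow> nat \<Rightarrow> real) \<Rightarrow> nat \<Rightarrow> real" where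
  "ddx2_term \<kappa> Q p n =
    (if n = 0 then \<kappa>^2 * p 2 0 else if n = 1 then 2 * \<kappa> * p 1 1 else Q 1 * p 1 0 + p 0 2)"

text \<open>\<open>P i j\<close> stands for \<open>\<partial>\<^sub>\<theta>\<^sup>i \<partial>\<^sub>X\<^sup>j F\<close>.  Everything is local in \<open>X\<close>, because the wave family, and with it the
  ansatz, is available only where \<open>k0 + \<epsilon> q(X)\<close> lies in the parameter interval.\<close>

lemma ddx_powers:
  fixes k0 \<epsilon> :: real
  assumes J: "open J" and X: "X \<in> J" and q: "smooth_on UNIV q"
    and F: "\<And>\<theta> X. X \<in> J \<Longrightarrow> F \<theta> X = P 0 0 \<theta> X"
    and P1: "\<And>i j \<theta> X. X \<in> J \<Longrightarrow> j \<le> 3 \<Longrightarrow>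
      ((\<lambda>s. P i j s X) has_real_derivative P (Suc i) j \<theta> X) (at \<theta>)"
    and P2: "\<And>i j \<theta> X. X \<in> J \<Longrightarrow> j \<le> 3 \<Longrightarrow>
      ((\<lambda>s. P i j \<theta> s) has_real_derivative P i (Suc j) \<theta> X) (at X)"
  defines "Q \<equiv> \<lambda>X n. (deriv ^^ n) q X" and "\<kappa> \<equiv> \<lambda>X. k0 + \<epsilon> * q X"
  shows "(ddx k0 q \<epsilon> ^^ 2) F \<theta> X = (\<Sum>n\<le>2. \<epsilon>^n * ddx2_term (\<kappa> X) (Q X) (\<lambda>i j. P i j \<theta> X) n)" (is ?g1)
    and "(ddx k0 q \<epsilon> ^^ 4) F \<theta> X = (\<Sum>n\<le>4. \<epsilon>^n * ddx4_term (\<kappa> X) (Q X) (\<lambda>i j. P i j \<theta> X) n)" (is ?g2)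
proof -
  define q0 q1 q2 q3 where q0123: "q0 = q" "q1 = deriv q" "q2 = deriv q1" "q3 = deriv q2"
  have qd: "(q0 has_real_derivative q1 X) (at X)" "(q1 has_real_derivative q2 X) (at X)"
    "(q2 has_real_derivative q3 X) (at X)" for X
    unfolding q0123 using q by (auto intro!: smooth_has_deriv smooth_deriv)
  define F1 where "F1 = (\<lambda>\<theta> X. (k0 + \<epsilon> * q0 X) * P 1 0 \<theta> X + \<epsilon> * P 0 1 \<theta> X)"
  have F1: "ddx k0 q \<epsilon> F \<theta> X = F1 \<theta> X" if X: "X \<in> J" for \<theta> X
  proof -
    have "ddx k0 q \<epsilon> F \<theta> X = ddx k0 q \<epsilon> (P 0 0) \<theta> X" by (rule ddx_cong[OF J X F])
    also have "\<dots> = F1 \<theta> X"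
      unfolding F1_def q0123(1)
      by (rule ddx_eqI) (use P1[OF X, of 0 0] P2[OF X, of 0 0] in simp_all)
    finally show ?thesis .
  qed
  define F2 where "F2 = (\<lambda>\<theta> X. (k0 + \<epsilon> * q0 X)^2 * P 2 0 \<theta> X
    + \<epsilon> * (2 * (k0 + \<epsilon> * q0 X) * P 1 1 \<theta> X) + \<epsilon>^2 * (q1 X * P 1 0 \<theta> X + P 0 2 \<theta> X))"
  have F2: "ddx k0 q \<epsilon> (ddx k0 q \<epsilon> F) \<theta> X = F2 \<theta> X" if X: "X \<in> J" for \<theta> X
  proof -
    have "ddx k0 q \<epsilon> F1 \<theta> X = (k0 + \<epsilon> * q X) * ((k0 + \<epsilon> * q0 X) * P 2 0 \<theta> X + \<epsilon> * P 1 1 \<theta> X)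
      + \<epsilon> * ((k0 + \<epsilon> * q0 X) * P 1 1 \<theta> X + \<epsilon> * q1 X * P 1 0 \<theta> X + \<epsilon> * P 0 2 \<theta> X)"
      unfolding F1_def
      by (rule ddx_eqI)
        (auto intro!: derivative_eq_intros P1 P2 X qd simp: numeral_eq_Suc algebra_simps)
    also have "\<dots> = F2 \<theta> X" by (simp add: F2_def q0123(1) power2_eq_square algebra_simps)
    finally show ?thesis using ddx_cong[OF J X F1] by simp
  qed
  define F3 where "F3 = (\<lambda>\<theta> X. (k0 + \<epsilon> * q0 X)^3 * P 3 0 \<theta> X
    + 3 * \<epsilon> * ((k0 + \<epsilon> * q0 X)^2 * P 2 1 \<theta> X)
    + 3 * \<epsilon>^2 * ((k0 + \<epsilon> * q0 X) * (q1 X * P 2 0 \<theta> X + P 1 2 \<theta> X))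
    + \<epsilon>^3 * (q2 X * P 1 0 \<theta> X + 3 * q1 X * P 1 1 \<theta> X + P 0 3 \<theta> X))"
  have F3: "ddx k0 q \<epsilon> (ddx k0 q \<epsilon> (ddx k0 q \<epsilon> F)) \<theta> X = F3 \<theta> X" if X: "X \<in> J" for \<theta> X
  proof -
    have "ddx k0 q \<epsilon> F2 \<theta> X = (k0 + \<epsilon> * q X) * ((k0 + \<epsilon> * q0 X)^2 * P 3 0 \<theta> X
        + \<epsilon> * (2 * (k0 + \<epsilon> * q0 X) * P 2 1 \<theta> X) + \<epsilon>^2 * (q1 X * P 2 0 \<theta> X + P 1 2 \<theta> X))
      + \<epsilon> * ((k0 + \<epsilon> * q0 X)^2 * P 2 1 \<theta> X + 2 * (k0 + \<epsilon> * q0 X) * (\<epsilon> * q1 X) * P 2 0 \<theta> X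
        + \<epsilon> * (2 * (k0 + \<epsilon> * q0 X) * P 1 2 \<theta> X + 2 * (\<epsilon> * q1 X) * P 1 1 \<theta> X)
        + \<epsilon>^2 * (q1 X * P 1 1 \<theta> X + q2 X * P 1 0 \<theta> X + P 0 3 \<theta> X))"
      unfolding F2_def
      by (rule ddx_eqI)
        (auto intro!: derivative_eq_intros P1 P2 X qd simp: numeral_eq_Suc algebra_simps)
    also have "\<dots> = F3 \<theta> X"
      by (simp add: F3_def q0123(1) power2_eq_square power3_eq_cube algebra_simps)
    finally show ?thesis using ddx_cong[OF J X F2] by simp
  qed
  have F4: "ddx k0 q \<epsilon> (ddx k0 q \<epsilon> (ddx k0 q \<epsilon> (ddx k0 q \<epsilon> F))) \<theta> X
    = (k0 + \<epsilon> * q X)^4 * P 4 0 \<theta> X + \<epsilon> * (4 * (k0 + \<epsilon> * q X)^3 * P 3 1 \<theta> X)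
    + \<epsilon>^2 * (6 * (k0 + \<epsilon> * q X)^2 * q1 X * P 3 0 \<theta> X + 6 * (k0 + \<epsilon> * q X)^2 * P 2 2 \<theta> X)
    + \<epsilon>^3 * (4 * (k0 + \<epsilon> * q X) * q2 X * P 2 0 \<theta> X + 12 * (k0 + \<epsilon> * q X) * q1 X * P 2 1 \<theta> X
        + 4 * (k0 + \<epsilon> * q X) * P 1 3 \<theta> X)
    + \<epsilon>^4 * (3 * (q1 X)^2 * P 2 0 \<theta> X + q3 X * P 1 0 \<theta> X + 4 * q2 X * P 1 1 \<theta> X + 6 * q1 X * P 1 2 \<theta> X
        + P 0 4 \<theta> X)"
    (is "_ = ?R")
  proof -
    have "ddx k0 q \<epsilon> F3 \<theta> X = (k0 + \<epsilon> * q X) * ((k0 + \<epsilon> * q0 X)^3 * P 4 0 \<theta> X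
        + 3 * \<epsilon> * ((k0 + \<epsilon> * q0 X)^2 * P 3 1 \<theta> X)
        + 3 * \<epsilon>^2 * ((k0 + \<epsilon> * q0 X) * (q1 X * P 3 0 \<theta> X + P 2 2 \<theta> X))
        + \<epsilon>^3 * (q2 X * P 2 0 \<theta> X + 3 * q1 X * P 2 1 \<theta> X + P 1 3 \<theta> X))
      + \<epsilon> * ((k0 + \<epsilon> * q0 X)^3 * P 3 1 \<theta> X + 3 * (k0 + \<epsilon> * q0 X)^2 * (\<epsilon> * q1 X) * P 3 0 \<theta> X
        + 3 * \<epsilon> * ((k0 + \<epsilon> * q0 X)^2 * P 2 2 \<theta> X + 2 * (k0 + \<epsilon> * q0 X) * (\<epsilon> * q1 X) * P 2 1 \<theta> X)
        + 3 * \<epsilon>^2 * ((k0 + \<epsilon> * q0 X) * (q1 X * P 2 1 \<theta> X + q2 X * P 2 0 \<theta> X + P 1 3 \<theta> X)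
          + (\<epsilon> * q1 X) * (q1 X * P 2 0 \<theta> X + P 1 2 \<theta> X))
        + \<epsilon>^3 * (q2 X * P 1 1 \<theta> X + q3 X * P 1 0 \<theta> X + 3 * (q1 X * P 1 2 \<theta> X + q2 X * P 1 1 \<theta> X)
          + P 0 4 \<theta> X))"
      unfolding F3_def
      by (rule ddx_eqI)
        (auto intro!: derivative_eq_intros P1 P2 X qd simp: numeral_eq_Suc algebra_simps)
    also have "\<dots> = ?R"
      by (simp add: q0123(1) power2_eq_square power3_eq_cube power4_eq_xxxx algebra_simps)
    finally show ?thesis using ddx_cong[OF J X F3] by simp
  qed
  have Q: "Q X 0 = q X" "Q X 1 = q1 X" "Q X 2 = q2 X" "Q X 3 = q3 X" for X
    by (simp_all add: Q_def q0123 numeral_eq_Suc)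
  show ?g1
    using F2[OF X, of \<theta>] Q by (simp add: numeral_2_eq_2 F2_def ddx2_term_def \<kappa>_def q0123(1))
  show ?g2
    using F4 Q by (simp add: eval_nat_numeral atMost_Suc ddx4_term_def \<kappa>_def)
qed

lemma fps_mult_nth_2:
  "fps_nth (a * b) 2 = fps_nth a 0 * fps_nth b 2 + fps_nth a 1 * fps_nth b 1
    + fps_nth a 2 * fps_nth b 0" for a b :: "'a::comm_semiring_1 fps"
  by (simp add: fps_mult_nth numeral_2_eq_2)

lemma fps_compose_nth_le_4:
  fixes a b :: "real fps"
  assumes "fps_nth b 0 = 0"
  shows "fps_nth (a oo b) 0 = fps_nth a 0"
    and "fps_nth (a oo b) 1 = fps_nth a 1 * fps_nth b 1"
    and "fps_nth (a oo b) 2 = fps_nth a 1 * fps_nth b 2 + fps_nth a 2 * (fps_nth b 1)^2"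
    and "fps_nth (a oo b) 3 = fps_nth a 1 * fps_nth b 3
      + 2 * fps_nth a 2 * fps_nth b 1 * fps_nth b 2 + fps_nth a 3 * (fps_nth b 1)^3"
    and "fps_nth (a oo b) 4 = fps_nth a 1 * fps_nth b 4
      + fps_nth a 2 * (2 * fps_nth b 1 * fps_nth b 3 + (fps_nth b 2)^2)
      + 3 * fps_nth a 3 * (fps_nth b 1)^2 * fps_nth b 2 + fps_nth a 4 * (fps_nth b 1)^4"
  using assms
  by (simp_all add: fps_compose_nth fps_mult_nth numeral_eq_Suc atLeast0_atMost_Suc algebra_simps)

lemma fps_affine_power_nth:
  fixes a b :: real
  defines "K \<equiv> fps_const a + fps_X * fps_const b"
  shows "fps_nth (K ^ m) 0 = a ^ m" and "fps_nth (K ^ m) 1 = real m * a ^ (m - 1) * b"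
    and "fps_nth (K ^ m) 2 = real (m * (m - 1)) / 2 * a ^ (m - 2) * b^2"
proof -
  have K: "fps_nth K 0 = a" "fps_nth K 1 = b" "fps_nth K 2 = 0"
    by (simp_all add: K_def numeral_2_eq_2)
  show 0: "fps_nth (K ^ m) 0 = a ^ m" for m by (induction m) (simp_all add: K)
  show 1: "fps_nth (K ^ m) 1 = real m * a ^ (m - 1) * b" for m
  proof (induction m)
    case (Suc m)
    then show ?case using K by (cases m) (simp_all add: 0 fps_mult_nth_1 algebra_simps)
  qed simp
  show "fps_nth (K ^ m) 2 = real (m * (m - 1)) / 2 * a ^ (m - 2) * b^2"
  proof (induction m)
    case (Suc m)
    have "fps_nth (K ^ Suc m) 2 = a * fps_nth (K ^ m) 2 + b * fps_nth (K ^ m) 1"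
      unfolding power_Suc fps_mult_nth_2 K by simp
    also have "\<dots> = real (Suc m * (Suc m - 1)) / 2 * a ^ (Suc m - 2) * b^2"
    proof (cases m)
      case m: (Suc l)
      show ?thesis
        unfolding Suc.IH 1 unfolding m by (cases l) (simp_all add: power2_eq_square field_simps)
    qed simp
    finally show ?case .
  qed simp
qed

lemma sum_le2: "(\<Sum>n\<le>2. f n) = f 0 + f 1 + f 2" for f :: "nat \<Rightarrow> real"
  by (simp add: eval_nat_numeral atMost_Suc)

lemma sum_le4: "(\<Sum>n\<le>4. f n) = f 0 + f 1 + f 2 + f 3 + f 4" for f :: "nat \<Rightarrow> real"
  by (simp add: eval_nat_numeral atMost_Suc)

text \<open>The part of order \<open>\<epsilon>\<^sup>n\<close> of \<open>D\<^sup>4 + \<sigma> D\<^sup>2\<close>, \<open>D = \<kappa> \<partial>\<^sub>\<theta> + \<epsilon> \<partial>\<^sub>X\<close>, with \<open>\<kappa>\<close> left unexpanded.\<close>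

definition op_term :: "real \<Rightarrow> real \<Rightarrow> (nat \<Rightarrow> real) \<Rightarrow> (nat \<Rightarrow> nat \<Rightarrow> real) \<Rightarrow> nat \<Rightarrow> real" where
  "op_term \<sigma> \<kappa> Q p n = ddx4_term \<kappa> Q p n + \<sigma> * (if n \<le> 2 then ddx2_term \<kappa> Q p n else 0)"

lemma op_term_linear:
  "op_term \<sigma> \<kappa> Q (\<lambda>i j. a i j + x * b i j + y * c i j + z * d i j) n
    = op_term \<sigma> \<kappa> Q a n + x * op_term \<sigma> \<kappa> Q b n + y * op_term \<sigma> \<kappa> Q c n + z * op_term \<sigma> \<kappa> Q d n"
  by (simp add: op_term_def ddx4_term_def ddx2_term_def algebra_simps)

text \<open>The \<open>X\<close>-derivatives of \<open>u \<theta> (k0 + \<epsilon> q(X))\<close>; here \<open>U i j\<close> is \<open>\<partial>\<^sub>z\<^sup>i \<partial>\<^sub>k\<^sup>j u\<close>.\<close>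

definition modulated :: "real \<Rightarrow> (nat \<Rightarrow> real) \<Rightarrow> (nat \<Rightarrow> nat \<Rightarrow> real) \<Rightarrow> nat \<Rightarrow> nat \<Rightarrow> real" where
  "modulated \<epsilon> Q U i j =
    (if j = 0 then U i 0
     else if j = 1 then \<epsilon> * Q 1 * U i 1
     else if j = 2 then \<epsilon> * Q 2 * U i 1 + \<epsilon>^2 * (Q 1)^2 * U i 2
     else if j = 3 then \<epsilon> * Q 3 * U i 1 + 3 * \<epsilon>^2 * Q 1 * Q 2 * U i 2 + \<epsilon>^3 * (Q 1)^3 * U i 3
     else \<epsilon> * Q 4 * U i 1 + \<epsilon>^2 * (3 * (Q 2)^2 + 4 * Q 1 * Q 3) * U i 2
       + 6 * \<epsilon>^3 * (Q 1)^2 * Q 2 * U i 3 + \<epsilon>^4 * (Q 1)^4 * U i 4)"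

text \<open>What the modulated wave contributes at the orders \<open>2\<close>, \<open>3\<close>, \<open>4\<close> and beyond, once
  \<open>\<kappa>\<^sup>4 u\<^sub>z\<^sub>z\<^sub>z\<^sub>z + \<sigma> \<kappa>\<^sup>2 u\<^sub>z\<^sub>z\<close> is set aside: every remaining term carries an \<open>X\<close>-derivative of \<open>q\<close>.\<close>

definition wave_part2 :: "real \<Rightarrow> real \<Rightarrow> (nat \<Rightarrow> real) \<Rightarrow> (nat \<Rightarrow> nat \<Rightarrow> real) \<Rightarrow> real" where
  "wave_part2 \<sigma> \<kappa> Q U = Q 1 * (4 * \<kappa>^3 * U 3 1 + 6 * \<kappa>^2 * U 3 0 + 2 * \<sigma> * \<kappa> * U 1 1 + \<sigma> * U 1 0)"

definition wave_part3 :: "real \<Rightarrow> real \<Rightarrow> (nat \<Rightarrow> real) \<Rightarrow> (nat \<Rightarrow> nat \<Rightarrow> real) \<Rightarrow> real" where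
  "wave_part3 \<sigma> \<kappa> Q U = Q 2 * (6 * \<kappa>^2 * U 2 1 + 4 * \<kappa> * U 2 0 + \<sigma> * U 0 1)"

definition wave_part4 :: "real \<Rightarrow> real \<Rightarrow> (nat \<Rightarrow> real) \<Rightarrow> (nat \<Rightarrow> nat \<Rightarrow> real) \<Rightarrow> real" where
  "wave_part4 \<sigma> \<kappa> Q U = Q 3 * (4 * \<kappa> * U 1 1 + U 1 0)
    + (Q 1)^2 * (6 * \<kappa>^2 * U 2 2 + 12 * \<kappa> * U 2 1 + 3 * U 2 0 + \<sigma> * U 0 2)"

definition wave_rest :: "real \<Rightarrow> real \<Rightarrow> (nat \<Rightarrow> real) \<Rightarrow> (nat \<Rightarrow> nat \<Rightarrow> real) \<Rightarrow> real" where
  "wave_rest \<epsilon> \<kappa> Q U = 4 * \<kappa> * (3 * Q 1 * Q 2 * U 1 2 + \<epsilon> * (Q 1)^3 * U 1 3)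
    + 4 * Q 2 * Q 1 * U 1 1 + 6 * Q 1 * (Q 2 * U 1 1 + \<epsilon> * (Q 1)^2 * U 1 2) + Q 4 * U 0 1
    + \<epsilon> * (3 * (Q 2)^2 + 4 * Q 1 * Q 3) * U 0 2 + 6 * \<epsilon>^2 * (Q 1)^2 * Q 2 * U 0 3 + \<epsilon>^3 * (Q 1)^4 * U 0 4"

lemma op_term_modulated:
  "(\<Sum>n\<le>4. \<epsilon>^n * op_term \<sigma> \<kappa> Q (modulated \<epsilon> Q U) n) = \<kappa>^4 * U 4 0 + \<sigma> * \<kappa>^2 * U 2 0
    + \<epsilon>^2 * wave_part2 \<sigma> \<kappa> Q U + \<epsilon>^3 * wave_part3 \<sigma> \<kappa> Q U + \<epsilon>^4 * wave_part4 \<sigma> \<kappa> Q U + \<epsilon>^5 * wave_rest \<epsilon> \<kappa> Q U"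
proof -
  show ?thesis
    unfolding sum_le4 wave_part2_def wave_part3_def wave_part4_def wave_rest_def
    by (simp add: op_term_def ddx4_term_def ddx2_term_def modulated_def) algebra
qed

locale wave_family =
  fixes \<sigma> k0 :: real and V :: "real \<Rightarrow> real" and u :: "real \<Rightarrow> real \<Rightarrow> real" and I :: "real set"
  assumes V_smooth: "smooth_on UNIV V"
    and I_open: "open I" and I_interval: "is_interval I"
    and u_smooth: "smooth2 I u"
    and u_ode: "\<And>k z. k \<in> I \<Longrightarrow>
          k^4 * (pd1 ^^ 4) u z k + \<sigma> * k^2 * (pd1 ^^ 2) u z k + deriv V (u z k) = 0"
    and k0: "k0 \<in> I"
begin

lemma u_DERIV1: "k \<in> I \<Longrightarrow> ((\<lambda>s. pdd i j u s k) has_real_derivative pdd (Suc i) j u z k) (at z)"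
  by (rule pdd_DERIV1[OF I_open u_smooth])

lemma u_DERIV2: "k \<in> I \<Longrightarrow> ((\<lambda>s. pdd i j u z s) has_real_derivative pdd i (Suc j) u z k) (at k)"
  by (rule pdd_DERIV2[OF I_open u_smooth])

text \<open>With \<open>\<kappa> = k0 + \<epsilon> q\<close> unexpanded, the wave equation at wave number \<open>\<kappa>\<close> removes the terms of the
  modulated wave without \<open>X\<close>-derivatives exactly, leaving \<open>- V'(u(\<theta>, \<kappa>))\<close>.\<close>

lemma residual_eq:
  fixes q :: "real \<Rightarrow> real" and \<epsilon> \<theta> X :: real
  assumes q: "smooth_on UNIV q"
    and w: "smooth2 UNIV w2" "smooth2 UNIV w3" "smooth2 UNIV w4"
    and \<epsilon>: "k0 + \<epsilon> * q X \<in> I"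
  defines "Q \<equiv> \<lambda>n. (deriv ^^ n) q X" and "\<kappa> \<equiv> k0 + \<epsilon> * q X"
    and "p \<equiv> \<lambda>w i j. pdd i j w \<theta> X"
  shows "residual \<sigma> V u k0 q w2 w3 w4 \<epsilon> \<theta> X =
    \<epsilon>^2 * (wave_part2 \<sigma> \<kappa> Q (\<lambda>i j. pdd i j u \<theta> \<kappa>) + op_term \<sigma> \<kappa> Q (p w2) 0)
    + \<epsilon>^3 * (wave_part3 \<sigma> \<kappa> Q (\<lambda>i j. pdd i j u \<theta> \<kappa>) + op_term \<sigma> \<kappa> Q (p w2) 1 + op_term \<sigma> \<kappa> Q (p w3) 0)
    + \<epsilon>^4 * (wave_part4 \<sigma> \<kappa> Q (\<lambda>i j. pdd i j u \<theta> \<kappa>) + op_term \<sigma> \<kappa> Q (p w2) 2 + op_term \<sigma> \<kappa> Q (p w3) 1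
        + op_term \<sigma> \<kappa> Q (p w4) 0)
    + \<epsilon>^5 * (wave_rest \<epsilon> \<kappa> Q (\<lambda>i j. pdd i j u \<theta> \<kappa>) + op_term \<sigma> \<kappa> Q (p w2) 3 + \<epsilon> * op_term \<sigma> \<kappa> Q (p w2) 4
        + op_term \<sigma> \<kappa> Q (p w3) 2 + \<epsilon> * op_term \<sigma> \<kappa> Q (p w3) 3 + \<epsilon>^2 * op_term \<sigma> \<kappa> Q (p w3) 4
        + op_term \<sigma> \<kappa> Q (p w4) 1 + \<epsilon> * op_term \<sigma> \<kappa> Q (p w4) 2 + \<epsilon>^2 * op_term \<sigma> \<kappa> Q (p w4) 3
        + \<epsilon>^3 * op_term \<sigma> \<kappa> Q (p w4) 4)
    + (deriv V (u \<theta> \<kappa> + \<epsilon>^2 * w2 \<theta> X + \<epsilon>^3 * w3 \<theta> X + \<epsilon>^4 * w4 \<theta> X) - deriv V (u \<theta> \<kappa>))"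
proof -
  define J where "J = {X. k0 + \<epsilon> * q X \<in> I}"
  have "continuous_on UNIV q" using q by (rule smooth_on_continuous_on)
  then have "open ((\<lambda>X. k0 + \<epsilon> * q X) -` I)"
    by (intro open_vimage I_open continuous_intros)
  then have J: "open J" by (simp add: J_def vimage_def)
  have XJ: "X \<in> J" using \<epsilon> by (simp add: J_def)
  define M where "M = (\<lambda>i j \<theta> X. modulated \<epsilon> (\<lambda>n. (deriv ^^ n) q X) (\<lambda>i j. pdd i j u \<theta> (k0 + \<epsilon> * q X)) i j)"
  define P where "P = (\<lambda>i j \<theta> X. M i j \<theta> X
    + \<epsilon>^2 * pdd i j w2 \<theta> X + \<epsilon>^3 * pdd i j w3 \<theta> X + \<epsilon>^4 * pdd i j w4 \<theta> X)"
  define U where "U = ansatz u k0 q w2 w3 w4 \<epsilon>"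
  have U: "U \<theta> X = P 0 0 \<theta> X" for \<theta> X
    by (simp add: U_def ansatz_def P_def M_def modulated_def)
  have qD: "((deriv ^^ n) q has_real_derivative (deriv ^^ Suc n) q X) (at X)" for n X
    using smooth_has_deriv[OF smooth_funpow_deriv[OF q]] by simp
  have jc: "j = 0 \<or> j = 1 \<or> j = 2 \<or> j = 3" if "j \<le> 3" for j :: nat using that by auto
  have M1: "((\<lambda>s. M i j s X) has_real_derivative M (Suc i) j \<theta> X) (at \<theta>)" if "X \<in> J" "j \<le> 3" for i j \<theta> X
    using jc[OF that(2)] that(1) unfolding M_def modulated_def J_def
    by (elim disjE) (auto intro!: derivative_eq_intros u_DERIV1 u_DERIV1[where j = 0, unfolded funpow_0]
        simp del: funpow.simps)
  have M2: "((\<lambda>s. M i j \<theta> s) has_real_derivative M i (Suc j) \<theta> X) (at X)" if X: "X \<in> J" "j \<le> 3" for i j \<theta> X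
  proof -
    define q0 q1 q2 q3 q4 where q': "q0 = q" "q1 = (deriv ^^ 1) q" "q2 = (deriv ^^ 2) q"
      "q3 = (deriv ^^ 3) q" "q4 = (deriv ^^ 4) q"
    have qd: "(q0 has_real_derivative q1 X) (at X)" "(q1 has_real_derivative q2 X) (at X)"
      "(q2 has_real_derivative q3 X) (at X)" "(q3 has_real_derivative q4 X) (at X)"
      using qD[of 0 X] qD[of 1 X] qD[of 2 X] qD[of 3 X] by (simp_all add: q' numeral_eq_Suc)
    define g where "g = (\<lambda>j s. pdd i j u \<theta> (k0 + \<epsilon> * q0 s))"
    have "(g j has_real_derivative pdd i (Suc j) u \<theta> (k0 + \<epsilon> * q0 X) * (\<epsilon> * q1 X)) (at X)" for j
      unfolding g_def
    proof (rule DERIV_chain2[where f = "\<lambda>s. pdd i j u \<theta> s" and g = "\<lambda>s. k0 + \<epsilon> * q0 s"])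
      show "((\<lambda>s. pdd i j u \<theta> s) has_real_derivative pdd i (Suc j) u \<theta> (k0 + \<epsilon> * q0 X)) (at (k0 + \<epsilon> * q0 X))"
        using X by (intro u_DERIV2) (simp add: J_def q')
      show "((\<lambda>s. k0 + \<epsilon> * q0 s) has_real_derivative \<epsilon> * q1 X) (at X)"
        using qd by (auto intro!: derivative_eq_intros)
    qed
    then have gd: "(g j has_real_derivative g (Suc j) X * (\<epsilon> * q1 X)) (at X)" for j
      by (simp add: g_def)
    have gd': "(g 0 has_real_derivative g 1 X * (\<epsilon> * q1 X)) (at X)"
       "(g 1 has_real_derivative g 2 X * (\<epsilon> * q1 X)) (at X)"
       "(g 2 has_real_derivative g 3 X * (\<epsilon> * q1 X)) (at X)"
       "(g 3 has_real_derivative g 4 X * (\<epsilon> * q1 X)) (at X)"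
      using gd[of 0] gd[of 1] gd[of 2] gd[of 3] by (simp_all add: numeral_eq_Suc)
    have Mg: "M i 0 \<theta> = (\<lambda>s. g 0 s)" "M i 1 \<theta> = (\<lambda>s. \<epsilon> * q1 s * g 1 s)"
      "M i 2 \<theta> = (\<lambda>s. \<epsilon> * q2 s * g 1 s + \<epsilon>^2 * (q1 s)^2 * g 2 s)"
      "M i 3 \<theta> = (\<lambda>s. \<epsilon> * q3 s * g 1 s + 3 * \<epsilon>^2 * q1 s * q2 s * g 2 s + \<epsilon>^3 * (q1 s)^3 * g 3 s)"
      "M i 4 \<theta> = (\<lambda>s. \<epsilon> * q4 s * g 1 s + \<epsilon>^2 * (3 * (q2 s)^2 + 4 * q1 s * q3 s) * g 2 s
        + 6 * \<epsilon>^3 * (q1 s)^2 * q2 s * g 3 s + \<epsilon>^4 * (q1 s)^4 * g 4 s)"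
      unfolding q' g_def M_def modulated_def by simp_all
    have "(M i 0 \<theta> has_real_derivative M i 1 \<theta> X) (at X)"
      unfolding Mg using gd'(1) by (simp add: algebra_simps)
    moreover have "(M i 1 \<theta> has_real_derivative M i 2 \<theta> X) (at X)"
      unfolding Mg by (rule derivative_eq_intros gd' qd refl)+ (simp add: power2_eq_square algebra_simps)
    moreover have "(M i 2 \<theta> has_real_derivative M i 3 \<theta> X) (at X)"
      unfolding Mg by (rule derivative_eq_intros gd' qd refl)+
        (simp add: power2_eq_square power3_eq_cube algebra_simps)
    moreover have "(M i 3 \<theta> has_real_derivative M i 4 \<theta> X) (at X)"
      unfolding Mg by (rule derivative_eq_intros gd' qd refl)+
        (simp add: power2_eq_square power3_eq_cube power4_eq_xxxx algebra_simps)
    ultimately show ?thesis using jc[OF X(2)] by (auto simp: numeral_eq_Suc)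
  qed
  have P1: "((\<lambda>s. P i j s X) has_real_derivative P (Suc i) j \<theta> X) (at \<theta>)" if "X \<in> J" "j \<le> 3" for i j \<theta> X
    unfolding P_def using w
    by (intro DERIV_add DERIV_cmult M1[OF that] pdd_DERIV1[of UNIV]) auto
  have P2: "((\<lambda>s. P i j \<theta> s) has_real_derivative P i (Suc j) \<theta> X) (at X)" if "X \<in> J" "j \<le> 3" for i j \<theta> X
    unfolding P_def using w
    by (intro DERIV_add DERIV_cmult M2[OF that] pdd_DERIV2[of UNIV]) auto
  note dp = ddx_powers[OF J XJ q, of U P k0 \<epsilon> \<theta>, OF U P1 P2]
  have "(ddx k0 q \<epsilon> ^^ 4) U \<theta> X + \<sigma> * (ddx k0 q \<epsilon> ^^ 2) U \<theta> X
      = (\<Sum>n\<le>4. \<epsilon>^n * op_term \<sigma> \<kappa> Q (\<lambda>i j. P i j \<theta> X) n)"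
    using dp by (simp add: sum_le2 sum_le4 op_term_def Q_def \<kappa>_def algebra_simps)
  also have "\<dots> = (\<Sum>n\<le>4. \<epsilon>^n * op_term \<sigma> \<kappa> Q (modulated \<epsilon> Q (\<lambda>i j. pdd i j u \<theta> \<kappa>)) n)
      + \<epsilon>^2 * (\<Sum>n\<le>4. \<epsilon>^n * op_term \<sigma> \<kappa> Q (p w2) n) + \<epsilon>^3 * (\<Sum>n\<le>4. \<epsilon>^n * op_term \<sigma> \<kappa> Q (p w3) n)
      + \<epsilon>^4 * (\<Sum>n\<le>4. \<epsilon>^n * op_term \<sigma> \<kappa> Q (p w4) n)"
    unfolding P_def op_term_linear p_def M_def Q_def[symmetric] \<kappa>_def[symmetric]
    by (simp add: sum_le4 algebra_simps)
  finally have D: "(ddx k0 q \<epsilon> ^^ 4) U \<theta> X + \<sigma> * (ddx k0 q \<epsilon> ^^ 2) U \<theta> X = \<dots>" .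
  have ode: "\<kappa>^4 * pdd 4 0 u \<theta> \<kappa> + \<sigma> * \<kappa>^2 * pdd 2 0 u \<theta> \<kappa> = - deriv V (u \<theta> \<kappa>)"
    using u_ode[of \<kappa> \<theta>] \<epsilon> by (simp add: \<kappa>_def)
  have Uval: "U \<theta> X = u \<theta> \<kappa> + \<epsilon>^2 * w2 \<theta> X + \<epsilon>^3 * w3 \<theta> X + \<epsilon>^4 * w4 \<theta> X"
    by (simp add: U_def ansatz_def \<kappa>_def)
  show ?thesis
    unfolding residual_def Let_def U_def[symmetric] D op_term_modulated ode sum_le4 Uval
    by (simp add: algebra_simps eval_nat_numeral)
qed

end

lemma jet_diff: "jet n f c \<Longrightarrow> jet n g d \<Longrightarrow> jet n (\<lambda>x. f x - g x) (c - d)"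
  using jet_add[of n f c "\<lambda>x. - 1 * g x" "fps_const (- 1) * d"] jet_mult[OF jet_const[of n "- 1"], of g d]
  by (simp flip: fps_const_neg)

lemma op_term_simps:
  "op_term \<sigma> \<kappa> Q p 0 = \<kappa>^4 * p 4 0 + \<sigma> * \<kappa>^2 * p 2 0"
  "op_term \<sigma> \<kappa> Q p 1 = 4 * \<kappa>^3 * p 3 1 + 2 * \<sigma> * \<kappa> * p 1 1"
  "op_term \<sigma> \<kappa> Q p 2 = 6 * \<kappa>^2 * (Q 1 * p 3 0 + p 2 2) + \<sigma> * (Q 1 * p 1 0 + p 0 2)"
  "op_term \<sigma> \<kappa> Q p 3 = \<kappa> * (4 * Q 2 * p 2 0 + 12 * Q 1 * p 2 1 + 4 * p 1 3)"
  "op_term \<sigma> \<kappa> Q p 4 = 3 * (Q 1)^2 * p 2 0 + Q 3 * p 1 0 + 4 * Q 2 * p 1 1 + 6 * Q 1 * p 1 2 + p 0 4"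
  by (simp_all add: op_term_def ddx4_term_def ddx2_term_def algebra_simps)

context wave_family
begin

lemma jet_u: "jet n (\<lambda>\<epsilon>. pdd i j u \<theta> (k0 + \<epsilon> * a)) (Abs_fps (\<lambda>m. a ^ m * pdd i (j + m) u \<theta> k0 / fact m))"
  using jet_section[OF I_open k0, of "\<lambda>m. pdd i (j + m) u \<theta>" n a] u_DERIV2 by simp

text \<open>The jets of \<open>\<kappa> = k0 + \<epsilon> q\<close> and of \<open>u\<^sub>i\<^sub>j(\<theta>, \<kappa>)\<close> turn the previous identity into Taylor coefficients; the
  terms with a factor \<open>Q 0\<close> are those produced by expanding \<open>\<kappa>\<close>.\<close>

lemma residual_coeffs:
  fixes q :: "real \<Rightarrow> real" and \<theta> X :: real
  assumes q: "smooth_on UNIV q"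
    and w: "smooth2 UNIV w2" "smooth2 UNIV w3" "smooth2 UNIV w4"
  defines "Q \<equiv> \<lambda>n. (deriv ^^ n) q X" and "U \<equiv> \<lambda>i j. pdd i j u \<theta> k0"
    and "p2 \<equiv> \<lambda>i j. pdd i j w2 \<theta> X" and "p3 \<equiv> \<lambda>i j. pdd i j w3 \<theta> X" and "p4 \<equiv> \<lambda>i j. pdd i j w4 \<theta> X"
    and "V2 \<equiv> (deriv ^^ 2) V (u \<theta> k0)" and "V3 \<equiv> (deriv ^^ 3) V (u \<theta> k0)" and "V4 \<equiv> (deriv ^^ 4) V (u \<theta> k0)"
  shows "residual_coeff \<sigma> V u k0 q w2 w3 w4 0 \<theta> X = 0" (is ?g1)
    and "residual_coeff \<sigma> V u k0 q w2 w3 w4 1 \<theta> X = 0" (is ?g2)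
    and "residual_coeff \<sigma> V u k0 q w2 w3 w4 2 \<theta> X =
      Q 1 * (4 * k0^3 * U 3 1 + 6 * k0^2 * U 3 0 + 2 * \<sigma> * k0 * U 1 1 + \<sigma> * U 1 0)
      + k0^4 * p2 4 0 + \<sigma> * k0^2 * p2 2 0 + V2 * p2 0 0" (is ?g3)
    and "residual_coeff \<sigma> V u k0 q w2 w3 w4 3 \<theta> X =
      Q 2 * (6 * k0^2 * U 2 1 + 4 * k0 * U 2 0 + \<sigma> * U 0 1) + 4 * k0^3 * p2 3 1 + 2 * \<sigma> * k0 * p2 1 1
      + k0^4 * p3 4 0 + \<sigma> * k0^2 * p3 2 0 + V2 * p3 0 0
      + Q 0 * (Q 1 * (18 * k0^2 * U 3 1 + 4 * k0^3 * U 3 2 + 12 * k0 * U 3 0 + 3 * \<sigma> * U 1 1 + 2 * \<sigma> * k0 * U 1 2)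
        + 4 * k0^3 * p2 4 0 + 2 * \<sigma> * k0 * p2 2 0 + V3 * U 0 1 * p2 0 0)" (is ?g4)
    and "residual_coeff \<sigma> V u k0 q w2 w3 w4 4 \<theta> X =
      Q 3 * (4 * k0 * U 1 1 + U 1 0)
      + (Q 1)^2 * (6 * k0^2 * U 2 2 + 12 * k0 * U 2 1 + 3 * U 2 0 + \<sigma> * U 0 2)
      + 6 * k0^2 * (Q 1 * p2 3 0 + p2 2 2) + \<sigma> * (Q 1 * p2 1 0 + p2 0 2)
      + 4 * k0^3 * p3 3 1 + 2 * \<sigma> * k0 * p3 1 1
      + k0^4 * p4 4 0 + \<sigma> * k0^2 * p4 2 0 + V2 * p4 0 0 + 1 / 2 * V3 * (p2 0 0)^2
      + Q 0 * (Q 2 * (16 * k0 * U 2 1 + 6 * k0^2 * U 2 2 + 4 * U 2 0 + \<sigma> * U 0 2)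
        + 12 * k0^2 * p2 3 1 + 2 * \<sigma> * p2 1 1 + 4 * k0^3 * p3 4 0 + 2 * \<sigma> * k0 * p3 2 0 + V3 * U 0 1 * p3 0 0)
      + 1 / 2 * (Q 0)^2 * (Q 1 * (48 * k0 * U 3 1 + 30 * k0^2 * U 3 2 + 4 * k0^3 * U 3 3 + 12 * U 3 0
          + 5 * \<sigma> * U 1 2 + 2 * \<sigma> * k0 * U 1 3)
        + 12 * k0^2 * p2 4 0 + 2 * \<sigma> * p2 2 0 + (V4 * (U 0 1)^2 + V3 * U 0 2) * p2 0 0)" (is ?g5)
proof -
  let ?a = "q X"
  have a: "Q 0 = ?a" by (simp add: Q_def)
  define W2 W3 W4 where W: "W2 = w2 \<theta> X" "W3 = w3 \<theta> X" "W4 = w4 \<theta> X"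
  have Wp: "p2 0 0 = W2" "p3 0 0 = W3" "p4 0 0 = W4" by (simp_all add: p2_def p3_def p4_def W)
  define Ue where "Ue = (\<lambda>\<epsilon> i j. pdd i j u \<theta> (k0 + \<epsilon> * ?a))"
  define A2 where "A2 = (\<lambda>\<epsilon>. wave_part2 \<sigma> (k0 + \<epsilon> * ?a) Q (Ue \<epsilon>) + op_term \<sigma> (k0 + \<epsilon> * ?a) Q p2 0)"
  define A3 where "A3 = (\<lambda>\<epsilon>. wave_part3 \<sigma> (k0 + \<epsilon> * ?a) Q (Ue \<epsilon>) + op_term \<sigma> (k0 + \<epsilon> * ?a) Q p2 1
    + op_term \<sigma> (k0 + \<epsilon> * ?a) Q p3 0)"
  define A4 where "A4 = (\<lambda>\<epsilon>. wave_part4 \<sigma> (k0 + \<epsilon> * ?a) Q (Ue \<epsilon>) + op_term \<sigma> (k0 + \<epsilon> * ?a) Q p2 2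
    + op_term \<sigma> (k0 + \<epsilon> * ?a) Q p3 1 + op_term \<sigma> (k0 + \<epsilon> * ?a) Q p4 0)"
  define A5 where "A5 = (\<lambda>\<epsilon>. let \<kappa> = k0 + \<epsilon> * ?a in wave_rest \<epsilon> \<kappa> Q (Ue \<epsilon>)
        + op_term \<sigma> \<kappa> Q p2 3 + \<epsilon> * op_term \<sigma> \<kappa> Q p2 4
        + op_term \<sigma> \<kappa> Q p3 2 + \<epsilon> * op_term \<sigma> \<kappa> Q p3 3 + \<epsilon>^2 * op_term \<sigma> \<kappa> Q p3 4
        + op_term \<sigma> \<kappa> Q p4 1 + \<epsilon> * op_term \<sigma> \<kappa> Q p4 2 + \<epsilon>^2 * op_term \<sigma> \<kappa> Q p4 3
        + \<epsilon>^3 * op_term \<sigma> \<kappa> Q p4 4)"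
  define B where "B = (\<lambda>\<epsilon>. Ue \<epsilon> 0 0 + \<epsilon>^2 * W2 + \<epsilon>^3 * W3 + \<epsilon>^4 * W4)"
  define R where "R = (\<lambda>\<epsilon>. \<epsilon>^2 * A2 \<epsilon> + \<epsilon>^3 * A3 \<epsilon> + \<epsilon>^4 * A4 \<epsilon> + \<epsilon>^5 * A5 \<epsilon>
    + (deriv V (B \<epsilon>) - deriv V (Ue \<epsilon> 0 0)))"
  have res: "\<forall>\<^sub>F \<epsilon> in nhds 0. R \<epsilon> = residual \<sigma> V u k0 q w2 w3 w4 \<epsilon> \<theta> X"
    using eventually_affine_in_open[OF I_open k0, of ?a]
  proof eventually_elim
    case (elim \<epsilon>)
    show ?case
      unfolding residual_eq[OF q w elim, of \<theta>] R_def A2_def A3_def A4_def A5_def Let_def Ue_def B_def W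
        Q_def p2_def p3_def p4_def by simp
  qed
  define K where "K = fps_const k0 + fps_X * fps_const ?a"
  have KN: "fps_nth K 0 = k0" "fps_nth K 1 = ?a" "fps_nth K 2 = 0"
    by (simp_all add: K_def numeral_2_eq_2)
  have KP: "fps_nth (K ^ 2) 0 = k0^2" "fps_nth (K ^ 3) 0 = k0^3" "fps_nth (K ^ 4) 0 = k0^4"
    "fps_nth (K ^ 2) 1 = 2 * k0 * ?a" "fps_nth (K ^ 3) 1 = 3 * k0^2 * ?a" "fps_nth (K ^ 4) 1 = 4 * k0^3 * ?a"
    "fps_nth (K ^ 2) 2 = ?a^2" "fps_nth (K ^ 3) 2 = 3 * k0 * ?a^2" "fps_nth (K ^ 4) 2 = 6 * k0^2 * ?a^2"
    unfolding K_def fps_affine_power_nth by simp_all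
  define F where "F = (\<lambda>i j. Abs_fps (\<lambda>m. ?a ^ m * pdd i (j + m) u \<theta> k0 / fact m))"
  have FN: "fps_nth (F i j) 0 = U i j" "fps_nth (F i j) 1 = ?a * U i (Suc j)"
    "fps_nth (F i j) 2 = ?a^2 / 2 * U i (Suc (Suc j))" for i j
    by (simp_all add: F_def U_def numeral_2_eq_2 del: funpow.simps)
  have jU: "jet 4 (\<lambda>\<epsilon>. Ue \<epsilon> i j) (F i j)" for i j
    unfolding Ue_def F_def by (rule jet_u)
  define C where "C = (fps_const :: real \<Rightarrow> real fps)"
  have jC: "jet 4 (\<lambda>\<epsilon>. c) (C c)" for c unfolding C_def by (rule jet_const)
  have CN: "fps_nth (C c) 0 = c" "fps_nth (C c) 1 = 0" "fps_nth (C c) 2 = 0" for c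
    by (simp_all add: C_def)
  have jK: "jet 4 (\<lambda>\<epsilon>. k0 + \<epsilon> * ?a) K"
    unfolding K_def by (intro jet_add jet_mult jet_const jet_id)
  note jets = jK jU jet_power jC jet_mult jet_add
  note nths = fps_add_nth fps_mult_nth_0 fps_mult_nth_1 fps_mult_nth_2 KN KP FN CN
  define C2 where "C2 = C (Q 1) * (C 4 * K^3 * F 3 1 + C 6 * K^2 * F 3 0 + C 2 * C \<sigma> * K * F 1 1 + C \<sigma> * F 1 0)
    + (K^4 * C (p2 4 0) + C \<sigma> * K^2 * C (p2 2 0))"
  have j2: "jet 4 A2 C2"
    unfolding A2_def C2_def wave_part2_def op_term_simps by (rule jets)+
  define C3 where "C3 = C (Q 2) * (C 6 * K^2 * F 2 1 + C 4 * K * F 2 0 + C \<sigma> * F 0 1)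
    + (C 4 * K^3 * C (p2 3 1) + C 2 * C \<sigma> * K * C (p2 1 1)) + (K^4 * C (p3 4 0) + C \<sigma> * K^2 * C (p3 2 0))"
  have j3: "jet 4 A3 C3"
    unfolding A3_def C3_def wave_part3_def op_term_simps by (rule jets)+
  define C4 where "C4 = C (Q 3) * (C 4 * K * F 1 1 + F 1 0)
    + C (Q 1)^2 * (C 6 * K^2 * F 2 2 + C 12 * K * F 2 1 + C 3 * F 2 0 + C \<sigma> * F 0 2)
    + (C 6 * K^2 * (C (Q 1) * C (p2 3 0) + C (p2 2 2)) + C \<sigma> * (C (Q 1) * C (p2 1 0) + C (p2 0 2)))
    + (C 4 * K^3 * C (p3 3 1) + C 2 * C \<sigma> * K * C (p3 1 1)) + (K^4 * C (p4 4 0) + C \<sigma> * K^2 * C (p4 2 0))"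
  have j4: "jet 4 A4 C4"
    unfolding A4_def C4_def wave_part4_def op_term_simps by (rule jets)+
  \<comment> \<open>At order five the existence of a jet is enough.\<close>
  have "\<exists>c. jet 4 A5 c"
  proof -
    define je where "je = (\<lambda>f. \<exists>c. jet 4 f c)"
    have "je (\<lambda>\<epsilon>. \<epsilon>)" "\<And>c. je (\<lambda>\<epsilon>. c)" "je (\<lambda>\<epsilon>. k0 + \<epsilon> * ?a)" "\<And>i j. je (\<lambda>\<epsilon>. Ue \<epsilon> i j)"
      "\<And>f m. je f \<Longrightarrow> je (\<lambda>\<epsilon>. f \<epsilon> ^ m)" "\<And>f g. je f \<Longrightarrow> je g \<Longrightarrow> je (\<lambda>\<epsilon>. f \<epsilon> * g \<epsilon>)"
      "\<And>f g. je f \<Longrightarrow> je g \<Longrightarrow> je (\<lambda>\<epsilon>. f \<epsilon> + g \<epsilon>)"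
      unfolding je_def using jet_id jets by meson+
    note jes = this
    have "je A5" unfolding A5_def Let_def wave_rest_def op_term_simps by (rule jes)+
    then show ?thesis by (simp add: je_def)
  qed
  then obtain C5 where j5: "jet 4 A5 C5" by blast
  define b0 where "b0 = F 0 0"
  define b where "b = F 0 0 + fps_X^2 * C W2 + fps_X^3 * C W3 + fps_X^4 * C W4"
  define T where "T = taylor (deriv V) (u \<theta> k0)"
  have u0: "U 0 0 = u \<theta> k0" by (simp add: U_def)
  have jB: "jet 4 B b" unfolding B_def b_def by (intro jet_add jet_mult jet_power jU jC jet_id)
  have bn: "fps_nth b 0 = u \<theta> k0" by (simp add: b_def FN(1) u0 fps_X_power_mult_nth)
  have b0n: "fps_nth b0 0 = u \<theta> k0" by (simp add: b0_def FN(1) u0)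
  have dV: "smooth_on UNIV (deriv V)" by (rule smooth_deriv[OF V_smooth])
  have jV: "jet 4 (\<lambda>\<epsilon>. deriv V (B \<epsilon>) - deriv V (Ue \<epsilon> 0 0))
      ((T oo (b - fps_const (u \<theta> k0))) - (T oo (b0 - fps_const (u \<theta> k0))))"
    using jet_diff[OF jet_compose[OF dV jB] jet_compose[OF dV jU[of 0 0]]]
    unfolding T_def bn b0n b0_def[symmetric] .
  define c where "c = fps_X^2 * C2 + fps_X^3 * C3 + fps_X^4 * C4 + fps_X^5 * C5
    + ((T oo (b - fps_const (u \<theta> k0))) - (T oo (b0 - fps_const (u \<theta> k0))))"
  have "jet 4 R c"
    unfolding R_def c_def by (intro jet_add jet_mult[OF jet_power[OF jet_id]] j2 j3 j4 j5 jV)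
  then have "jet 4 (\<lambda>\<epsilon>. residual \<sigma> V u k0 q w2 w3 w4 \<epsilon> \<theta> X) c"
    by (rule jet_cong[OF res])
  then have rc: "residual_coeff \<sigma> V u k0 q w2 w3 w4 j \<theta> X = fps_nth c j" if "j \<le> 4" for j
    unfolding residual_coeff_def using jet_coeff that by blast
  define d where "d = b - fps_const (u \<theta> k0)"
  define d0 where "d0 = b0 - fps_const (u \<theta> k0)"
  have e: "fps_nth d0 0 = 0" "fps_nth d 0 = 0" "fps_nth d0 1 = ?a * U 0 1" "fps_nth d 1 = ?a * U 0 1"
    "fps_nth d0 2 = ?a^2 / 2 * U 0 2" "fps_nth d 2 = ?a^2 / 2 * U 0 2 + W2"
    "fps_nth d 3 = fps_nth d0 3 + W3" "fps_nth d 4 = fps_nth d0 4 + W4"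
    using FN[of 0 0] by (simp_all add: d_def d0_def b_def b0_def C_def bn b0n u0 fps_X_power_mult_nth
        numeral_2_eq_2[symmetric])
  \<comment> \<open>Both compositions share the series \<open>T\<close>, and their arguments differ only from order two on.\<close>
  have TN: "fps_nth T 1 = V2" "fps_nth T 2 = V3 / 2" "fps_nth T 3 = V4 / 6"
    unfolding T_def taylor_nth V2_def V3_def V4_def by (simp_all add: numeral_eq_Suc funpow_swap1 fact_Suc)
  note cN = c_def[folded d_def d0_def]
  note top = fps_compose_nth_le_4[OF e(1)] fps_compose_nth_le_4[OF e(2)]
  have D: "fps_nth (T oo d) 0 - fps_nth (T oo d0) 0 = 0" "fps_nth (T oo d) 1 - fps_nth (T oo d0) 1 = 0"
    "fps_nth (T oo d) 2 - fps_nth (T oo d0) 2 = V2 * W2"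
    "fps_nth (T oo d) 3 - fps_nth (T oo d0) 3 = V2 * W3 + V3 * ?a * U 0 1 * W2"
    "fps_nth (T oo d) 4 - fps_nth (T oo d0) 4 = V2 * W4 + V3 * (?a * U 0 1 * W3 + ?a^2 / 2 * U 0 2 * W2 + W2^2 / 2)
      + V4 / 2 * ?a^2 * (U 0 1)^2 * W2"
    unfolding top e TN by (simp_all add: algebra_simps power2_eq_square add_divide_distrib)
  have cj: "fps_nth c 0 = 0" "fps_nth c 1 = 0"
    "fps_nth c 2 = fps_nth C2 0 + V2 * W2"
    "fps_nth c 3 = fps_nth C2 1 + fps_nth C3 0 + (V2 * W3 + V3 * ?a * U 0 1 * W2)"
    "fps_nth c 4 = fps_nth C2 2 + fps_nth C3 1 + fps_nth C4 0 + (V2 * W4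
      + V3 * (?a * U 0 1 * W3 + ?a^2 / 2 * U 0 2 * W2 + W2^2 / 2) + V4 / 2 * ?a^2 * (U 0 1)^2 * W2)"
    unfolding cN fps_add_nth fps_sub_nth D by (simp_all add: fps_X_power_mult_nth)
  show ?g1 ?g2
    using rc[of 0] rc[of 1] cj by simp_all
  have S: "Suc 0 = 1" "Suc 1 = 2" "Suc 2 = 3" by simp_all
  show ?g3 unfolding rc[of 2, simplified] cj C2_def Wp by (simp only: nths)
  show ?g4
    unfolding rc[of 3, simplified] cj C2_def C3_def Wp a by (simp only: nths S) (simp add: algebra_simps)
  show ?g5
    unfolding rc[of 4, simplified] cj C2_def C3_def C4_def power2_eq_square[of "C (Q 1)"] Wp a
    by (simp only: nths S) (simp add: field_simps power2_eq_square)
qed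

end

section \<open>Smooth periodic functions and their inner product\<close>

lemma deriv_eqs:
  fixes f g :: "real \<Rightarrow> real"
  assumes "smooth_on UNIV f" "smooth_on UNIV g"
  shows "deriv (\<lambda>z. f z + g z) = (\<lambda>z. deriv f z + deriv g z)"
    and "deriv (\<lambda>z. f z * g z) = (\<lambda>z. deriv f z * g z + f z * deriv g z)"
  using smooth_has_deriv[OF assms(1)] smooth_has_deriv[OF assms(2)]
  by (auto intro!: ext DERIV_imp_deriv derivative_eq_intros)

lemma sp_smooth: "smooth_periodic f \<Longrightarrow> smooth_on UNIV f"
  by (simp add: smooth_periodic_def)

lemma sp_period: "smooth_periodic f \<Longrightarrow> f (z + 2 * pi) = f z"
  by (simp add: smooth_periodic_def periodic_fun_simple_def)

lemma spI: "smooth_on UNIV f \<Longrightarrow> (\<And>z. f (z + 2 * pi) = f z) \<Longrightarrow> smooth_periodic f"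
  by (simp add: smooth_periodic_def periodic_fun_simple_def)

lemma sp_const: "smooth_periodic (\<lambda>z. c)"
  by (auto intro: spI smooth_on_const)

lemma sp_add: "smooth_periodic f \<Longrightarrow> smooth_periodic g \<Longrightarrow> smooth_periodic (\<lambda>z. f z + g z)"
  by (intro spI smooth_on_add open_UNIV) (auto simp: sp_smooth sp_period)

lemma sp_mult: "smooth_periodic f \<Longrightarrow> smooth_periodic g \<Longrightarrow> smooth_periodic (\<lambda>z. f z * g z)"
  by (intro spI smooth_on_mult open_UNIV) (auto simp: sp_smooth sp_period)

lemma sp_cmult: "smooth_periodic f \<Longrightarrow> smooth_periodic (\<lambda>z. c * f z)"
  by (rule sp_mult[OF sp_const])

lemma sp_minus: "smooth_periodic f \<Longrightarrow> smooth_periodic (\<lambda>z. - f z)"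
  using sp_cmult[of f "- 1"] by simp

lemma sp_diff: "smooth_periodic f \<Longrightarrow> smooth_periodic g \<Longrightarrow> smooth_periodic (\<lambda>z. f z - g z)"
  using sp_add[OF _ sp_minus, of f g] by simp

lemma sp_power2: "smooth_periodic f \<Longrightarrow> smooth_periodic (\<lambda>z. (f z)^2)"
  unfolding power2_eq_square by (rule sp_mult)

lemma sp_deriv: assumes "smooth_periodic f" shows "smooth_periodic (deriv f)"
proof (rule spI)
  show "smooth_on UNIV (deriv f)" by (rule smooth_deriv[OF sp_smooth[OF assms]])
  fix z
  have "((\<lambda>z. f (z + 2 * pi)) has_real_derivative deriv f (z + 2 * pi)) (at z)"
    using smooth_has_deriv[OF sp_smooth[OF assms], of "z + 2 * pi"] by (simp add: DERIV_shift)
  moreover have "(\<lambda>z. f (z + 2 * pi)) = f" by (rule ext) (rule sp_period[OF assms])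
  ultimately have "(f has_real_derivative deriv f (z + 2 * pi)) (at z)" by simp
  then show "deriv f (z + 2 * pi) = deriv f z" by (rule DERIV_imp_deriv[symmetric])
qed

lemma sp_funpow: "smooth_periodic f \<Longrightarrow> smooth_periodic ((deriv ^^ n) f)"
  by (induction n) (auto intro: sp_deriv)

lemma sp_compose: "smooth_on UNIV V \<Longrightarrow> smooth_periodic f \<Longrightarrow> smooth_periodic (\<lambda>z. V (f z))"
  using smooth_compose[of V f] by (auto intro!: spI simp: sp_smooth sp_period)

lemma sp_integrable: "smooth_periodic f \<Longrightarrow> f integrable_on {a..b}"
  by (rule integrable_continuous_real)
    (rule continuous_on_subset[OF smooth_on_continuous_on[OF sp_smooth]], auto)

lemma integral_deriv_zero:
  assumes "smooth_periodic f" shows "integral {0..2 * pi} (deriv f) = 0"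
proof -
  have "(deriv f has_integral f (2 * pi) - f 0) {0..2 * pi}"
    using smooth_has_deriv[OF sp_smooth[OF assms]]
    by (intro fundamental_theorem_of_calculus)
      (auto simp: has_real_derivative_iff_has_vector_derivative[symmetric] intro: has_field_derivative_at_within)
  then show ?thesis using sp_period[OF assms, of 0] by (simp add: integral_unique)
qed

lemma ip_commute: "ip a b = ip b a"
  by (simp add: ip_def mult.commute)

lemma ip_add: "smooth_periodic f \<Longrightarrow> smooth_periodic g \<Longrightarrow> smooth_periodic h \<Longrightarrow>
    ip f (\<lambda>z. g z + h z) = ip f g + ip f h"
  by (simp add: ip_def distrib_left integral_add sp_integrable sp_mult)

lemma ip_cmult: "ip f (\<lambda>z. c * g z) = c * ip f g"
proof -
  have "(\<lambda>z. f z * (c * g z)) = (\<lambda>z. c * (f z * g z))" by (auto simp: algebra_simps)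
  then show ?thesis by (simp add: ip_def)
qed

lemma ip_minus: "ip f (\<lambda>z. - g z) = - ip f g"
  using ip_cmult[of f "- 1" g] by simp

lemma ip_diff: "smooth_periodic f \<Longrightarrow> smooth_periodic g \<Longrightarrow> smooth_periodic h \<Longrightarrow>
    ip f (\<lambda>z. g z - h z) = ip f g - ip f h"
  using ip_add[OF _ _ sp_minus, of f g h] by (simp add: ip_minus)

lemma ip_deriv:
  assumes "smooth_periodic f" "smooth_periodic g"
  shows "ip f (deriv g) = - ip (deriv f) g"
proof -
  have "integral {0..2 * pi} (\<lambda>z. deriv f z * g z + f z * deriv g z) = 0"
    using integral_deriv_zero[OF sp_mult[OF assms]]
    by (simp add: deriv_eqs[OF sp_smooth sp_smooth] assms)
  then have "integral {0..2 * pi} (\<lambda>z. f z * deriv g z) = - integral {0..2 * pi} (\<lambda>z. deriv f z * g z)"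
    by (simp add: integral_add sp_integrable sp_mult sp_deriv assms)
  then show ?thesis by (simp add: ip_def)
qed

lemma ip_self_pos:
  assumes "smooth_periodic f" "f z \<noteq> 0" shows "ip f f > 0"
proof -
  have c: "continuous_on A f" for A
    by (rule continuous_on_subset[OF smooth_on_continuous_on[OF sp_smooth[OF assms(1)]]]) simp
  have "integral {0..2 * pi} (\<lambda>z. f z * f z) \<noteq> 0"
  proof
    assume 0: "integral {0..2 * pi} (\<lambda>z. f z * f z) = 0"
    have "f x * f x = 0" if "x \<in> {0..2 * pi}" for x
      using integral_eq_0_iff[OF continuous_on_mult[OF c c], of 0 "2 * pi"] 0 that by auto
    then have x0: "f x = 0" if "x \<in> {0..2 * pi}" for x using that by simp
    obtain y where "y \<in> {0..2 * pi}" "f y = f z"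
      using periodic_reduce[of f z] assms by (auto simp: smooth_periodic_def)
    then show False using x0 assms by simp
  qed
  moreover have "integral {0..2 * pi} (\<lambda>z. f z * f z) \<ge> 0"
    by (rule integral_nonneg) (auto intro: sp_integrable sp_mult assms)
  ultimately show ?thesis by (simp add: ip_def)
qed

subsection \<open>Odd and even operators\<close>

text \<open>All operators below are constant-coefficient up to a potential.  Those with odd-order derivatives
  are antisymmetric and those with even-order derivatives symmetric for \<open>ip\<close>; every cancellation in the
  solvability conditions rests on this parity.\<close>

definition Od :: "real \<Rightarrow> real \<Rightarrow> (real \<Rightarrow> real) \<Rightarrow> real \<Rightarrow> real" where
  "Od a b f = (\<lambda>z. a * (deriv ^^ 3) f z + b * deriv f z)"

definition Ev :: "real \<Rightarrow> real \<Rightarrow> (real \<Rightarrow> real) \<Rightarrow> (real \<Rightarrow> real) \<Rightarrow> real \<Rightarrow> real" where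
  "Ev a b v f = (\<lambda>z. a * (deriv ^^ 4) f z + b * (deriv ^^ 2) f z + v z * f z)"

lemma sp_Od: "smooth_periodic f \<Longrightarrow> smooth_periodic (Od a b f)"
  unfolding Od_def by (intro sp_add sp_cmult sp_funpow sp_deriv)

lemma sp_Ev: "smooth_periodic f \<Longrightarrow> smooth_periodic v \<Longrightarrow> smooth_periodic (Ev a b v f)"
  unfolding Ev_def by (intro sp_add sp_cmult sp_funpow sp_deriv sp_mult)

lemma ip_deriv2:
  assumes "smooth_periodic f" "smooth_periodic g"
  shows "ip f ((deriv ^^ 2) g) = ip ((deriv ^^ 2) f) g"
  using assms by (simp add: numeral_2_eq_2 ip_deriv sp_deriv)

lemma ip_Od:
  assumes f: "smooth_periodic f" and g: "smooth_periodic g"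
  shows "ip f (Od a b g) = - ip (Od a b f) g"
proof -
  have 3: "ip f ((deriv ^^ 3) g) = - ip ((deriv ^^ 3) f) g"
    using assms by (simp add: numeral_3_eq_3 ip_deriv sp_deriv)
  have "ip h (Od a b k) = a * ip h ((deriv ^^ 3) k) + b * ip h (deriv k)"
    if "smooth_periodic h" "smooth_periodic k" for h k
    unfolding Od_def using that by (simp add: ip_add ip_cmult sp_cmult sp_funpow sp_deriv)
  from this[OF f g] this[OF g f] show ?thesis
    using 3 ip_deriv[OF f g] ip_commute[of g "(deriv ^^ 3) f"] ip_commute[of g "deriv f"]
      ip_commute[of g "Od a b f"] by simp
qed

lemma ip_Ev:
  assumes f: "smooth_periodic f" and g: "smooth_periodic g" and v: "smooth_periodic v"
  shows "ip f (Ev a b v g) = ip (Ev a b v f) g"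
proof -
  have 4: "ip f ((deriv ^^ 4) g) = ip ((deriv ^^ 4) f) g"
    using assms by (simp add: numeral_eq_Suc ip_deriv sp_deriv)
  have 0: "ip g (\<lambda>z. v z * f z) = ip f (\<lambda>z. v z * g z)" by (simp add: ip_def mult_ac)
  have "ip h (Ev a b v k) = a * ip h ((deriv ^^ 4) k) + b * ip h ((deriv ^^ 2) k) + ip h (\<lambda>z. v z * k z)"
    if "smooth_periodic h" "smooth_periodic k" for h k
    unfolding Ev_def using that v by (simp add: ip_add ip_cmult sp_cmult sp_funpow sp_deriv sp_add sp_mult)
  from this[OF f g] this[OF g f] show ?thesis
    using 4 0 ip_deriv2[OF f g] ip_commute[of g "(deriv ^^ 4) f"] ip_commute[of g "(deriv ^^ 2) f"]
      ip_commute[of g "Ev a b v f"] by simp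
qed

lemma ip_Od_self: "smooth_periodic f \<Longrightarrow> ip f (Od a b f) = 0"
  using ip_Od[of f f a b] ip_commute[of f] by simp

lemma ip_deriv_self: "smooth_periodic f \<Longrightarrow> ip f (deriv f) = 0"
  using ip_deriv[of f f] ip_commute[of f] by simp

lemma deriv_Od: "smooth_periodic f \<Longrightarrow> deriv (Od a b f) = Od a b (deriv f)"
  unfolding Od_def
  by (simp add: deriv_eqs sp_smooth sp_funpow sp_deriv sp_cmult sp_const numeral_3_eq_3)

lemma funpow_deriv_lin: "smooth_periodic f \<Longrightarrow> smooth_periodic g \<Longrightarrow>
    (deriv ^^ n) (\<lambda>z. x * f z + y * g z) = (\<lambda>z. x * (deriv ^^ n) f z + y * (deriv ^^ n) g z)"
proof (induction n)
  case (Suc n)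
  have "deriv (\<lambda>z. x * (deriv ^^ n) f z + y * (deriv ^^ n) g z)
      = (\<lambda>z. x * deriv ((deriv ^^ n) f) z + y * deriv ((deriv ^^ n) g) z)"
    using Suc.prems by (simp add: deriv_eqs sp_smooth sp_funpow sp_cmult sp_const)
  then show ?case using Suc by simp
qed simp

lemma Od_lin: "smooth_periodic f \<Longrightarrow> smooth_periodic g \<Longrightarrow>
    Od a b (\<lambda>z. x * f z + y * g z) = (\<lambda>z. x * Od a b f z + y * Od a b g z)"
  using funpow_deriv_lin[of f g 1 x y] by (simp add: Od_def funpow_deriv_lin algebra_simps)

lemma Ev_lin: "smooth_periodic f \<Longrightarrow> smooth_periodic g \<Longrightarrow>
    Ev a b v (\<lambda>z. x * f z + y * g z) = (\<lambda>z. x * Ev a b v f z + y * Ev a b v g z)"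
  by (simp add: Ev_def funpow_deriv_lin algebra_simps)

section \<open>Identities along the family of waves\<close>

lemma smooth_id: "smooth_on UNIV (\<lambda>x::real. x)"
proof -
  have "Ck_on n UNIV (\<lambda>x::real. x)" for n
    by (cases n) (simp_all add: Ck_on_UNIV_Suc Ck_on_const del: Ck_on.simps(2))
  then show ?thesis by (simp add: smooth_on_def)
qed

lemma smooth2_proj2: "open J \<Longrightarrow> smooth2 J (\<lambda>z k. k)"
  using smooth_on_compose_affine[where A = snd and L = snd and S = "UNIV \<times> J" and T = UNIV, OF _ _ _ smooth_id]
  by (simp add: open_Times case_prod_beta' bounded_linear_imp_has_derivative bounded_linear_snd)

lemma smooth2_const: "smooth2 J (\<lambda>z k. c)"
  using smooth_on_const[of "UNIV \<times> J" c] by (simp add: case_prod_beta')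

lemma smooth2_mult:
  "open J \<Longrightarrow> smooth2 J f \<Longrightarrow> smooth2 J g \<Longrightarrow> smooth2 J (\<lambda>z k. f z k * g z k)"
  using smooth_on_mult[of "UNIV \<times> J" "\<lambda>(z, k). f z k" "\<lambda>(z, k). g z k"]
  by (simp add: open_Times case_prod_beta')

lemma smooth2_power: "open J \<Longrightarrow> smooth2 J f \<Longrightarrow> smooth2 J (\<lambda>z k. f z k ^ n)"
  by (induction n) (auto intro: smooth2_const smooth2_mult)

lemma smooth2_leibniz:
  assumes J: "open J" "is_interval J" and G: "smooth2 J G" "smooth2 J G'"
    and D: "\<And>z k. k \<in> J \<Longrightarrow> ((\<lambda>k. G z k) has_real_derivative G' z k) (at k)" and k: "k \<in> J"
  shows "((\<lambda>k. integral {a..b} (\<lambda>z. G z k)) has_real_derivative integral {a..b} (\<lambda>z. G' z k)) (at k)"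
proof -
  have "((\<lambda>k. integral (cbox a b) (\<lambda>z. G z k)) has_real_derivative integral (cbox a b) (\<lambda>z. G' z k))
      (at k within J)"
  proof (rule leibniz_rule_field_derivative)
    show "(\<lambda>z. G z k) integrable_on cbox a b" if "k \<in> J" for k
      by (rule integrable_continuous, rule continuous_on_subset[OF smooth_on_continuous_on])
        (rule smooth2_section1[OF G(1) that], simp)
    have "continuous_on (J \<times> cbox a b) (\<lambda>p. case (snd p, fst p) of (z, k) \<Rightarrow> G' z k)"
      by (rule continuous_on_compose2[OF smooth2_cont[OF G(2), of J UNIV]])
        (auto intro!: continuous_intros)
    then show "continuous_on (J \<times> cbox a b) (\<lambda>(k, z). G' z k)" by (simp add: case_prod_beta')
    show "((\<lambda>k. G z k) has_real_derivative G' z k) (at k within J)" if "k \<in> J" for z k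
      using D[OF that] by (rule has_field_derivative_at_within)
  qed (use J k in \<open>auto simp: is_interval_convex_1\<close>)
  then show ?thesis using at_within_open[OF k J(1)] by simp
qed

context wave_family
begin

text \<open>The wave equation differentiated by \<open>\<partial>\<^sub>z\<close>, \<open>\<partial>\<^sub>z\<^sup>2\<close>, \<open>\<partial>\<^sub>k\<close>, \<open>\<partial>\<^sub>z \<partial>\<^sub>k\<close>, \<open>\<partial>\<^sub>k\<^sup>2\<close> and \<open>\<partial>\<^sub>z \<partial>\<^sub>k\<^sup>2\<close>.\<close>

lemma ode_derivatives:
  fixes z k :: real
  assumes k: "k \<in> I"
  defines "U \<equiv> \<lambda>i j. pdd i j u z k" and "W \<equiv> \<lambda>n. (deriv ^^ n) V (u z k)"
  shows "k^4 * U 5 0 + \<sigma> * k^2 * U 3 0 + W 2 * U 1 0 = 0" (is ?g1)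
    and "k^4 * U 6 0 + \<sigma> * k^2 * U 4 0 + W 2 * U 2 0 + W 3 * (U 1 0)^2 = 0" (is ?g2)
    and "k^4 * U 4 1 + 4 * k^3 * U 4 0 + \<sigma> * k^2 * U 2 1 + 2 * \<sigma> * k * U 2 0 + W 2 * U 0 1 = 0" (is ?g3)
    and "k^4 * U 5 1 + 4 * k^3 * U 5 0 + \<sigma> * k^2 * U 3 1 + 2 * \<sigma> * k * U 3 0 + W 2 * U 1 1
      + W 3 * U 0 1 * U 1 0 = 0" (is ?g4)
    and "k^4 * U 4 2 + 8 * k^3 * U 4 1 + 12 * k^2 * U 4 0 + \<sigma> * k^2 * U 2 2 + 4 * \<sigma> * k * U 2 1
      + 2 * \<sigma> * U 2 0 + W 2 * U 0 2 + W 3 * (U 0 1)^2 = 0" (is ?g5)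
    and "k^4 * U 5 2 + 8 * k^3 * U 5 1 + 12 * k^2 * U 5 0 + \<sigma> * k^2 * U 3 2 + 4 * \<sigma> * k * U 3 1
      + 2 * \<sigma> * U 3 0 + W 2 * U 1 2 + 2 * W 3 * U 0 1 * U 1 1 + W 3 * U 0 2 * U 1 0
      + W 4 * (U 0 1)^2 * U 1 0 = 0" (is ?g6)
proof -
  define y where "y = (\<lambda>i j z k. pdd i j u z k)"
  define v where "v = (\<lambda>n z k. (deriv ^^ n) V (u z k))"
  have y1: "((\<lambda>s. y i j s k) has_real_derivative y i' j z k) (at z)"
    if "k \<in> I" "i' = Suc i" for i i' j z k unfolding y_def that(2) by (rule u_DERIV1[OF that(1)])
  have y2: "((\<lambda>s. y i j z s) has_real_derivative y i j' z k) (at k)"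
    if "k \<in> I" "j' = Suc j" for i j j' z k unfolding y_def that(2) by (rule u_DERIV2[OF that(1)])
  have VD: "((deriv ^^ n) V has_real_derivative (deriv ^^ Suc n) V x) (at x)" for n x
    using smooth_has_deriv[OF smooth_funpow_deriv[OF V_smooth]] by simp
  have u00: "u = y 0 0" by (simp add: y_def fun_eq_iff)
  have v1: "((\<lambda>s. v n s k) has_real_derivative v n' z k * y 1 0 z k) (at z)"
    if "k \<in> I" "n' = Suc n" for n n' z k
    unfolding v_def that(2) by (rule DERIV_chain2[OF VD]) (use that in \<open>auto simp: u00 intro!: y1\<close>)
  have v2: "((\<lambda>s. v n z s) has_real_derivative v n' z k * y 0 1 z k) (at k)"
    if "k \<in> I" "n' = Suc n" for n n' z k
    unfolding v_def that(2) by (rule DERIV_chain2[OF VD]) (use that in \<open>auto simp: u00 intro!: y2\<close>)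
  have y1s: "((\<lambda>s. y 4 j s k) has_real_derivative y 5 j z k) (at z)"
    "((\<lambda>s. y 5 j s k) has_real_derivative y 6 j z k) (at z)"
    "((\<lambda>s. y 2 j s k) has_real_derivative y 3 j z k) (at z)"
    "((\<lambda>s. y 3 j s k) has_real_derivative y 4 j z k) (at z)"
    "((\<lambda>s. y 1 j s k) has_real_derivative y 2 j z k) (at z)"
    "((\<lambda>s. y 0 j s k) has_real_derivative y 1 j z k) (at z)" if "k \<in> I" for j z k
    by (rule y1, rule that, simp)+
  have y2s: "((\<lambda>s. y i 0 z s) has_real_derivative y i 1 z k) (at k)"
    "((\<lambda>s. y i 1 z s) has_real_derivative y i 2 z k) (at k)" if "k \<in> I" for i z k
    by (rule y2, rule that, simp)+
  have v1s: "((\<lambda>s. v 1 s k) has_real_derivative v 2 z k * y 1 0 z k) (at z)"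
    "((\<lambda>s. v 2 s k) has_real_derivative v 3 z k * y 1 0 z k) (at z)"
    "((\<lambda>s. v 3 s k) has_real_derivative v 4 z k * y 1 0 z k) (at z)" if "k \<in> I" for z k
    by (rule v1, rule that, simp)+
  have v2s: "((\<lambda>s. v 1 z s) has_real_derivative v 2 z k * y 0 1 z k) (at k)"
    "((\<lambda>s. v 2 z s) has_real_derivative v 3 z k * y 0 1 z k) (at k)" if "k \<in> I" for z k
    by (rule v2, rule that, simp)+
  have vanish1: "D = 0" if "k \<in> I" "\<And>z. F z k = 0" "((\<lambda>s. F s k) has_real_derivative D) (at z)"
    for F :: "real \<Rightarrow> real \<Rightarrow> real" and D z k
    using that DERIV_unique[OF that(3), of 0] by simp
  have vanish2: "D = 0" if "k \<in> I" "\<And>k. k \<in> I \<Longrightarrow> F z k = 0" "((\<lambda>s. F z s) has_real_derivative D) (at k)"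
    for F :: "real \<Rightarrow> real \<Rightarrow> real" and D z k
  proof -
    have "((\<lambda>s. 0) has_real_derivative D) (at k)"
      by (rule has_field_derivative_transform_within_open[OF that(3) I_open that(1)]) (use that in auto)
    then show ?thesis using DERIV_unique DERIV_const by blast
  qed
  define N0 where "N0 = (\<lambda>z k. k^4 * y 4 0 z k + \<sigma> * k^2 * y 2 0 z k + v 1 z k)"
  define Nz where "Nz = (\<lambda>z k. k^4 * y 5 0 z k + \<sigma> * k^2 * y 3 0 z k + v 2 z k * y 1 0 z k)"
  define Nk where "Nk = (\<lambda>z k. k^4 * y 4 1 z k + 4 * k^3 * y 4 0 z k + \<sigma> * k^2 * y 2 1 z k
      + 2 * \<sigma> * k * y 2 0 z k + v 2 z k * y 0 1 z k)"
  define Nkk where "Nkk = (\<lambda>z k. k^4 * y 4 2 z k + 8 * k^3 * y 4 1 z k + 12 * k^2 * y 4 0 z k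
      + \<sigma> * k^2 * y 2 2 z k + 4 * \<sigma> * k * y 2 1 z k + 2 * \<sigma> * y 2 0 z k + v 2 z k * y 0 2 z k
      + v 3 z k * (y 0 1 z k)^2)"
  have e0: "N0 z k = 0" if "k \<in> I" for z k
    using u_ode[OF that, of z] by (simp add: N0_def y_def v_def)
  have ez: "Nz z k = 0" if "k \<in> I" for z k
    by (rule vanish1[where k = k and z = z and F = N0, OF that e0[OF that]], unfold N0_def Nz_def)
      (auto intro!: derivative_eq_intros y1s v1s that simp del: One_nat_def)
  have ezz: "k^4 * y 6 0 z k + \<sigma> * k^2 * y 4 0 z k + v 2 z k * y 2 0 z k + v 3 z k * (y 1 0 z k)^2 = 0"
    if "k \<in> I" for z k
    by (rule vanish1[where k = k and z = z and F = Nz, OF that ez[OF that]], unfold Nz_def)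
      (auto intro!: derivative_eq_intros y1s v1s that simp del: One_nat_def simp: power2_eq_square)
  have ek: "Nk z k = 0" if "k \<in> I" for z k
    by (rule vanish2[where k = k and z = z and F = N0, OF that e0], assumption, unfold N0_def Nk_def)
      (auto intro!: derivative_eq_intros y2s v2s that simp del: One_nat_def)
  have ekz: "k^4 * y 5 1 z k + 4 * k^3 * y 5 0 z k + \<sigma> * k^2 * y 3 1 z k + 2 * \<sigma> * k * y 3 0 z k
      + v 2 z k * y 1 1 z k + v 3 z k * y 0 1 z k * y 1 0 z k = 0" if "k \<in> I" for z k
    by (rule vanish1[where k = k and z = z and F = Nk, OF that ek[OF that]], unfold Nk_def)
      (auto intro!: derivative_eq_intros y1s v1s that simp del: One_nat_def)
  have ekk: "Nkk z k = 0" if "k \<in> I" for z k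
    by (rule vanish2[where k = k and z = z and F = Nk, OF that ek], assumption, unfold Nk_def Nkk_def)
      (auto intro!: derivative_eq_intros y2s v2s that simp del: One_nat_def simp: power2_eq_square algebra_simps)
  have ekkz: "k^4 * y 5 2 z k + 8 * k^3 * y 5 1 z k + 12 * k^2 * y 5 0 z k + \<sigma> * k^2 * y 3 2 z k
      + 4 * \<sigma> * k * y 3 1 z k + 2 * \<sigma> * y 3 0 z k + v 2 z k * y 1 2 z k
      + 2 * v 3 z k * y 0 1 z k * y 1 1 z k + v 3 z k * y 0 2 z k * y 1 0 z k
      + v 4 z k * (y 0 1 z k)^2 * y 1 0 z k = 0" if "k \<in> I" for z k
    by (rule vanish1[where k = k and z = z and F = Nkk, OF that ekk[OF that]], unfold Nkk_def)
      (auto intro!: derivative_eq_intros y1s v1s that simp del: One_nat_def simp: power2_eq_square algebra_simps)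
  note all = ez[OF k, of z] ezz[OF k, of z] ek[OF k, of z] ekz[OF k, of z] ekk[OF k, of z] ekkz[OF k, of z]
  show ?g1
    ?g2
    ?g3
    ?g4
    ?g5
    ?g6
    using all unfolding y_def v_def U_def W_def Nz_def Nk_def Nkk_def by blast+
qed

end

section \<open>The degenerate wave\<close>

locale critical_wave = wave_family +
  assumes k0_nz: "k0 \<noteq> 0"
    and u_periodic: "\<And>k. k \<in> I \<Longrightarrow> periodic_fun_simple (\<lambda>z. u z k) (2 * pi)"
    and u_nonconst: "\<not> (\<lambda>z. u z k0) constant_on UNIV"
    and A_k: "deriv (action \<sigma> u) k0 = 0"
    and A_kk: "(deriv ^^ 2) (action \<sigma> u) k0 = 0"
    and kernel: "{f. smooth_periodic f \<and> (\<forall>z. L0 \<sigma> V u k0 f z = 0)}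
          = {f. \<exists>c. f = (\<lambda>z. c * pd1 u z k0)}"
begin

lemma sp_section:
  assumes k: "k \<in> I" shows "smooth_periodic (\<lambda>z. (pd2 ^^ j) u z k)"
proof (rule spI)
  show "smooth_on UNIV (\<lambda>z. (pd2 ^^ j) u z k)"
    using smooth2_section1[OF smooth2_pdd[OF I_open u_smooth, of 0 j] k] by simp
  show "(pd2 ^^ j) u (z + 2 * pi) k = (pd2 ^^ j) u z k" for z
    using k
  proof (induction j arbitrary: k)
    case 0
    then show ?case using u_periodic by (simp add: periodic_fun_simple_def)
  next
    case (Suc j)
    have "\<forall>\<^sub>F s in nhds k. (pd2 ^^ j) u (z + 2 * pi) s = (pd2 ^^ j) u z s"
      using eventually_nhds_in_open[OF I_open Suc.prems] by eventually_elim (rule Suc.IH)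
    then have "pd2 ((pd2 ^^ j) u) (z + 2 * pi) k = pd2 ((pd2 ^^ j) u) z k"
      unfolding pd2_def[of "(pd2 ^^ j) u"] by (rule deriv_cong_ev) simp
    then show ?case by simp
  qed
qed

definition e :: "nat \<Rightarrow> real \<Rightarrow> real" where "e j = (\<lambda>z. (pd2 ^^ j) u z k0)"

definition W :: "nat \<Rightarrow> real \<Rightarrow> real" where "W n = (\<lambda>z. (deriv ^^ n) V (u z k0))"

lemma sp_e: "smooth_periodic (e j)"
  unfolding e_def by (rule sp_section[OF k0])

lemma sp_W: "smooth_periodic (W n)"
  using sp_compose[OF smooth_funpow_deriv[OF V_smooth] sp_e[of 0], of n] by (simp add: W_def e_def)

lemma pdd_e: "pdd i j u z k0 = (deriv ^^ i) (e j) z"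
  by (simp add: pdd_eq_deriv e_def)

text \<open>At \<open>k = k0\<close>: \<open>e j\<close> is \<open>\<partial>\<^sub>k\<^sup>j u\<close> and \<open>x\<close> is \<open>u\<^sub>z\<close>.  \<open>L\<close> is the linearised operator; \<open>T\<close> and \<open>S\<close> are the
  coefficients of one and of two \<open>X\<close>-derivatives in \<open>D\<^sup>4 + \<sigma> D\<^sup>2\<close>.  A suffix \<open>1\<close> or \<open>2\<close> marks the first or second
  \<open>k\<close>-derivative along the family, so \<open>G1\<close> and \<open>G2\<close> are those of \<open>G = T u\<^sub>k + S u\<^sub>z\<close>, the forcing at order two.\<close>

abbreviation "x \<equiv> deriv (e 0)"
abbreviation "L \<equiv> Ev (k0^4) (\<sigma> * k0^2) (W 2)"
abbreviation "L1 \<equiv> Ev (4 * k0^3) (2 * \<sigma> * k0) (\<lambda>z. W 3 z * e 1 z)"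
abbreviation "L2 \<equiv> Ev (12 * k0^2) (2 * \<sigma>) (\<lambda>z. W 4 z * (e 1 z)^2 + W 3 z * e 2 z)"
abbreviation "T \<equiv> Od (4 * k0^3) (2 * \<sigma> * k0)"
abbreviation "T1 \<equiv> Od (12 * k0^2) (2 * \<sigma>)"
abbreviation "S \<equiv> Ev 0 (6 * k0^2) (\<lambda>_. \<sigma>)"
abbreviation "S1 \<equiv> Ev 0 (12 * k0) (\<lambda>_. 0)"

definition G :: "real \<Rightarrow> real" where "G = (\<lambda>z. T (e 1) z + S x z)"
definition G1 :: "real \<Rightarrow> real" where
  "G1 = (\<lambda>z. T1 (e 1) z + T (e 2) z + S1 x z + S (deriv (e 1)) z)"
definition G2 :: "real \<Rightarrow> real" where
  "G2 = (\<lambda>z. Od (24 * k0) 0 (e 1) z + 2 * T1 (e 2) z + T (e 3) z + Ev 0 12 (\<lambda>_. 0) x z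
    + 2 * S1 (deriv (e 1)) z + S (deriv (e 2)) z)"

lemmas sps = sp_e sp_W sp_const sp_deriv sp_funpow sp_Od sp_Ev sp_add sp_diff sp_minus sp_mult sp_cmult sp_power2

lemma sp_G: "smooth_periodic G" "smooth_periodic G1" "smooth_periodic G2"
  unfolding G_def G1_def G2_def by (intro sps)+

lemma L0_eq: "L0 \<sigma> V u k0 f z = L f z"
  by (simp add: L0_def Ev_def W_def)

text \<open>These identities are what allows \<open>L\<close> to be moved onto the known corrections in the inner products.\<close>

lemma wave_identities:
  "L x = (\<lambda>z. 0)"
  "L (deriv x) = (\<lambda>z. - (W 3 z * (x z)^2))"
  "L (e 1) = (\<lambda>z. - T x z)"
  "L (deriv (e 1)) = (\<lambda>z. - L1 x z)"
  "L (e 2) = (\<lambda>z. - L1 (e 1) z - T1 x z - T (deriv (e 1)) z)"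
  "L (deriv (e 2)) = (\<lambda>z. - L2 x z - 2 * L1 (deriv (e 1)) z)"
proof (rule_tac [!] ext)
  fix z
  have W: "(deriv ^^ n) V (u z k0) = W n z" for n by (simp add: W_def)
  show "L x z = 0" "L (deriv x) z = - (W 3 z * (x z)^2)" "L (e 1) z = - T x z"
    "L (deriv (e 1)) z = - L1 x z"
    "L (e 2) z = - L1 (e 1) z - T1 x z - T (deriv (e 1)) z"
    "L (deriv (e 2)) z = - L2 x z - 2 * L1 (deriv (e 1)) z"
    using ode_derivatives[OF k0, of z] unfolding pdd_e Ev_def Od_def W
    by (simp_all add: numeral_eq_Suc algebra_simps)
qed

text \<open>Integration by parts gives \<open>A'(k) = \<langle>\<langle>u\<^sub>z, G\<rangle>\<rangle>\<close> at every \<open>k\<close>, the solvability condition at order two;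
  the higher derivatives follow by differentiating this product under the integral.\<close>

lemma action_derivs:
  "deriv (action \<sigma> u) k0 = ip x G"
  "(deriv ^^ 2) (action \<sigma> u) k0 = ip (deriv (e 1)) G + ip x G1"
  "(deriv ^^ 3) (action \<sigma> u) k0 = ip (deriv (e 2)) G + 2 * ip (deriv (e 1)) G1 + ip x G2"
proof -
  define y where "y = (\<lambda>i j z k. pdd i j u z k)"
  have y2: "((\<lambda>s. y i j z s) has_real_derivative y i j' z k) (at k)"
    if "k \<in> I" "j' = Suc j" for i j j' z k unfolding y_def that(2) by (rule u_DERIV2[OF that(1)])
  have y2s: "((\<lambda>s. y i 0 z s) has_real_derivative y i 1 z k) (at k)"
    "((\<lambda>s. y i 1 z s) has_real_derivative y i 2 z k) (at k)"
    "((\<lambda>s. y i 2 z s) has_real_derivative y i 3 z k) (at k)" if "k \<in> I" for i z k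
    by (rule y2, rule that, simp)+
  have sy: "smooth2 I (\<lambda>z k. y i j z k)" for i j
    unfolding y_def by (rule smooth2_pdd[OF I_open u_smooth])
  note sm = sy smooth2_proj2[OF I_open] smooth2_const smooth2_add[OF I_open] smooth2_mult[OF I_open]
    smooth2_power[OF I_open]
  define a0 where "a0 = (\<lambda>z k. \<sigma> * k * (y 1 0 z k)^2 + (- 2) * k^3 * (y 2 0 z k)^2)"
  define a0' where "a0' = (\<lambda>z k. \<sigma> * (y 1 0 z k)^2 + 2 * \<sigma> * k * y 1 0 z k * y 1 1 z k
      + (- 6) * k^2 * (y 2 0 z k)^2 + (- 4) * k^3 * y 2 0 z k * y 2 1 z k)"
  define g where "g = (\<lambda>z k. 4 * k^3 * y 3 1 z k + 2 * \<sigma> * k * y 1 1 z k + 6 * k^2 * y 3 0 z k + \<sigma> * y 1 0 z k)"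
  define g1 where "g1 = (\<lambda>z k. 18 * k^2 * y 3 1 z k + 4 * k^3 * y 3 2 z k + 12 * k * y 3 0 z k
      + 3 * \<sigma> * y 1 1 z k + 2 * \<sigma> * k * y 1 2 z k)"
  define g2 where "g2 = (\<lambda>z k. 48 * k * y 3 1 z k + 30 * k^2 * y 3 2 z k + 4 * k^3 * y 3 3 z k
      + 12 * y 3 0 z k + 5 * \<sigma> * y 1 2 z k + 2 * \<sigma> * k * y 1 3 z k)"
  have sg: "smooth2 I g" "smooth2 I g1" "smooth2 I g2" "smooth2 I a0" "smooth2 I a0'"
    unfolding g_def g1_def g2_def a0_def a0'_def by (intro sm)+
  have gD: "((\<lambda>s. g z s) has_real_derivative g1 z k) (at k)"
    "((\<lambda>s. g1 z s) has_real_derivative g2 z k) (at k)"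
    "((\<lambda>s. a0 z s) has_real_derivative a0' z k) (at k)" if "k \<in> I" for z k
    unfolding g_def g1_def g2_def a0_def a0'_def
    by (auto intro!: derivative_eq_intros y2s that simp: algebra_simps simp del: One_nat_def)
  define B1 where "B1 = (\<lambda>z k. y 1 0 z k * g z k)"
  define B2 where "B2 = (\<lambda>z k. y 1 1 z k * g z k + y 1 0 z k * g1 z k)"
  define B3 where "B3 = (\<lambda>z k. y 1 2 z k * g z k + 2 * (y 1 1 z k * g1 z k) + y 1 0 z k * g2 z k)"
  have sB: "smooth2 I B1" "smooth2 I B2" "smooth2 I B3"
    unfolding B1_def B2_def B3_def by (intro sm sg)+
  have BD: "((\<lambda>s. B1 z s) has_real_derivative B2 z k) (at k)"
    "((\<lambda>s. B2 z s) has_real_derivative B3 z k) (at k)" if "k \<in> I" for z k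
    unfolding B1_def B2_def B3_def
    by (auto intro!: derivative_eq_intros y2s gD that simp: algebra_simps simp del: One_nat_def)
  have lb: "((\<lambda>k. 1 / (2 * pi) * integral {0..2 * pi} (\<lambda>z. P z k)) has_real_derivative
      1 / (2 * pi) * integral {0..2 * pi} (\<lambda>z. P' z k)) (at k)"
    if "smooth2 I P" "smooth2 I P'" "\<And>z k. k \<in> I \<Longrightarrow> ((\<lambda>s. P z s) has_real_derivative P' z k) (at k)"
      "k \<in> I" for P P' k
    by (intro DERIV_cmult smooth2_leibniz[OF I_open I_interval that(1,2) _ that(4)] that(3))
  have act: "action \<sigma> u = (\<lambda>k. 1 / (2 * pi) * integral {0..2 * pi} (\<lambda>z. a0 z k))"
    by (simp add: action_def a0_def y_def fun_eq_iff)
  have ibp: "integral {0..2 * pi} (\<lambda>z. a0' z k) = integral {0..2 * pi} (\<lambda>z. B1 z k)" if "k \<in> I" for k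
  proof -
    define f h where "f = (\<lambda>z. u z k)" and "h = (\<lambda>z. pd2 u z k)"
    have f: "smooth_periodic f" and h: "smooth_periodic h"
      using sp_section[OF that, of 0] sp_section[OF that, of 1] by (simp_all add: f_def h_def)
    have yf: "y i 0 z k = (deriv ^^ i) f z" "y i 1 z k = (deriv ^^ i) h z" for i z
      by (simp_all add: y_def pdd_eq_deriv f_def h_def)
    define f1 f2 f3 h1 h2 h3 where fh: "f1 = deriv f" "f2 = deriv f1" "f3 = deriv f2"
      "h1 = deriv h" "h2 = deriv h1" "h3 = deriv h2"
    have yf': "y 1 0 z k = f1 z" "y 2 0 z k = f2 z" "y 3 0 z k = f3 z"
      "y 1 1 z k = h1 z" "y 2 1 z k = h2 z" "y 3 1 z k = h3 z" for z
      unfolding yf fh by (simp_all add: numeral_eq_Suc)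
    have sf: "smooth_periodic f1" "smooth_periodic f2" "smooth_periodic f3"
      "smooth_periodic h1" "smooth_periodic h2" "smooth_periodic h3"
      unfolding fh by (intro sp_deriv f h)+
    have "ip f2 f2 = - ip f1 f3" "ip f2 h2 = - ip f1 h3"
      using ip_deriv[OF sf(1) sf(2)] ip_deriv[OF sf(1) sf(5)] by (simp_all add: fh)
    then have ibp: "integral {0..2 * pi} (\<lambda>z. f2 z * f2 z) = - integral {0..2 * pi} (\<lambda>z. f1 z * f3 z)"
      "integral {0..2 * pi} (\<lambda>z. f2 z * h2 z) = - integral {0..2 * pi} (\<lambda>z. f1 z * h3 z)"
      by (simp_all add: ip_def field_simps)
    have lin: "integral {0..2 * pi} (\<lambda>z. a * p1 z + b * p2 z + c * p3 z + d * p4 z)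
      = a * integral {0..2 * pi} p1 + b * integral {0..2 * pi} p2 + c * integral {0..2 * pi} p3
        + d * integral {0..2 * pi} p4"
      if "smooth_periodic p1" "smooth_periodic p2" "smooth_periodic p3" "smooth_periodic p4"
      for a b c d :: real and p1 p2 p3 p4
      using that by (simp add: integral_add sp_integrable sp_add sp_cmult integral_mult_right)
    have "(\<lambda>z. a0' z k) = (\<lambda>z. \<sigma> * (f1 z * f1 z) + 2 * \<sigma> * k * (f1 z * h1 z)
        + (- 6 * k^2) * (f2 z * f2 z) + (- 4 * k^3) * (f2 z * h2 z))"
      "(\<lambda>z. B1 z k) = (\<lambda>z. \<sigma> * (f1 z * f1 z) + 2 * \<sigma> * k * (f1 z * h1 z)
        + (6 * k^2) * (f1 z * f3 z) + (4 * k^3) * (f1 z * h3 z))"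
      unfolding a0'_def B1_def g_def yf' by (auto simp: power2_eq_square algebra_simps)
    then show ?thesis by (simp only: lin sp_mult sf ibp)
  qed
  have A1: "(action \<sigma> u has_real_derivative 1 / (2 * pi) * integral {0..2 * pi} (\<lambda>z. B1 z k)) (at k)"
    if "k \<in> I" for k
    unfolding ibp[OF that, symmetric] unfolding act by (rule lb[OF sg(4,5) gD(3) that])
  have A2: "((\<lambda>k. 1 / (2 * pi) * integral {0..2 * pi} (\<lambda>z. B1 z k)) has_real_derivative
      1 / (2 * pi) * integral {0..2 * pi} (\<lambda>z. B2 z k)) (at k)" if "k \<in> I" for k
    by (rule lb[OF sB(1,2) BD(1) that])
  have A3: "((\<lambda>k. 1 / (2 * pi) * integral {0..2 * pi} (\<lambda>z. B2 z k)) has_real_derivative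
      1 / (2 * pi) * integral {0..2 * pi} (\<lambda>z. B3 z k)) (at k)" if "k \<in> I" for k
    by (rule lb[OF sB(2,3) BD(2) that])
  have dA1: "deriv (action \<sigma> u) k = 1 / (2 * pi) * integral {0..2 * pi} (\<lambda>z. B1 z k)" if "k \<in> I" for k
    by (rule DERIV_imp_deriv[OF A1[OF that]])
  have dA2: "deriv (deriv (action \<sigma> u)) k = 1 / (2 * pi) * integral {0..2 * pi} (\<lambda>z. B2 z k)" if "k \<in> I" for k
  proof -
    have "\<forall>\<^sub>F s in nhds k. deriv (action \<sigma> u) s = 1 / (2 * pi) * integral {0..2 * pi} (\<lambda>z. B1 z s)"
      using eventually_nhds_in_open[OF I_open that] by eventually_elim (rule dA1)
    then show ?thesis using deriv_cong_ev DERIV_imp_deriv[OF A2[OF that]] by metis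
  qed
  have dA3: "deriv (deriv (deriv (action \<sigma> u))) k = 1 / (2 * pi) * integral {0..2 * pi} (\<lambda>z. B3 z k)"
    if "k \<in> I" for k
  proof -
    have "\<forall>\<^sub>F s in nhds k. deriv (deriv (action \<sigma> u)) s = 1 / (2 * pi) * integral {0..2 * pi} (\<lambda>z. B2 z s)"
      using eventually_nhds_in_open[OF I_open that] by eventually_elim (rule dA2)
    then show ?thesis using deriv_cong_ev DERIV_imp_deriv[OF A3[OF that]] by metis
  qed
  have ye: "y i j z k0 = (deriv ^^ i) (e j) z" for i j z by (simp add: y_def pdd_e)
  have gG: "g z k0 = G z" "g1 z k0 = G1 z" "g2 z k0 = G2 z" for z
    unfolding g_def g1_def g2_def G_def G1_def G2_def ye Od_def Ev_def
    by (simp_all add: numeral_eq_Suc algebra_simps)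
  have y1: "y 1 0 z k0 = x z" "y 1 1 z k0 = deriv (e 1) z" "y 1 2 z k0 = deriv (e 2) z" for z
    by (simp_all add: ye)
  note sx = sps(1)[THEN sp_deriv]
  show "deriv (action \<sigma> u) k0 = ip x G"
    unfolding dA1[OF k0] B1_def gG y1 by (simp add: ip_def)
  show "(deriv ^^ 2) (action \<sigma> u) k0 = ip (deriv (e 1)) G + ip x G1"
    using dA2[OF k0] unfolding B2_def gG y1
    by (simp add: numeral_2_eq_2 ip_def integral_add sp_integrable sp_mult sx sp_G add_divide_distrib)
  show "(deriv ^^ 3) (action \<sigma> u) k0 = ip (deriv (e 2)) G + 2 * ip (deriv (e 1)) G1 + ip x G2"
    using dA3[OF k0] unfolding B3_def gG y1
    by (simp add: numeral_3_eq_3 ip_def integral_add sp_integrable sp_add sp_cmult sp_mult sx sp_G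
        add_divide_distrib integral_mult_right)
qed

lemma kernel_L: "smooth_periodic f \<Longrightarrow> (\<And>z. L f z = 0) \<Longrightarrow> \<exists>c. f = (\<lambda>z. c * x z)"
proof -
  assume f: "smooth_periodic f" "\<And>z. L f z = 0"
  have "f \<in> {f. \<exists>c. f = (\<lambda>z. c * pd1 u z k0)}"
    unfolding kernel[symmetric] using f by (simp add: L0_eq)
  moreover have "pd1 u z k0 = x z" for z using pdd_e[of 1 0 z] by simp
  ultimately show ?thesis by simp
qed

lemma x_nonzero: "\<exists>z. x z \<noteq> 0"
proof (rule ccontr)
  assume "\<not> (\<exists>z. x z \<noteq> 0)"
  then have "(e 0 has_real_derivative 0) (at z)" for z
    using smooth_has_deriv[OF sp_smooth[OF sp_e], of 0 z] by simp
  then have "e 0 z = e 0 0" for z using DERIV_isconst_all by blast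
  then have "u z k0 = u 0 k0" for z by (simp add: e_def)
  then show False using u_nonconst by (auto simp: constant_on_def)
qed

lemma fredholm:
  assumes g: "smooth_periodic g" and orth: "ip x g = 0"
  shows "\<exists>f. smooth_periodic f \<and> L f = g"
proof -
  have k4: "k0^4 \<noteq> 0" using k0_nz by simp
  have Lf: "L f z = k0^4 * ((deriv ^^ 4) f z + (\<sigma> / k0^2) * (deriv ^^ 2) f z + (1 / k0^4 * W 2 z) * f z)" for f z
    using k0_nz by (simp add: Ev_def field_simps eval_nat_numeral)
  have "\<exists>f. smooth_periodic f \<and>
    (\<forall>z. (deriv ^^ 4) f z + (\<sigma> / k0^2) * (deriv ^^ 2) f z + (1 / k0^4 * W 2 z) * f z = 1 / k0^4 * g z)"
  proof (rule periodic_fredholm[where \<psi> = x])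
    show "(deriv ^^ 4) x z + (\<sigma> / k0^2) * (deriv ^^ 2) x z + (1 / k0^4 * W 2 z) * x z = 0" for z
      using Lf[of x z] wave_identities(1) k4 by (simp add: fun_eq_iff)
    show "\<exists>z. x z \<noteq> 0" by (rule x_nonzero)
    show "\<exists>c. f = (\<lambda>z. c * x z)" if f: "smooth_periodic f"
      "\<And>z. (deriv ^^ 4) f z + (\<sigma> / k0^2) * (deriv ^^ 2) f z + (1 / k0^4 * W 2 z) * f z = 0" for f
      using f by (intro kernel_L) (simp_all add: Lf)
    have "integral {0..2 * pi} (\<lambda>z. x z * (1 / k0^4 * g z)) = 1 / k0^4 * integral {0..2 * pi} (\<lambda>z. x z * g z)"
      by (subst integral_mult_right[symmetric]) (simp add: algebra_simps)
    then show "integral {0..2 * pi} (\<lambda>z. x z * (1 / k0^4 * g z)) = 0"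
      using orth by (simp add: ip_def)
  qed (intro sps g)+
  then obtain f where f: "smooth_periodic f" "\<And>z. L f z = k0^4 * (1 / k0^4 * g z)"
    unfolding Lf by metis
  then have "L f = g" using k4 by (auto simp: fun_eq_iff)
  with f(1) show ?thesis by blast
qed

end

section \<open>Solvability conditions\<close>

lemma sp_divide: "smooth_periodic f \<Longrightarrow> smooth_periodic (\<lambda>z. f z / c)"
  using sp_cmult[of f "1 / c"] by simp

lemma ip_divide: "ip f (\<lambda>z. g z / c) = ip f g / c"
  using ip_cmult[of f "1 / c" g] by simp

lemma ip_Ev_commute: "smooth_periodic f \<Longrightarrow> smooth_periodic g \<Longrightarrow> smooth_periodic v \<Longrightarrow>
    ip f (Ev a b v g) = ip g (Ev a b v f)"
  using ip_Ev[of f g v a b] ip_commute by metis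

lemma ip_Od_anticommute: "smooth_periodic f \<Longrightarrow> smooth_periodic g \<Longrightarrow>
    ip f (Od a b g) = - ip g (Od a b f)"
  using ip_Od[of f g a b] ip_commute[of g "Od a b f"] by simp

lemma ip_deriv_anticommute: "smooth_periodic f \<Longrightarrow> smooth_periodic g \<Longrightarrow>
    ip f (deriv g) = - ip g (deriv f)"
  using ip_deriv[of f g] ip_commute[of g "deriv f"] by simp

context critical_wave
begin

lemma op_symmetry:
  assumes "smooth_periodic f" "smooth_periodic g"
  shows "ip f (L g) = ip g (L f)" "ip f (L1 g) = ip g (L1 f)" "ip f (L2 g) = ip g (L2 f)"
    "ip f (S g) = ip g (S f)" "ip f (S1 g) = ip g (S1 f)"
    "ip f (T g) = - ip g (T f)" "ip f (T1 g) = - ip g (T1 f)" "ip f (deriv g) = - ip g (deriv f)"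
  by (rule ip_Ev_commute ip_Od_anticommute ip_deriv_anticommute, (intro sps assms)+)+

text \<open>With \<open>P(s) = s\<^sup>4 + \<sigma> s\<^sup>2\<close> the operators are \<open>T = P'(k \<partial>\<^sub>z)\<close> and \<open>S = P''(k \<partial>\<^sub>z) / 2\<close>, whence \<open>\<partial>\<^sub>k T = 2 S \<partial>\<^sub>z\<close>.\<close>

lemma T1_eq: "T1 f z = 2 * S (deriv f) z"
  by (simp add: Od_def Ev_def numeral_eq_Suc)

lemma ip_T1: "ip f (T1 g) = 2 * ip f (S (deriv g))"
  using ip_cmult[of f 2 "S (deriv g)"] by (simp add: T1_eq[abs_def])

lemma S_deriv_anti:
  assumes "smooth_periodic f" "smooth_periodic g"
  shows "ip f (S (deriv g)) = - ip g (S (deriv f))"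
  using op_symmetry(7)[OF assms] by (simp add: ip_T1)

lemma T_deriv_sym:
  assumes "smooth_periodic f" "smooth_periodic g"
  shows "ip f (T (deriv g)) = ip g (T (deriv f))"
proof -
  have "ip f (T (deriv g)) = - ip (T g) (deriv f)"
    using op_symmetry(8)[of f "T g"] assms by (simp add: deriv_Od sps)
  then show ?thesis
    using op_symmetry(6)[OF sp_deriv[OF assms(1)] assms(2)] ip_commute[of "T g" "deriv f"] by linarith
qed

lemma pair_identities:
  assumes f: "smooth_periodic f"
  shows "ip f (L x) = 0"
    and "ip f (L (deriv x)) = - ip f (\<lambda>z. W 3 z * (x z)^2)"
    and "ip f (L (e 1)) = - ip f (T x)"
    and "ip f (L (deriv (e 1))) = - ip f (L1 x)"
    and "ip f (L (e 2)) = - ip f (L1 (e 1)) - ip f (T1 x) - ip f (T (deriv (e 1)))"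
    and "ip f (L (deriv (e 2))) = - ip f (L2 x) - 2 * ip f (L1 (deriv (e 1)))"
proof -
  have s: "smooth_periodic (L1 g)" "smooth_periodic (L2 g)" if "smooth_periodic g" for g
    by (intro sps that)+
  show "ip f (L x) = 0" unfolding wave_identities by (simp add: ip_def)
  show "ip f (L (deriv x)) = - ip f (\<lambda>z. W 3 z * (x z)^2)"
    unfolding wave_identities by (rule ip_minus)
  show "ip f (L (e 1)) = - ip f (T x)" unfolding wave_identities by (rule ip_minus)
  show "ip f (L (deriv (e 1))) = - ip f (L1 x)" unfolding wave_identities by (rule ip_minus)
  show "ip f (L (e 2)) = - ip f (L1 (e 1)) - ip f (T1 x) - ip f (T (deriv (e 1)))"
    unfolding wave_identities by (simp add: ip_diff ip_minus s sps f)
  show "ip f (L (deriv (e 2))) = - ip f (L2 x) - 2 * ip f (L1 (deriv (e 1)))"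
    unfolding wave_identities by (simp add: ip_diff ip_minus ip_cmult s sps f)
qed

lemma ip_G: "smooth_periodic f \<Longrightarrow> ip f G = ip f (T (e 1)) + ip f (S x)"
  unfolding G_def by (simp add: ip_add sps)

lemma ip_G1: "smooth_periodic f \<Longrightarrow>
    ip f G1 = ip f (T1 (e 1)) + ip f (T (e 2)) + ip f (S1 x) + ip f (S (deriv (e 1)))"
  unfolding G1_def by (simp add: ip_add sps)

lemma ip_x_G: "ip x G = 0"
  using A_k action_derivs(1) by simp

lemma ip_x_G1: "ip (deriv (e 1)) G + ip x G1 = 0"
  using A_kk action_derivs(2) by simp

lemma xi3_exists: "\<exists>\<xi>. smooth_periodic \<xi> \<and> L \<xi> = (\<lambda>z. - G z)"
  by (rule fredholm) (simp_all add: sp_minus sp_G ip_minus ip_x_G)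

end

text \<open>\<open>y3\<close>, and later \<open>y4\<close>, are the corrections \<open>\<xi>\<^sub>3\<close> and \<open>\<xi>\<^sub>4\<close>.\<close>

locale corrected_wave = critical_wave +
  fixes y3 :: "real \<Rightarrow> real"
  assumes sp_y3: "smooth_periodic y3" and L_y3: "L y3 = (\<lambda>z. - G z)"
begin

lemma pair_y3: "smooth_periodic f \<Longrightarrow> ip f (L y3) = - ip f (T (e 1)) - ip f (S x)"
  unfolding L_y3 by (simp add: ip_minus ip_G)

text \<open>The equation for \<open>y3\<close>, differentiated in \<open>z\<close>, trades products with \<open>V'''\<close> for \<open>G\<close> and \<open>L\<close>.\<close>

lemma pair_y3_deriv:
  assumes f: "smooth_periodic f"
  shows "ip f (\<lambda>z. W 3 z * x z * y3 z) = ip G (deriv f) - ip f (L (deriv y3))"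
proof -
  have W3: "deriv (W 2) = (\<lambda>z. W 3 z * x z)"
  proof
    fix z
    have "((\<lambda>z. (deriv ^^ 2) V (e 0 z)) has_real_derivative deriv ((deriv ^^ 2) V) (e 0 z) * deriv (e 0) z) (at z)"
      by (rule DERIV_chain2[where f = "(deriv ^^ 2) V" and g = "e 0"])
        (intro smooth_has_deriv smooth_funpow_deriv V_smooth sp_smooth[OF sp_e])+
    then show "deriv (W 2) z = W 3 z * x z"
      unfolding W_def by (intro DERIV_imp_deriv) (simp add: e_def numeral_eq_Suc)
  qed
  then have "deriv (W (Suc (Suc 0))) = (\<lambda>z. W (Suc (Suc (Suc 0))) z * x z)"
    by (simp add: numeral_eq_Suc)
  then have "deriv (L y3) = (\<lambda>z. L (deriv y3) z + W 3 z * x z * y3 z)"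
    unfolding Ev_def
    by (simp add: deriv_eqs sp_smooth sps sp_y3 numeral_eq_Suc algebra_simps)
  moreover have "deriv (L y3) = (\<lambda>z. - deriv G z)"
    unfolding L_y3 using smooth_has_deriv[OF sp_smooth[OF sp_G(1)]]
    by (auto intro!: ext DERIV_imp_deriv derivative_intros)
  ultimately have "W 3 z * x z * y3 z = - deriv G z - L (deriv y3) z" for z
    by (simp add: fun_eq_iff algebra_simps)
  then have "ip f (\<lambda>z. W 3 z * x z * y3 z) = ip f (\<lambda>z. - deriv G z - L (deriv y3) z)" by simp
  also have "\<dots> = - ip f (deriv G) - ip f (L (deriv y3))"
    by (simp add: ip_diff ip_minus f sps sp_G sp_y3)
  also have "ip f (deriv G) = - ip G (deriv f)" using op_symmetry(8)[OF f sp_G(1)] .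
  finally show ?thesis by simp
qed

text \<open>Order three, terms in \<open>q''\<close>: since \<open>T x = - L u\<^sub>k\<close>, moving \<open>T\<close> and then \<open>L\<close> across the product leaves
  \<open>\<langle>\<langle>u\<^sub>k, L y3\<rangle>\<rangle>\<close>, which cancels the rest.\<close>

lemma solvable_y4: "ip x (\<lambda>z. T y3 z + S (e 1) z + 4 * k0 * deriv x z) = 0"
proof -
  note sp = sps sp_y3
  have "ip x (\<lambda>z. T y3 z + S (e 1) z + 4 * k0 * deriv x z)
      = ip x (T y3) + ip x (S (e 1)) + 4 * k0 * ip x (deriv x)"
    by (simp add: ip_add ip_cmult sp)
  moreover have "ip x (deriv x) = 0" "ip (e 1) (T (e 1)) = 0"
    using ip_deriv_self ip_Od_self sps by simp_all
  ultimately show ?thesis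
    using op_symmetry(6)[of x y3] pair_identities(3)[of y3] op_symmetry(1)[of y3 "e 1"] pair_y3[of "e 1"] op_symmetry(4)[of x "e 1"]
    by (simp add: sp)
qed

text \<open>Order three, terms in \<open>q q'\<close>: the product is \<open>A\<^sub>k\<^sub>k(k0)\<close>.\<close>

lemma solvable_eta: "ip x (\<lambda>z. G1 z + L1 y3 z) = 0"
proof -
  note sp = sps sp_y3
  have "ip x (\<lambda>z. G1 z + L1 y3 z) = ip x G1 + ip x (L1 y3)"
    by (rule ip_add) (intro sp sp_G)+
  then show ?thesis
    using ip_x_G1 ip_G[of "deriv (e 1)"] op_symmetry(2)[of x y3] pair_identities(4)[of y3]
      op_symmetry(1)[of y3 "deriv (e 1)"] pair_y3[of "deriv (e 1)"]
    by (simp add: sp)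
qed

lemma y4_exists: "\<exists>\<xi>. smooth_periodic \<xi> \<and> L \<xi> = (\<lambda>z. - (T y3 z + S (e 1) z + 4 * k0 * deriv x z))"
  by (rule fredholm) (intro sps sp_y3, simp only: ip_minus solvable_y4 minus_zero)

lemma eta_exists: "\<exists>\<eta>. smooth_periodic \<eta> \<and> L \<eta> = (\<lambda>z. - (G1 z + L1 y3 z))"
  by (rule fredholm) (intro sps sp_y3 sp_G, simp only: ip_minus solvable_eta minus_zero)

end

text \<open>\<open>\<eta>\<close> answers the forcing \<open>q q'\<close> at order three.  Its equation is the formal \<open>k\<close>-derivative of the one
  for \<open>y3\<close>, so it takes the place of \<open>\<partial>\<^sub>k \<xi>\<^sub>3\<close>, although \<open>\<xi>\<^sub>3\<close> is defined at \<open>k0\<close> only.\<close>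

locale second_corrected_wave = corrected_wave +
  fixes y4 \<eta> :: "real \<Rightarrow> real"
  assumes sp_y4: "smooth_periodic y4" and L_y4: "L y4 = (\<lambda>z. - (T y3 z + S (e 1) z + 4 * k0 * deriv x z))"
    and sp_eta: "smooth_periodic \<eta>" and L_eta: "L \<eta> = (\<lambda>z. - (G1 z + L1 y3 z))"
begin

lemmas sp = sps sp_y3 sp_y4 sp_eta sp_G

lemma pair_y4: "smooth_periodic f \<Longrightarrow>
    ip f (L y4) = - ip f (T y3) - ip f (S (e 1)) - 4 * k0 * ip f (deriv x)"
  unfolding L_y4 ip_minus by (simp add: ip_add ip_cmult sp)

lemma pair_eta: "smooth_periodic f \<Longrightarrow> ip f (L \<eta>) = - ip f G1 - ip f (L1 y3)"
proof -
  assume f: "smooth_periodic f"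
  have "ip f (\<lambda>z. G1 z + L1 y3 z) = ip f G1 + ip f (L1 y3)"
    by (rule ip_add) (intro sp f)+
  then show ?thesis unfolding L_eta ip_minus by simp
qed

text \<open>The forcing at order four is a sum of profiles with coefficients depending on \<open>X\<close>: \<open>h1\<close> to \<open>h4\<close> belong to
  \<open>q'''\<close>, \<open>q'\<^sup>2\<close>, \<open>q q''\<close>, \<open>q\<^sup>2 q'\<close>, and \<open>h5\<close> to \<open>h9\<close> to \<open>\<alpha>''\<close>, \<open>q' \<alpha>\<close>, \<open>q \<alpha>'\<close>, \<open>\<alpha>\<^sup>2 / 2\<close>, \<open>q\<^sup>2 \<alpha>\<close>, where
  \<open>\<alpha>(X) u\<^sub>z\<close> is the free kernel component of \<open>w2\<close>; that of \<open>w3\<close>, \<open>\<beta>(X) u\<^sub>z\<close>, brings \<open>T x\<close> and \<open>L1 x\<close>.\<close>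

definition "h1 = (\<lambda>z. 4 * k0 * deriv (e 1) z + x z + S y3 z + T y4 z)"
definition "h2 = (\<lambda>z. S (e 2) z + S1 (e 1) z + 3 * deriv x z + S (deriv y3) z + T \<eta> z + 1 / 2 * (W 3 z * (y3 z)^2))"
definition "h3 = (\<lambda>z. S1 (e 1) z + S (e 2) z + 4 * deriv x z + 4 * k0 * deriv (deriv (e 1)) z
    + T1 y3 z + T \<eta> z + L1 y4 z)"
definition "h4 = (\<lambda>z. 1 / 2 * G2 z + L1 \<eta> z + 1 / 2 * L2 y3 z)"
definition "h5 = (\<lambda>z. S x z + T (e 1) z)"
definition "h6 = (\<lambda>z. S (deriv x) z + W 3 z * x z * y3 z + T (deriv (e 1)) z)"
definition "h7 = (\<lambda>z. T1 x z + L1 (e 1) z + T (deriv (e 1)) z)"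
definition "h8 = (\<lambda>z. W 3 z * (x z)^2)"
definition "h9 = (\<lambda>z. 1 / 2 * L2 x z + L1 (deriv (e 1)) z)"

lemma sp_h: "smooth_periodic h1" "smooth_periodic h2" "smooth_periodic h3" "smooth_periodic h4"
  "smooth_periodic h5" "smooth_periodic h6" "smooth_periodic h7" "smooth_periodic h8" "smooth_periodic h9"
  unfolding h1_def h2_def h3_def h4_def h5_def h6_def h7_def h8_def h9_def by (intro sp)+

lemma spL: "smooth_periodic f \<Longrightarrow> smooth_periodic (L f)" "smooth_periodic f \<Longrightarrow> smooth_periodic (L1 f)"
  "smooth_periodic f \<Longrightarrow> smooth_periodic (L2 f)" "smooth_periodic f \<Longrightarrow> smooth_periodic (S f)"
  "smooth_periodic f \<Longrightarrow> smooth_periodic (S1 f)"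
  by (intro sp; assumption)+

lemmas ip_expand = ip_add ip_cmult ip_divide sp sp_divide spL

lemma ip_x_S_dx: "ip x (S (deriv x)) = 0"
  using S_deriv_anti[of x x] by (simp add: sps)

lemma ip_x_T_eta:
  "ip x (T \<eta>) = ip y3 (T1 x) + ip y3 (T (deriv (e 1))) - ip (e 1) (S1 x) - ip (e 2) (S x)"
proof -
  define a b where "a = e 1" and "b = e 2"
  have sa: "smooth_periodic a" "smooth_periodic b" "smooth_periodic x" by (simp_all add: a_def b_def sps)
  have t1: "ip x (T \<eta>) = - ip a G1 - ip a (L1 y3)"
    using op_symmetry(6)[OF sa(3) sp_eta] pair_identities(3)[OF sp_eta] op_symmetry(1)[OF sp_eta sa(1)]
      pair_eta[OF sa(1)] by (simp add: a_def)
  have t2: "ip a G1 = ip a (T1 a) + ip a (T b) + ip a (S1 x) + ip a (S (deriv a))"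
    using ip_G1[OF sa(1)] by (simp add: a_def b_def)
  have t3: "ip a (T1 a) = 0" "ip a (S (deriv a)) = 0"
    using ip_Od_self[OF sa(1)] S_deriv_anti[OF sa(1,1)] by simp_all
  have t4: "ip y3 (L b) = - ip y3 (L1 a) - ip y3 (T1 x) - ip y3 (T (deriv a))"
    using pair_identities(5)[OF sp_y3] by (simp add: a_def b_def)
  have t5: "ip y3 (L b) = - ip b (T a) - ip b (S x)"
    using op_symmetry(1)[OF sp_y3 sa(2)] pair_y3[OF sa(2)] by (simp add: a_def)
  have t6: "ip a (L1 y3) = ip y3 (L1 a)" "ip a (T b) = - ip b (T a)"
    using op_symmetry(2)[OF sa(1) sp_y3] op_symmetry(6)[OF sa(1,2)] by auto
  show ?thesis using t1 t2 t3 t4 t5 t6 unfolding a_def[symmetric] b_def[symmetric] by linarith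
qed

text \<open>The potential term equals \<open>\<langle>\<langle>\<partial>\<^sub>z y3, G\<rangle>\<rangle>\<close>; rewriting \<open>\<eta>\<close> through its equation produces the opposite of this
  and of the remaining products.\<close>

lemma ip_x_h2: "ip x h2 = 0"
proof -
  define a b where "a = e 1" and "b = e 2"
  have sa: "smooth_periodic a" "smooth_periodic b" "smooth_periodic x" by (simp_all add: a_def b_def sps)
  have E: "ip x h2 = ip x (S b) + ip x (S1 a) + 3 * ip x (deriv x) + ip x (S (deriv y3)) + ip x (T \<eta>)
      + 1 / 2 * ip x (\<lambda>z. W 3 z * (y3 z)^2)"
    unfolding h2_def a_def b_def by (simp add: ip_expand)
  have t1: "ip x (T \<eta>) = ip y3 (T1 x) + ip y3 (T (deriv a)) - ip a (S1 x) - ip b (S x)"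
    using ip_x_T_eta by (simp add: a_def b_def)
  have dx: "ip x (deriv x) = 0" "ip a (S (deriv a)) = 0"
    using ip_deriv_self[OF sa(3)] S_deriv_anti[OF sa(1,1)] by simp_all
  have t2: "ip x (\<lambda>z. W 3 z * (y3 z)^2) = ip y3 (\<lambda>z. W 3 z * x z * y3 z)"
    by (simp add: ip_def power2_eq_square mult_ac)
  have t3: "ip y3 (\<lambda>z. W 3 z * x z * y3 z) = ip G (deriv y3) - ip y3 (L (deriv y3))"
    by (rule pair_y3_deriv[OF sp_y3])
  have t4: "ip G (deriv y3) = ip (deriv y3) (T a) + ip (deriv y3) (S x)"
    using ip_G[of "deriv y3"] ip_commute[of G "deriv y3"] by (simp add: sp a_def)
  have t5: "ip y3 (L (deriv y3)) = - ip (deriv y3) (T a) - ip (deriv y3) (S x)"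
    using op_symmetry(1)[of y3 "deriv y3"] pair_y3[of "deriv y3"] by (simp add: sp a_def)
  have t9: "ip y3 (T1 x) = - 2 * ip x (S (deriv y3))" using op_symmetry(7)[OF sp_y3 sa(3)] by (simp add: ip_T1)
  have t10: "ip y3 (T (deriv a)) = - ip (deriv y3) (T a)"
    using T_deriv_sym[OF sp_y3 sa(1)] op_symmetry(6)[OF sa(1) sp_deriv[OF sp_y3]] by simp
  have t12: "ip x (S b) = ip b (S x)" "ip x (S1 a) = ip a (S1 x)" using op_symmetry(4,5)[OF sa(3)] sa by simp_all
  have t14: "ip x (S (deriv y3)) = ip (deriv y3) (S x)" using op_symmetry(4)[OF sa(3) sp_deriv[OF sp_y3]] .
  show ?thesis
    using E dx t1 t2 t3 t4 t5 t9 t10 t12 t14 by linarith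
qed

text \<open>Formally this is the \<open>k\<close>-derivative of the solvability condition for \<open>y4\<close>, with \<open>\<eta>\<close> for \<open>\<partial>\<^sub>k y3\<close>.\<close>

lemma ip_x_h3: "ip x h3 = 0"
proof -
  define a b where "a = e 1" and "b = e 2"
  have sa: "smooth_periodic a" "smooth_periodic b" "smooth_periodic x" "smooth_periodic (deriv a)"
    by (simp_all add: a_def b_def sps)
  have E: "ip x h3 = ip x (S1 a) + ip x (S b) + 4 * ip x (deriv x) + 4 * k0 * ip x (deriv (deriv a))
      + ip x (T1 y3) + ip x (T \<eta>) + ip x (L1 y4)"
    unfolding h3_def a_def b_def by (simp add: ip_expand)
  have t1: "ip x (T \<eta>) = ip y3 (T1 x) + ip y3 (T (deriv a)) - ip a (S1 x) - ip b (S x)"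
    using ip_x_T_eta by (simp add: a_def b_def)
  have dx: "ip x (deriv x) = 0" "ip a (S (deriv a)) = 0"
    using ip_deriv_self[OF sa(3)] S_deriv_anti[OF sa(1,1)] by simp_all
  have t9: "ip x (T1 y3) = - ip y3 (T1 x)" using op_symmetry(7)[OF sa(3) sp_y3] .
  have t12: "ip x (S b) = ip b (S x)" "ip x (S1 a) = ip a (S1 x)" using op_symmetry(4,5)[OF sa(3)] sa by simp_all
  have t14: "ip x (L1 y4) = ip y4 (L1 x)" using op_symmetry(2)[OF sa(3) sp_y4] .
  have t15: "ip y4 (L1 x) = - ip (deriv a) (L y4)"
    using pair_identities(4)[OF sp_y4] op_symmetry(1)[OF sp_y4 sa(4)] by (simp add: a_def)
  have t16: "ip (deriv a) (L y4) = - ip (deriv a) (T y3) - ip (deriv a) (S a) - 4 * k0 * ip (deriv a) (deriv x)"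
    using pair_y4[OF sa(4)] by (simp add: a_def)
  have t17: "ip (deriv a) (T y3) = - ip y3 (T (deriv a))" using op_symmetry(6)[OF sa(4) sp_y3] .
  have t18: "ip (deriv a) (S a) = ip a (S (deriv a))" using op_symmetry(4)[OF sa(4,1)] .
  have t19: "4 * k0 * ip x (deriv (deriv a)) = - (4 * k0 * ip (deriv a) (deriv x))"
    using op_symmetry(8)[OF sa(3,4)] by simp
  show ?thesis
    using E dx t1 t9 t12 t14 t15 t16 t17 t18 t19 by linarith
qed

text \<open>Formally this is half the second \<open>k\<close>-derivative of \<open>\<langle>\<langle>u\<^sub>z, G\<rangle>\<rangle> = A'(k)\<close>.\<close>

lemma ip_x_h4: "ip x h4 = 1 / 2 * (deriv ^^ 3) (action \<sigma> u) k0"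
proof -
  define da db where "da = deriv (e 1)" and "db = deriv (e 2)"
  have sa: "smooth_periodic da" "smooth_periodic db" "smooth_periodic x" by (simp_all add: da_def db_def sps)
  have E: "ip x h4 = 1 / 2 * ip x G2 + ip x (L1 \<eta>) + 1 / 2 * ip x (L2 y3)"
    unfolding h4_def by (simp add: ip_expand)
  have t1: "ip x (L1 \<eta>) = - ip da (L \<eta>)"
    using op_symmetry(2)[OF sa(3) sp_eta] pair_identities(4)[OF sp_eta] op_symmetry(1)[OF sp_eta sa(1)] by (simp add: da_def)
  have t2: "ip da (L \<eta>) = - ip da G1 - ip da (L1 y3)" by (rule pair_eta[OF sa(1)])
  have t3: "ip x (L2 y3) = - ip y3 (L db) - 2 * ip y3 (L1 da)"
    using op_symmetry(3)[OF sa(3) sp_y3] pair_identities(6)[OF sp_y3] by (simp add: da_def db_def)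
  have t4: "ip y3 (L db) = - ip db G"
    using op_symmetry(1)[OF sp_y3 sa(2)] pair_y3[OF sa(2)] ip_G[OF sa(2)] by simp
  have t5: "ip da (L1 y3) = ip y3 (L1 da)" by (rule op_symmetry(2)[OF sa(1) sp_y3])
  show ?thesis
    using E t1 t2 t3 t4 t5 action_derivs(3) unfolding da_def[symmetric] db_def[symmetric] by linarith
qed

lemma ip_x_L: "smooth_periodic f \<Longrightarrow> ip x (L f) = 0"
  using op_symmetry(1)[of x f] pair_identities(1)[of f] by (simp add: sps)

text \<open>The kernel components are phase shifts of size \<open>\<epsilon>\<^sup>2\<close> and \<open>\<epsilon>\<^sup>3\<close>, to which the solvability condition must be
  blind; the following products confirm this profile by profile.\<close>

lemma ip_x_h5: "ip x h5 = 0"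
  using ip_x_L[OF sp_y3] pair_y3[of x] unfolding h5_def by (simp add: ip_expand)

lemma ip_x_h6: "ip x h6 = 0"
proof -
  have E: "ip x h6 = ip x (S (deriv x)) + ip x (\<lambda>z. W 3 z * x z * y3 z) + ip x (T (deriv (e 1)))"
    unfolding h6_def by (simp add: ip_expand)
  have t1: "ip x (\<lambda>z. W 3 z * x z * y3 z) = ip (deriv x) (T (e 1)) + ip (deriv x) (S x)"
    using pair_y3_deriv[of x] ip_x_L[of "deriv y3"] ip_commute[of G "deriv x"] ip_G[of "deriv x"]
    by (simp add: sp)
  have t2: "ip (deriv x) (S x) = ip x (S (deriv x))" using op_symmetry(4)[of "deriv x" x] by (simp add: sps)
  have t3: "ip x (T (deriv (e 1))) = - ip (deriv x) (T (e 1))"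
    using T_deriv_sym[of x "e 1"] op_symmetry(6)[of "e 1" "deriv x"] by (simp add: sps)
  show ?thesis using E t1 t2 t3 ip_x_S_dx by linarith
qed

lemma ip_x_h7: "ip x h7 = 0"
proof -
  have E: "ip x h7 = ip x (T1 x) + ip x (L1 (e 1)) + ip x (T (deriv (e 1)))"
    unfolding h7_def by (simp add: ip_expand)
  have t1: "ip x (T1 x) = 0" using ip_Od_self sps by simp
  have t2: "ip x (L1 (e 1)) = - ip (e 1) (L (deriv (e 1)))"
    using op_symmetry(2)[of x "e 1"] pair_identities(4)[of "e 1"] by (simp add: sps)
  have t3: "ip (e 1) (L (deriv (e 1))) = - ip (deriv (e 1)) (T x)"
    using op_symmetry(1)[of "e 1" "deriv (e 1)"] pair_identities(3)[of "deriv (e 1)"] by (simp add: sps)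
  have t4: "ip (deriv (e 1)) (T x) = - ip x (T (deriv (e 1)))"
    using op_symmetry(6)[of "deriv (e 1)" x] by (simp add: sps)
  show ?thesis using E t1 t2 t3 t4 by linarith
qed

lemma ip_x_h8: "ip x h8 = 0"
  using pair_identities(2)[of x] ip_x_L[of "deriv x"] unfolding h8_def by (simp add: sps)

lemma ip_x_h9: "ip x h9 = 0"
proof -
  have E: "ip x h9 = 1 / 2 * ip x (L2 x) + ip x (L1 (deriv (e 1)))"
    unfolding h9_def by (simp add: ip_expand)
  then show ?thesis
    using pair_identities(6)[of x] ip_x_L[of "deriv (e 2)"] by (simp add: sps)
qed

lemma ip_x_h10: "ip x (T x) = 0"
  using ip_Od_self sps by simp

lemma ip_x_h11: "ip x (L1 x) = 0"
  using pair_identities(4)[of x] ip_x_L[of "deriv (e 1)"] by (simp add: sps)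

end

section \<open>The modulation equation\<close>

lemma funpow_deriv_lin5:
  assumes "smooth_periodic f1" "smooth_periodic f2" "smooth_periodic f3" "smooth_periodic f4" "smooth_periodic f5"
  shows "(deriv ^^ n) (\<lambda>z. c1 * f1 z + c2 * f2 z + c3 * f3 z + c4 * f4 z + c5 * f5 z)
    = (\<lambda>z. c1 * (deriv ^^ n) f1 z + c2 * (deriv ^^ n) f2 z + c3 * (deriv ^^ n) f3 z
        + c4 * (deriv ^^ n) f4 z + c5 * (deriv ^^ n) f5 z)"
proof -
  note s = assms sp_add sp_cmult
  have "(deriv ^^ n) (\<lambda>z. 1 * (1 * (1 * (c1 * f1 z + c2 * f2 z) + c3 * f3 z) + c4 * f4 z) + c5 * f5 z)
    = (\<lambda>z. 1 * (1 * (1 * (c1 * (deriv ^^ n) f1 z + c2 * (deriv ^^ n) f2 z) + c3 * (deriv ^^ n) f3 z)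
        + c4 * (deriv ^^ n) f4 z) + c5 * (deriv ^^ n) f5 z)"
    by (subst funpow_deriv_lin, (intro s)[1], (intro s)[1])+ (rule refl)
  then show ?thesis by simp
qed

lemma Od_lin5:
  assumes "smooth_periodic f1" "smooth_periodic f2" "smooth_periodic f3" "smooth_periodic f4" "smooth_periodic f5"
  shows "Od a b (\<lambda>z. c1 * f1 z + c2 * f2 z + c3 * f3 z + c4 * f4 z + c5 * f5 z) z
    = c1 * Od a b f1 z + c2 * Od a b f2 z + c3 * Od a b f3 z + c4 * Od a b f4 z + c5 * Od a b f5 z"
  unfolding Od_def funpow_deriv_lin5[OF assms] funpow_deriv_lin5[OF assms, of 1, simplified]
  by (simp add: algebra_simps)

lemma Ev_lin5:
  assumes "smooth_periodic f1" "smooth_periodic f2" "smooth_periodic f3" "smooth_periodic f4" "smooth_periodic f5"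
  shows "Ev a b v (\<lambda>z. c1 * f1 z + c2 * f2 z + c3 * f3 z + c4 * f4 z + c5 * f5 z) z
    = c1 * Ev a b v f1 z + c2 * Ev a b v f2 z + c3 * Ev a b v f3 z + c4 * Ev a b v f4 z + c5 * Ev a b v f5 z"
  unfolding Ev_def funpow_deriv_lin5[OF assms] by (simp add: algebra_simps)

lemma smooth_periodic_fst_iff:
  "smooth_periodic_fst w \<longleftrightarrow> smooth2 UNIV w \<and> (\<forall>X. smooth_periodic (\<lambda>z. w z X))"
  using smooth2_section1[of UNIV w] by (auto simp: smooth_periodic_fst_def smooth_periodic_def)

context critical_wave
begin

lemma residual_coeffs_op:
  fixes q :: "real \<Rightarrow> real" and \<theta> X :: real
  assumes q: "smooth_on UNIV q"
    and w: "smooth2 UNIV w2" "smooth2 UNIV w3" "smooth2 UNIV w4"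
  defines "Q \<equiv> \<lambda>n. (deriv ^^ n) q X"
  shows "residual_coeff \<sigma> V u k0 q w2 w3 w4 0 \<theta> X = 0" (is ?g1)
    and "residual_coeff \<sigma> V u k0 q w2 w3 w4 1 \<theta> X = 0" (is ?g2)
    and "residual_coeff \<sigma> V u k0 q w2 w3 w4 2 \<theta> X = Q 1 * G \<theta> + L (\<lambda>z. w2 z X) \<theta>" (is ?g3)
    and "residual_coeff \<sigma> V u k0 q w2 w3 w4 3 \<theta> X =
      Q 2 * (S (e 1) \<theta> + 4 * k0 * deriv x \<theta>) + T (\<lambda>z. pd2 w2 z X) \<theta> + L (\<lambda>z. w3 z X) \<theta>
      + Q 0 * (Q 1 * G1 \<theta> + L1 (\<lambda>z. w2 z X) \<theta>)" (is ?g4)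
    and "residual_coeff \<sigma> V u k0 q w2 w3 w4 4 \<theta> X =
      Q 3 * (4 * k0 * deriv (e 1) \<theta> + x \<theta>)
      + (Q 1)^2 * (S (e 2) \<theta> + S1 (e 1) \<theta> + 3 * deriv x \<theta>)
      + S (\<lambda>z. pd2 (pd2 w2) z X) \<theta> + Q 1 * S (deriv (\<lambda>z. w2 z X)) \<theta> + T (\<lambda>z. pd2 w3 z X) \<theta>
      + L (\<lambda>z. w4 z X) \<theta> + 1 / 2 * W 3 \<theta> * (w2 \<theta> X)^2
      + Q 0 * (Q 2 * (S1 (e 1) \<theta> + S (e 2) \<theta> + 4 * deriv x \<theta> + 4 * k0 * deriv (deriv (e 1)) \<theta>)
        + T1 (\<lambda>z. pd2 w2 z X) \<theta> + L1 (\<lambda>z. w3 z X) \<theta>)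
      + 1 / 2 * (Q 0)^2 * (Q 1 * G2 \<theta> + L2 (\<lambda>z. w2 z X) \<theta>)" (is ?g5)
proof -
  have W: "(deriv ^^ n) V (u \<theta> k0) = W n \<theta>" for n by (simp add: W_def)
  note rc = residual_coeffs[OF q w, of \<theta> X, unfolded pdd_e W, unfolded pdd_eq_deriv]
  show ?g1 ?g2
    using rc by blast+
  note defs = Q_def G_def G1_def G2_def Od_def Ev_def
  show ?g3
    unfolding rc defs by (simp add: numeral_eq_Suc algebra_simps)
  show ?g4
    unfolding rc defs by (simp add: numeral_eq_Suc algebra_simps)
  show ?g5
    unfolding rc defs by (simp add: numeral_eq_Suc field_simps)
qed

end

context second_corrected_wave
begin

lemma fourth_coeff:
  fixes q \<alpha> \<beta> :: "real \<Rightarrow> real"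
  assumes q: "smooth_on UNIV q" and ab: "smooth_on UNIV \<alpha>" "smooth_on UNIV \<beta>"
    and w: "smooth2 UNIV w2" "smooth2 UNIV w3" "smooth2 UNIV w4"
    and w2: "\<And>z X. w2 z X = deriv q X * y3 z + \<alpha> X * x z"
    and w3: "\<And>z X. w3 z X = (deriv ^^ 2) q X * y4 z + deriv \<alpha> X * e 1 z + q X * deriv q X * \<eta> z
      + q X * \<alpha> X * deriv (e 1) z + \<beta> X * x z"
  shows "residual_coeff \<sigma> V u k0 q w2 w3 w4 4 \<theta> X =
      L (\<lambda>z. w4 z X) \<theta> + (deriv ^^ 3) q X * h1 \<theta> + (deriv q X)^2 * h2 \<theta>
      + q X * (deriv ^^ 2) q X * h3 \<theta> + (q X)^2 * deriv q X * h4 \<theta>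
      + (deriv ^^ 2) \<alpha> X * h5 \<theta> + deriv q X * \<alpha> X * h6 \<theta> + q X * deriv \<alpha> X * h7 \<theta>
      + (\<alpha> X)^2 / 2 * h8 \<theta> + (q X)^2 * \<alpha> X * h9 \<theta> + deriv \<beta> X * T x \<theta> + q X * \<beta> X * L1 x \<theta>"
proof -
  define q1 q2 q3 a1 a2 b1 where d: "q1 = deriv q" "q2 = deriv q1" "q3 = deriv q2"
    "a1 = deriv \<alpha>" "a2 = deriv a1" "b1 = deriv \<beta>"
  have D: "(q has_real_derivative q1 X) (at X)" "(q1 has_real_derivative q2 X) (at X)"
    "(q2 has_real_derivative q3 X) (at X)" "(\<alpha> has_real_derivative a1 X) (at X)"
    "(a1 has_real_derivative a2 X) (at X)" "(\<beta> has_real_derivative b1 X) (at X)" for X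
    unfolding d using q ab by (auto intro!: smooth_has_deriv smooth_deriv)
  have nq: "deriv q = q1" "(deriv ^^ 2) q = q2" "(deriv ^^ 3) q = q3" "(deriv ^^ 2) \<alpha> = a2"
    "deriv \<alpha> = a1" "deriv \<beta> = b1" "(deriv ^^ 0) q = q" "(deriv ^^ 1) q = q1"
    unfolding d by (simp_all add: numeral_eq_Suc)
  have p1: "pd2 w2 = (\<lambda>z X. q2 X * y3 z + a1 X * x z)"
    unfolding pd2_def w2 nq by (intro ext DERIV_imp_deriv) (auto intro!: derivative_eq_intros D)
  have p2: "pd2 (pd2 w2) z X = q3 X * y3 z + a2 X * x z" for z X
    unfolding p1 unfolding pd2_def by (intro DERIV_imp_deriv) (auto intro!: derivative_eq_intros D)
  have p3: "pd2 w3 z X = q3 X * y4 z + a2 X * e 1 z + (q1 X * q1 X + q X * q2 X) * \<eta> z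
      + (q1 X * \<alpha> X + q X * a1 X) * deriv (e 1) z + b1 X * x z" for z X
    unfolding pd2_def w3 nq by (intro DERIV_imp_deriv)
      (auto intro!: derivative_eq_intros D simp: algebra_simps)
  have dw2: "deriv (\<lambda>z. q1 X * y3 z + \<alpha> X * x z) = (\<lambda>z. q1 X * deriv y3 z + \<alpha> X * deriv x z)"
    using funpow_deriv_lin[OF sp_y3 sp_deriv[OF sp_e], of 1] by simp
  have lin2: "Ev a b v (\<lambda>z. c1 * y3 z + c2 * x z) \<theta> = c1 * Ev a b v y3 \<theta> + c2 * Ev a b v x \<theta>"
    "Od a b (\<lambda>z. c1 * y3 z + c2 * x z) \<theta> = c1 * Od a b y3 \<theta> + c2 * Od a b x \<theta>"
    "Ev a b v (\<lambda>z. c1 * deriv y3 z + c2 * deriv x z) \<theta> = c1 * Ev a b v (deriv y3) \<theta> + c2 * Ev a b v (deriv x) \<theta>"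
    for a b v c1 c2
    by (simp_all add: Ev_lin Od_lin sp)
  have sp5: "smooth_periodic y4" "smooth_periodic (e 1)" "smooth_periodic \<eta>" "smooth_periodic (deriv (e 1))"
    "smooth_periodic x" by (simp_all add: sp)
  show ?thesis
    unfolding residual_coeffs_op(5)[OF q w] p2 p3 unfolding p1 unfolding w2 w3 nq dw2 lin2 Od_lin5[OF sp5]
      Ev_lin5[OF sp5] h1_def h2_def h3_def h4_def h5_def h6_def h7_def h8_def h9_def
    by (simp add: field_simps power2_eq_square)
qed

lemma second_third_coeff:
  fixes q \<alpha> :: "real \<Rightarrow> real" and \<beta> :: real
  assumes q: "smooth_on UNIV q" and a: "smooth_on UNIV \<alpha>"
    and w: "smooth2 UNIV w2" "smooth2 UNIV w3" "smooth2 UNIV w4"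
    and w2: "\<And>z X. w2 z X = deriv q X * y3 z + \<alpha> X * x z"
  shows "residual_coeff \<sigma> V u k0 q w2 w3 w4 3 \<theta> X = L (\<lambda>z. w3 z X) \<theta>
    - L (\<lambda>z. (deriv ^^ 2) q X * y4 z + deriv \<alpha> X * e 1 z + q X * deriv q X * \<eta> z
      + q X * \<alpha> X * deriv (e 1) z + \<beta> * x z) \<theta>"
proof -
  define q1 q2 a1 where d: "q1 = deriv q" "q2 = deriv q1" "a1 = deriv \<alpha>"
  have D: "(q has_real_derivative q1 X) (at X)" "(q1 has_real_derivative q2 X) (at X)"
    "(\<alpha> has_real_derivative a1 X) (at X)" for X
    unfolding d using q a by (auto intro!: smooth_has_deriv smooth_deriv)
  have nq: "deriv q = q1" "(deriv ^^ 2) q = q2" "deriv \<alpha> = a1" "(deriv ^^ 0) q = q" "(deriv ^^ 1) q = q1"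
    unfolding d by (simp_all add: numeral_eq_Suc)
  have p1: "pd2 w2 z X = q2 X * y3 z + a1 X * x z" for z X
    unfolding pd2_def w2 nq by (intro DERIV_imp_deriv) (auto intro!: derivative_eq_intros D)
  have lin2: "Ev a b v (\<lambda>z. c1 * y3 z + c2 * x z) \<theta> = c1 * Ev a b v y3 \<theta> + c2 * Ev a b v x \<theta>"
    "Od a b (\<lambda>z. c1 * y3 z + c2 * x z) \<theta> = c1 * Od a b y3 \<theta> + c2 * Od a b x \<theta>"
    for a b v c1 c2
    by (simp_all add: Ev_lin Od_lin sp)
  have sp5: "smooth_periodic y4" "smooth_periodic (e 1)" "smooth_periodic \<eta>" "smooth_periodic (deriv (e 1))"
    "smooth_periodic x" by (simp_all add: sp)
  show ?thesis
    unfolding residual_coeffs_op(4)[OF q w] p1 w2 nq lin2 Ev_lin5[OF sp5] L_y4 L_eta wave_identities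
    by (simp add: algebra_simps)
qed

text \<open>Any admissible correction agrees with the particular one up to kernel components
  \<open>\<alpha>(X) \<xi>\<^sub>1\<close> and \<open>\<beta>(X) \<xi>\<^sub>1\<close>.\<close>

lemma corrections_imp_equation:
  assumes q: "smooth_on UNIV q"
    and w: "smooth_periodic_fst w2" "smooth_periodic_fst w3" "smooth_periodic_fst w4"
    and res: "\<And>j \<theta> X. j \<le> 4 \<Longrightarrow> residual_coeff \<sigma> V u k0 q w2 w3 w4 j \<theta> X = 0"
  shows "ip x h1 * (deriv ^^ 3) q X + 1 / 2 * (deriv ^^ 3) (action \<sigma> u) k0 * (q X)^2 * deriv q X = 0"
proof -
  have sw: "smooth2 UNIV w2" "smooth2 UNIV w3" "smooth2 UNIV w4"
    and pw: "\<And>X. smooth_periodic (\<lambda>z. w2 z X)" "\<And>X. smooth_periodic (\<lambda>z. w3 z X)"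
      "\<And>X. smooth_periodic (\<lambda>z. w4 z X)"
    using w by (auto simp: smooth_periodic_fst_iff)
  obtain z0 where z0: "x z0 \<noteq> 0" using x_nonzero by blast
  note sq = smooth_funpow_deriv[OF q]
  have sq1: "smooth_on UNIV (deriv q)" by (rule smooth_deriv[OF q])
  \<comment> \<open>Dividing at one point \<open>z0\<close> off the zeros of \<open>u\<^sub>z\<close> exhibits the kernel component as a smooth function.\<close>
  define \<alpha> where "\<alpha> = (\<lambda>X. w2 z0 X * (1 / x z0) + deriv q X * (- y3 z0 / x z0))"
  have sa: "smooth_on UNIV \<alpha>"
    unfolding \<alpha>_def by (intro smooth_on_add[OF open_UNIV] smooth_on_mult[OF open_UNIV] smooth_on_const sq1 smooth2_section2[OF sw(1)])
  have w2: "w2 z X = deriv q X * y3 z + \<alpha> X * x z" for z X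
  proof -
    have "L (\<lambda>z. 1 * w2 z X + (- deriv q X) * y3 z) \<theta> = 0" for \<theta>
      using res[of 2 \<theta> X] unfolding residual_coeffs_op(3)[OF q sw] Ev_lin[OF pw(1) sp_y3] L_y3 by simp
    then obtain c where c: "(\<lambda>z. 1 * w2 z X + (- deriv q X) * y3 z) = (\<lambda>z. c * x z)"
      using kernel_L[OF sp_add[OF sp_cmult[OF pw(1)] sp_cmult[OF sp_y3]]] by blast
    have c': "w2 z X - deriv q X * y3 z = c * x z" for z using fun_cong[OF c, of z] by simp
    have "c = \<alpha> X" using c'[of z0] z0 by (simp add: \<alpha>_def field_simps)
    then show ?thesis using c'[of z] by simp
  qed
  define r where "r = (\<lambda>z X. (deriv ^^ 2) q X * y4 z + deriv \<alpha> X * e 1 z + q X * deriv q X * \<eta> z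
      + q X * \<alpha> X * deriv (e 1) z)"
  define \<beta> where "\<beta> = (\<lambda>X. w3 z0 X * (1 / x z0) + (- 1 / x z0) * ((deriv ^^ 2) q X * y4 z0
    + deriv \<alpha> X * e 1 z0 + q X * deriv q X * \<eta> z0 + q X * \<alpha> X * deriv (e 1) z0))"
  have sb: "smooth_on UNIV \<beta>"
    unfolding \<beta>_def
    by (intro smooth_on_add[OF open_UNIV] smooth_on_mult[OF open_UNIV] smooth_on_const sq q sq1 sa smooth_deriv[OF sa] smooth2_section2[OF sw(2)])
  have sr: "smooth_periodic (\<lambda>z. r z X)" for X
    unfolding r_def by (intro sp_add sp_cmult sp_e sp_deriv sp_y4 sp_eta)
  have w3: "w3 z X = r z X + \<beta> X * x z" for z X
  proof -
    have "L (\<lambda>z. w3 z X) \<theta> - L (\<lambda>z. r z X + 0 * x z) \<theta> = 0" for \<theta>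
      using res[of 3 \<theta> X] unfolding second_third_coeff[OF q sa sw w2, where \<beta> = 0] r_def by simp
    then have "L (\<lambda>z. 1 * w3 z X + (- 1) * r z X) \<theta> = 0" for \<theta>
      unfolding Ev_lin[OF pw(2) sr] by simp
    then obtain c where c: "(\<lambda>z. 1 * w3 z X + (- 1) * r z X) = (\<lambda>z. c * x z)"
      using kernel_L[OF sp_add[OF sp_cmult[OF pw(2)] sp_cmult[OF sr]]] by blast
    have c': "w3 z X - r z X = c * x z" for z using fun_cong[OF c, of z] by simp
    have "c = \<beta> X" using c'[of z0] z0 by (simp add: \<beta>_def r_def field_simps)
    then show ?thesis using c'[of z] by simp
  qed
  define Z where "Z = (\<lambda>\<theta>. L (\<lambda>z. w4 z X) \<theta> + (deriv ^^ 3) q X * h1 \<theta> + (deriv q X)^2 * h2 \<theta>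
      + q X * (deriv ^^ 2) q X * h3 \<theta> + (q X)^2 * deriv q X * h4 \<theta>
      + (deriv ^^ 2) \<alpha> X * h5 \<theta> + deriv q X * \<alpha> X * h6 \<theta> + q X * deriv \<alpha> X * h7 \<theta>
      + (\<alpha> X)^2 / 2 * h8 \<theta> + (q X)^2 * \<alpha> X * h9 \<theta> + deriv \<beta> X * T x \<theta> + q X * \<beta> X * L1 x \<theta>)"
  have Z0: "Z = (\<lambda>\<theta>. 0)"
  proof
    fix \<theta>
    show "Z \<theta> = 0"
      using res[of 4 \<theta> X] fourth_coeff[OF q sa sb sw w2 w3[unfolded r_def], of \<theta> X] by (simp add: Z_def)
  qed
  have "ip x Z = ip x (L (\<lambda>z. w4 z X)) + (deriv ^^ 3) q X * ip x h1 + (deriv q X)^2 * ip x h2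
      + q X * (deriv ^^ 2) q X * ip x h3 + (q X)^2 * deriv q X * ip x h4
      + (deriv ^^ 2) \<alpha> X * ip x h5 + deriv q X * \<alpha> X * ip x h6 + q X * deriv \<alpha> X * ip x h7
      + (\<alpha> X)^2 / 2 * ip x h8 + (q X)^2 * \<alpha> X * ip x h9 + deriv \<beta> X * ip x (T x) + q X * \<beta> X * ip x (L1 x)"
    unfolding Z_def by (simp only: ip_expand sp_h pw)
  then have "ip x Z = (deriv ^^ 3) q X * ip x h1 + (q X)^2 * deriv q X * ip x h4"
    unfolding ip_x_L[OF pw(3)] ip_x_h2 ip_x_h3 ip_x_h5 ip_x_h6 ip_x_h7 ip_x_h8 ip_x_h9 ip_x_h10 ip_x_h11
    by simp
  then show ?thesis unfolding Z0 ip_x_h4 by (simp add: ip_def algebra_simps)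
qed

text \<open>The kernel components are taken to be zero.  At order four \<open>L\<close> is inverted on each profile after projecting it
  off \<open>u\<^sub>z\<close>, so that \<open>w4\<close> is a finite sum of products and hence smooth; the projections add up to the left-hand
  side of the modulation equation.\<close>

lemma equation_imp_corrections:
  assumes q: "smooth_on UNIV q"
    and eq: "\<And>X. ip x h1 * (deriv ^^ 3) q X + 1 / 2 * (deriv ^^ 3) (action \<sigma> u) k0 * (q X)^2 * deriv q X = 0"
  shows "\<exists>w2 w3 w4. smooth_periodic_fst w2 \<and> smooth_periodic_fst w3 \<and> smooth_periodic_fst w4 \<and>
    (\<forall>j\<le>4. \<forall>\<theta> X. residual_coeff \<sigma> V u k0 q w2 w3 w4 j \<theta> X = 0)"
proof -
  define N where "N = ip x x"
  obtain z0 where "x z0 \<noteq> 0" using x_nonzero by blast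
  then have N: "N > 0" unfolding N_def by (intro ip_self_pos) (simp_all add: sps)
  have "\<exists>c. smooth_periodic c \<and> L c = (\<lambda>z. h z - ip x h / N * x z)" if h: "smooth_periodic h" for h
  proof (rule fredholm)
    have c: "ip x h / N * N = ip x h" using N by simp
    have "ip x (\<lambda>z. h z - c * x z) = ip x h - c * N" for c
      unfolding N_def by (simp add: ip_diff ip_cmult h sps)
    from this[of "ip x h / N"] show "ip x (\<lambda>z. h z - ip x h / N * x z) = 0"
      unfolding c by simp
  qed (intro sps h)
  note ch = this
  obtain c1 where c1: "smooth_periodic c1" "L c1 = (\<lambda>z. h1 z - ip x h1 / N * x z)" using ch[OF sp_h(1)] by blast
  obtain c2 where c2: "smooth_periodic c2" "L c2 = (\<lambda>z. h2 z - ip x h2 / N * x z)" using ch[OF sp_h(2)] by blast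
  obtain c3 where c3: "smooth_periodic c3" "L c3 = (\<lambda>z. h3 z - ip x h3 / N * x z)" using ch[OF sp_h(3)] by blast
  obtain c4 where c4: "smooth_periodic c4" "L c4 = (\<lambda>z. h4 z - ip x h4 / N * x z)" using ch[OF sp_h(4)] by blast
  note sq = smooth_funpow_deriv[OF q]
  have sq1: "smooth_on UNIV (deriv q)" by (rule smooth_deriv[OF q])
  define w2 where "w2 = (\<lambda>z X. y3 z * deriv q X)"
  define w3 where "w3 = (\<lambda>z X. y4 z * (deriv ^^ 2) q X + \<eta> z * (q X * deriv q X))"
  define w4 where "w4 = (\<lambda>z X. c1 z * (- 1 * (deriv ^^ 3) q X) + c2 z * (- 1 * (deriv q X * deriv q X))
    + c3 z * (- 1 * (q X * (deriv ^^ 2) q X)) + c4 z * (- 1 * (q X * q X * deriv q X)))"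
  have sw: "smooth2 UNIV w2" "smooth2 UNIV w3" "smooth2 UNIV w4"
    unfolding w2_def w3_def w4_def
    by (intro smooth2_add[OF open_UNIV] smooth2_prod sp_smooth[OF sp_y3] sp_smooth[OF sp_y4] sp_smooth[OF sp_eta]
        sp_smooth[OF c1(1)] sp_smooth[OF c2(1)] sp_smooth[OF c3(1)] sp_smooth[OF c4(1)]
        smooth_on_mult[OF open_UNIV] smooth_on_const sq sq1 q)+
  have pw: "smooth_periodic (\<lambda>z. w2 z X)" "smooth_periodic (\<lambda>z. w3 z X)" "smooth_periodic (\<lambda>z. w4 z X)" for X
    unfolding w2_def w3_def w4_def by (intro sp_add sp_mult sp_const sp_y3 sp_y4 sp_eta c1 c2 c3 c4)+
  have z: "smooth_on UNIV (\<lambda>X::real. 0::real)" by (rule smooth_on_const)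
  have zero2: "(deriv ^^ 2) (\<lambda>_::real. 0::real) X = 0" for X by (simp add: numeral_2_eq_2)
  have w2: "w2 z X = deriv q X * y3 z + 0 * x z" for z X by (simp add: w2_def)
  have w3: "w3 z X = (deriv ^^ 2) q X * y4 z + deriv (\<lambda>_. 0) X * e 1 z + q X * deriv q X * \<eta> z
      + q X * 0 * deriv (e 1) z + 0 * x z" for z X by (simp add: w3_def)
  have r2: "residual_coeff \<sigma> V u k0 q w2 w3 w4 2 \<theta> X = 0" for \<theta> X
    unfolding residual_coeffs_op(3)[OF q sw] w2 Ev_lin[OF sp_y3 sps(4)[OF sps(1)]] L_y3 by simp
  have r3: "residual_coeff \<sigma> V u k0 q w2 w3 w4 3 \<theta> X = 0" for \<theta> X
    unfolding second_third_coeff[OF q z sw w2, where \<beta> = 0] w3 by simp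
  have r4: "residual_coeff \<sigma> V u k0 q w2 w3 w4 4 \<theta> X = 0" for \<theta> X
  proof -
    have "(\<lambda>z. w4 z X) = (\<lambda>z. (- (deriv ^^ 3) q X) * c1 z + (- ((deriv q X)^2)) * c2 z
        + (- (q X * (deriv ^^ 2) q X)) * c3 z + (- ((q X)^2 * deriv q X)) * c4 z + 0 * x z)"
      by (simp add: w4_def power2_eq_square mult_ac)
    then have "L (\<lambda>z. w4 z X) \<theta> = (- (deriv ^^ 3) q X) * L c1 \<theta> + (- ((deriv q X)^2)) * L c2 \<theta>
        + (- (q X * (deriv ^^ 2) q X)) * L c3 \<theta> + (- ((q X)^2 * deriv q X)) * L c4 \<theta> + 0 * L x \<theta>"
      by (simp only: Ev_lin5[OF c1(1) c2(1) c3(1) c4(1) sps(4)[OF sps(1)]])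
    then have "residual_coeff \<sigma> V u k0 q w2 w3 w4 4 \<theta> X
      = ((deriv ^^ 3) q X * ip x h1 + (q X)^2 * deriv q X * ip x h4) / N * x \<theta>"
      using fourth_coeff[OF q z z sw w2 w3, of \<theta> X]
      by (simp add: zero2 c1(2) c2(2) c3(2) c4(2) ip_x_h2 ip_x_h3 algebra_simps add_divide_distrib)
    moreover have "(deriv ^^ 3) q X * ip x h1 + (q X)^2 * deriv q X * ip x h4 = 0"
      using eq[of X] by (simp add: ip_x_h4 algebra_simps)
    ultimately show ?thesis by simp
  qed
  have "residual_coeff \<sigma> V u k0 q w2 w3 w4 j \<theta> X = 0" if "j \<le> 4" for j \<theta> X
  proof -
    have "j = 0 \<or> j = 1 \<or> j = 2 \<or> j = 3 \<or> j = 4" using that by auto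
    then show ?thesis using residual_coeffs_op(1,2)[OF q sw] r2 r3 r4 by blast
  qed
  then show ?thesis using sw pw by (intro exI[of _ w2] exI[of _ w3] exI[of _ w4]) (auto simp: smooth_periodic_fst_iff)
qed

end

context critical_wave
begin

lemma is_xi34_iff:
  "is_xi34 \<sigma> V u k0 y3 y4 \<longleftrightarrow> smooth_periodic y3 \<and> smooth_periodic y4 \<and> L y3 = (\<lambda>z. - G z) \<and>
    L y4 = (\<lambda>z. - (T y3 z + S (e 1) z + 4 * k0 * deriv x z))"
proof -
  have x: "xi2 u k0 = e 1" "xi1 u k0 = x"
    using pdd_e[of 1 0] by (auto simp: xi1_def xi2_def e_def fun_eq_iff)
  have r3: "- (4 * k0^3 * (deriv ^^ 3) (e 1) z + 2 * \<sigma> * k0 * deriv (e 1) z)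
        - (6 * k0^2 * (deriv ^^ 2) x z + \<sigma> * x z) = - G z" for z
    by (simp add: G_def Od_def Ev_def)
  have r4: "- (4 * k0^3 * (deriv ^^ 3) y3 z + 2 * \<sigma> * k0 * deriv y3 z)
        - (6 * k0^2 * (deriv ^^ 2) (e 1) z + \<sigma> * e 1 z) - 4 * k0 * deriv x z
      = - (T y3 z + S (e 1) z + 4 * k0 * deriv x z)" for z
    by (simp add: Od_def Ev_def)
  show ?thesis
    unfolding is_xi34_def x L0_eq r3 r4 fun_eq_iff by blast
qed

text \<open>\<open>K_const\<close> is the inner product of \<open>u\<^sub>z\<close> with the profile \<open>h1\<close> of \<open>q'''\<close>, so the equation is the
  solvability condition at order four.\<close>

lemma solvability_equation:
  assumes q: "smooth_on UNIV q" and xi: "is_xi34 \<sigma> V u k0 y3 y4"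
  shows "(\<exists>w2 w3 w4. smooth_periodic_fst w2 \<and> smooth_periodic_fst w3 \<and> smooth_periodic_fst w4 \<and>
      (\<forall>j\<le>4. \<forall>\<theta> X. residual_coeff \<sigma> V u k0 q w2 w3 w4 j \<theta> X = 0)) \<longleftrightarrow>
    (\<forall>X. K_const \<sigma> u k0 y3 y4 * (deriv ^^ 3) q X
       + 1/2 * (deriv ^^ 3) (action \<sigma> u) k0 * (q X)^2 * deriv q X = 0)"
proof -
  note y = xi[unfolded is_xi34_iff]
  interpret C: corrected_wave \<sigma> k0 V u I y3 by unfold_locales (use y in auto)
  obtain \<eta> where \<eta>: "smooth_periodic \<eta>" "L \<eta> = (\<lambda>z. - (G1 z + L1 y3 z))" using C.eta_exists by blast
  interpret D: second_corrected_wave \<sigma> k0 V u I y3 y4 \<eta> by unfold_locales (use y \<eta> in auto)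
  have px: "pd1 u z k0 = x z" "pd2 (pd1 u) z k0 = deriv (e 1) z" for z
    using pdd_e[of 1 0 z] pdd_e[of 1 1 z] pd2_pdd[OF I_open u_smooth k0, of 1 0 z] by simp_all
  have K: "K_const \<sigma> u k0 y3 y4 = ip x D.h1"
    unfolding K_const_def px D.h1_def by (simp add: Od_def Ev_def algebra_simps)
  show ?thesis
    unfolding K using D.corrections_imp_equation[OF q] D.equation_imp_corrections[OF q] by blast
qed

lemma xi34_exists: "\<exists>y3 y4. is_xi34 \<sigma> V u k0 y3 y4"
proof -
  obtain y3 where y3: "smooth_periodic y3" "L y3 = (\<lambda>z. - G z)" using xi3_exists by blast
  interpret C: corrected_wave \<sigma> k0 V u I y3 by unfold_locales (use y3 in auto)
  from C.y4_exists y3 show ?thesis unfolding is_xi34_iff by blast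
qed

end

theorem mainTheorem5:
  fixes \<sigma> k0 :: real
    and V q \<phi> :: "real \<Rightarrow> real"
    and u :: "real \<Rightarrow> real \<Rightarrow> real"
    and I :: "real set"
  assumes V_smooth: "smooth_on UNIV V"
    and I_open: "open I" and I_interval: "is_interval I" and I_nonzero: "0 \<notin> I"
    and u_smooth: "smooth_on (UNIV \<times> I) (\<lambda>(z, k). u z k)"
    and u_periodic: "\<And>k. k \<in> I \<Longrightarrow> periodic_fun_simple (\<lambda>z. u z k) (2 * pi)"
    and u_nonconst: "\<And>k. k \<in> I \<Longrightarrow> \<not> (\<lambda>z. u z k) constant_on UNIV"
    and u_ode: "\<And>k z. k \<in> I \<Longrightarrow>
          k^4 * (pd1 ^^ 4) u z k + \<sigma> * k^2 * (pd1 ^^ 2) u z k + deriv V (u z k) = 0"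
    and k0: "k0 \<in> I"
    and A_k: "deriv (action \<sigma> u) k0 = 0"
    and A_kk: "(deriv ^^ 2) (action \<sigma> u) k0 = 0"
    and kernel: "{f. smooth_periodic f \<and> (\<forall>z. L0 \<sigma> V u k0 f z = 0)}
          = {f. \<exists>c. f = (\<lambda>z. c * pd1 u z k0)}"
    and q_smooth: "smooth_on UNIV q"
    and phi: "\<And>X. (\<phi> has_real_derivative q X) (at X)"
  shows "(\<exists>\<xi>3 \<xi>4. is_xi34 \<sigma> V u k0 \<xi>3 \<xi>4) \<and>
    (\<forall>\<xi>3 \<xi>4. is_xi34 \<sigma> V u k0 \<xi>3 \<xi>4 \<longrightarrow>
      ((\<exists>w2 w3 w4. smooth_periodic_fst w2 \<and> smooth_periodic_fst w3 \<and> smooth_periodic_fst w4 \<and>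
          (\<forall>j\<le>4. \<forall>\<theta> X. residual_coeff \<sigma> V u k0 q w2 w3 w4 j \<theta> X = 0))
       \<longleftrightarrow>
       (\<forall>X. K_const \<sigma> u k0 \<xi>3 \<xi>4 * (deriv ^^ 3) q X
            + 1/2 * (deriv ^^ 3) (action \<sigma> u) k0 * (q X)^2 * deriv q X = 0)))"
proof -
  have family: "wave_family \<sigma> k0 V u I"
    by (rule wave_family.intro) (fact V_smooth I_open I_interval u_smooth u_ode k0)+
  have k0_nz: "k0 \<noteq> 0" using k0 I_nonzero by auto
  have "critical_wave_axioms \<sigma> k0 V u I"
    by (rule critical_wave_axioms.intro) (fact k0_nz u_periodic u_nonconst[OF k0] A_k A_kk kernel)+
  with family interpret critical_wave \<sigma> k0 V u I by (rule critical_wave.intro)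
  show ?thesis using xi34_exists solvability_equation[OF q_smooth] by blast
qed

end
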